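(* Let $H:(0,\infty)\to\mathbb C^{2n\times 2n}$ be measurable, locally integrable on $[0,\infty)$ near $0$ (i.e. $H\in L^1(0,c)$ for some $c>0$) and on compact subintervals, with $H(x)\ge0$ a.e., and definite on $(0,\infty)$. Then both deficiency indices of $H$ are equal to $n$ if and only if $$\lim_{x\to\infty}f_0(x)^*Jh_0(x)=0\quad\text{for all }(f,g),(h,k)\in\mathcal T.$$
   Context: $J=\begin{pmatrix}0&-I_n\\ I_n&0\end{pmatrix}$. $H$ definite on $(0,\infty)$: for $v\in\mathbb C^{2n}$, $H(x)v=0$ for a.e. $x$ implies $v=0$. $L_H^2(0,\infty)$: measurable $f$ with $\int_0^\infty f^*Hf<\infty$ modulo null functions for this seminorm. Maximal relation $\mathcal T=\{(f,g)\in L_H^2(0,\infty)^2:f$ has an absolutely continuous representative $f_0$ with $Jf_0'=-Hg$ a.e.$\}$; by definiteness $f_0$ is uniquely determined. The deficiency indices of $H$ are $\dim\ker(\mathcal T-i)$ and $\dim\ker(\mathcal T+i)$. *)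

theory Defs
  imports "HOL-Analysis.Analysis"
begin

text \<open>Vectors in C^(2n) are indexed by the type 'n + 'n (first block Inl, second block Inr),
  so n = CARD('n). Matrices are complex^('n+'n)^('n+'n).\<close>

definition Jmat :: "complex^('n::finite + 'n)^('n + 'n)" where
  "Jmat = (\<chi> i j. (case (i, j) of
       (Inl a, Inr b) \<Rightarrow> (if a = b then -1 else 0)
     | (Inr a, Inl b) \<Rightarrow> (if a = b then 1 else 0)
     | _ \<Rightarrow> 0))"

definition hip :: "complex^'m::finite \<Rightarrow> complex^'m \<Rightarrow> complex" where
  "hip v w = (\<Sum>i\<in>UNIV. cnj (v $ i) * w $ i)"

definition psd :: "complex^'m::finite^'m \<Rightarrow> bool" where
  "psd A \<longleftrightarrow> (\<forall>i j. A $ i $ j = cnj (A $ j $ i)) \<and> (\<forall>v. 0 \<le> Re (hip v (A *v v)))"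

definition Hform :: "(real \<Rightarrow> complex^'m::finite^'m) \<Rightarrow> (real \<Rightarrow> complex^'m) \<Rightarrow> ennreal" where
  "Hform H f = (\<integral>\<^sup>+x\<in>{0<..}. ennreal (Re (hip (f x) (H x *v f x))) \<partial>lebesgue)"

definition L2H :: "(real \<Rightarrow> complex^'m::finite^'m) \<Rightarrow> (real \<Rightarrow> complex^'m) set" where
  "L2H H = {f. f \<in> borel_measurable lebesgue \<and> Hform H f < \<infinity>}"

definition Hnull :: "(real \<Rightarrow> complex^'m::finite^'m) \<Rightarrow> (real \<Rightarrow> complex^'m) \<Rightarrow> bool" where
  "Hnull H f \<longleftrightarrow> Hform H f = 0"

definition abs_cont_on :: "real \<Rightarrow> real \<Rightarrow> (real \<Rightarrow> 'b::real_normed_vector) \<Rightarrow> bool" where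
  "abs_cont_on a b f \<longleftrightarrow>
     (\<forall>\<epsilon>>0. \<exists>\<delta>>0. \<forall>(k::nat) s t.
        (\<forall>i<k. a \<le> s i \<and> s i \<le> t i \<and> t i \<le> b) \<and>
        disjoint_family_on (\<lambda>i. {s i<..<t i}) {..<k} \<and>
        (\<Sum>i<k. t i - s i) < \<delta>
        \<longrightarrow> (\<Sum>i<k. norm (f (t i) - f (s i))) < \<epsilon>)"

definition loc_abs_cont :: "(real \<Rightarrow> 'b::real_normed_vector) \<Rightarrow> bool" where
  "loc_abs_cont f \<longleftrightarrow> (\<forall>a b. 0 < a \<longrightarrow> a \<le> b \<longrightarrow> abs_cont_on a b f)"

definition T_rep :: "(real \<Rightarrow> complex^('n::finite + 'n)^('n + 'n)) \<Rightarrow>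
    (real \<Rightarrow> complex^('n + 'n)) \<Rightarrow> (real \<Rightarrow> complex^('n + 'n)) \<Rightarrow> (real \<Rightarrow> complex^('n + 'n)) \<Rightarrow> bool" where
  "T_rep H f g f0 \<longleftrightarrow> f \<in> L2H H \<and> g \<in> L2H H \<and> loc_abs_cont f0 \<and>
     Hnull H (\<lambda>x. f x - f0 x) \<and>
     (AE x in lebesgue. 0 < x \<longrightarrow>
        (\<exists>d. (f0 has_vector_derivative d) (at x) \<and> Jmat *v d = - (H x *v g x)))"

definition Tmax :: "(real \<Rightarrow> complex^('n::finite + 'n)^('n + 'n)) \<Rightarrow>
    (real \<Rightarrow> complex^('n + 'n)) \<Rightarrow> (real \<Rightarrow> complex^('n + 'n)) \<Rightarrow> bool" where
  "Tmax H f g \<longleftrightarrow> (\<exists>f0. T_rep H f g f0)"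

text \<open>dim ker(\<T> - \<mu>) in L^2_H (modulo H-null functions): the supremum of the sizes of
  families in the kernel that are linearly independent modulo null functions.\<close>
definition def_index :: "(real \<Rightarrow> complex^('n::finite + 'n)^('n + 'n)) \<Rightarrow> complex \<Rightarrow> enat" where
  "def_index H \<mu> = Sup {enat k | k. \<exists>fs :: nat \<Rightarrow> real \<Rightarrow> complex^('n + 'n).
       (\<forall>i<k. Tmax H (fs i) (\<lambda>x. \<mu> *s fs i x)) \<and>
       (\<forall>c :: nat \<Rightarrow> complex. Hnull H (\<lambda>x. \<Sum>i<k. c i *s fs i x) \<longrightarrow> (\<forall>i<k. c i = 0))}"

end

theory Submission
  imports Defs
begin

text \<open>For \<open>z = \<plusminus>i\<close> a solution of \<open>J u' = - z H u\<close> satisfies \<open>b\<^sub>z(u(0)) - b\<^sub>z(u(x)) = 4 \<integral>\<^sub>0\<^sup>x u\<^sup>*Hu\<close> for the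
  Hermitian form \<open>b\<^sub>z(v) = - 2 z v\<^sup>*Jv\<close>, which has signature \<open>(n, n)\<close>. Solving
  boundary problems on \<open>[0, L]\<close> with a nonnegative condition at \<open>L\<close> and letting \<open>L \<rightarrow> \<infinity>\<close> gives \<open>n\<close> independent square integrable solutions, so both
  deficiency indices are at least \<open>n\<close>. If boundary values at infinity vanish, \<open>b\<^sub>z\<close> is positive definite on
  the initial values of square integrable solutions, so the indices are at most \<open>n\<close>. Conversely, if
  \<open>f\<^sub>0\<^sup>*Jf\<^sub>0\<close> does not tend to 0 for some \<open>(f, g)\<close> in the maximal relation, then the boundary condition at \<open>L\<close>
  can be coupled to \<open>f\<^sub>0(L)\<close>, which in the limit yields one more square integrable solution for \<open>z = i\<close> or for
  \<open>z = - i\<close>. Polarization passes from \<open>f\<^sub>0\<^sup>*Jf\<^sub>0\<close> to \<open>f\<^sub>0\<^sup>*Jh\<^sub>0\<close>.\<close>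

subsection \<open>Absolute continuity and indefinite integrals\<close>

text \<open>The extra solution is a limit of solutions on finite intervals, and the danger is that
  this limit is 0. The coupling at \<open>L\<close> makes the pairing of \<open>f\<^sub>0\<close>
  with the approximating solution equal to that of \<open>f\<^sub>0\<close> with itself, hence
  bounded away from 0. This pairing is linear in the solution, so Lagrange's identity carries it
  back to quantities that would vanish in the limit. Since \<open>bform (- z) = - bform z\<close>, a
  boundary form that does not tend to 0 is negative arbitrarily far out for one of the two values of
  z. Either value will do, because both indices are already at least n. Elements of the maximal
  relation are absolutely continuous only on compact subintervals of the open half line. Their
  initial values in the upper bound are limits at 0, which exist because \<open>H g\<close> is
  integrable near 0. As \<open>H\<close> is merely integrable, everything rests on Lebesgue's
  fundamental theorem in both directions for the epsilon-delta notion of absolute continuity; this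
  comes first.\<close>

lemma abs_cont_onD:
  assumes "abs_cont_on a b f" "\<epsilon> > 0"
  obtains \<delta> where "\<delta> > 0"
    "\<And>(I :: 'i set) s t. \<lbrakk>finite I; \<And>i. i \<in> I \<Longrightarrow> a \<le> s i \<and> s i \<le> t i \<and> t i \<le> b;
       disjoint_family_on (\<lambda>i. {s i<..<t i}) I; (\<Sum>i\<in>I. t i - s i) < \<delta>\<rbrakk>
       \<Longrightarrow> (\<Sum>i\<in>I. norm (f (t i) - f (s i))) < \<epsilon>"
proof -
  obtain \<delta> where "\<delta> > 0" and \<delta>: "\<And>(k::nat) s t.
        \<lbrakk>\<And>i. i < k \<Longrightarrow> a \<le> s i \<and> s i \<le> t i \<and> t i \<le> b;
        disjoint_family_on (\<lambda>i. {s i<..<t i}) {..<k};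
        (\<Sum>i<k. t i - s i) < \<delta>\<rbrakk>
        \<Longrightarrow> (\<Sum>i<k. norm (f (t i) - f (s i))) < \<epsilon>"
    using assms unfolding abs_cont_on_def by meson
  show thesis
  proof (rule that[OF \<open>\<delta> > 0\<close>])
    fix I :: "'i set" and s t
    assume I: "finite I" "\<And>i. i \<in> I \<Longrightarrow> a \<le> s i \<and> s i \<le> t i \<and> t i \<le> b"
       "disjoint_family_on (\<lambda>i. {s i<..<t i}) I" "(\<Sum>i\<in>I. t i - s i) < \<delta>"
    \<comment> \<open>Divisions are finite sets of tagged intervals, while the definition speaks of
      families numbered by naturals; a bijection transports one to the other.\<close>
    obtain h where h: "bij_betw h {..<card I} I"
      using ex_bij_betw_nat_finite[OF I(1)] by (auto simp: atLeast0LessThan)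
    have "(\<Sum>i<card I. norm (f (t (h i)) - f (s (h i)))) < \<epsilon>"
    proof (rule \<delta>)
      show "disjoint_family_on (\<lambda>i. {s (h i)<..<t (h i)}) {..<card I}"
        using I(3) h unfolding disjoint_family_on_def bij_betw_def inj_on_def
        by (metis image_eqI)
      show "(\<Sum>i<card I. t (h i) - s (h i)) < \<delta>"
        using I(4) sum.reindex_bij_betw[OF h, of "\<lambda>i. t i - s i"] by simp
      show "\<And>i. i < card I \<Longrightarrow> a \<le> s (h i) \<and> s (h i) \<le> t (h i) \<and> t (h i) \<le> b"
        using I(2) h by (auto simp: bij_betw_def)
    qed
    then show "(\<Sum>i\<in>I. norm (f (t i) - f (s i))) < \<epsilon>"
      using sum.reindex_bij_betw[OF h, of "\<lambda>i. norm (f (t i) - f (s i))"] by simp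
  qed
qed

lemma abs_cont_on_subset:
  assumes "abs_cont_on a b f" "a \<le> c" "d \<le> b"
  shows "abs_cont_on c d f"
proof -
  have *: "a \<le> x \<and> x \<le> y \<and> y \<le> b" if "c \<le> x \<and> x \<le> y \<and> y \<le> d" for x y
    using that assms by auto
  show ?thesis
    using assms(1) * unfolding abs_cont_on_def by meson
qed

lemma abs_cont_on_imp_continuous_on:
  assumes "abs_cont_on a b f"
  shows "continuous_on {a..b} f"
  unfolding continuous_on_iff
proof (intro ballI allI impI)
  fix x :: real and e :: real assume x: "x \<in> {a..b}" and "0 < e"
  obtain d where "d > 0" and d: "\<And>(I :: unit set) s t. \<lbrakk>finite I; \<And>i. i \<in> I \<Longrightarrow> a \<le> s i \<and> s i \<le> t i \<and> t i \<le> b;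
       disjoint_family_on (\<lambda>i. {s i<..<t i}) I; (\<Sum>i\<in>I. t i - s i) < d\<rbrakk>
       \<Longrightarrow> (\<Sum>i\<in>I. norm (f (t i) - f (s i))) < e"
    by (rule abs_cont_onD[OF assms \<open>0 < e\<close>]) (rule that, assumption, blast)
  have le: "norm (f y - f x) < e" if "a \<le> x" "x \<le> y" "y \<le> b" "y - x < d" for x y
    using d[of "{()}" "\<lambda>_. x" "\<lambda>_. y"] that by (auto simp: disjoint_family_on_def)
  show "\<exists>d>0. \<forall>x'\<in>{a..b}. dist x' x < d \<longrightarrow> dist (f x') (f x) < e"
  proof (intro exI[of _ d] conjI ballI impI)
    fix y assume y: "y \<in> {a..b}" "dist y x < d"
    show "dist (f y) (f x) < e"
      using le[of x y] le[of y x] x y by (cases "x \<le> y") (auto simp: dist_norm norm_minus_commute)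
  qed fact
qed

lemma abs_cont_on_bounded_linear:
  assumes "abs_cont_on a b f" "bounded_linear T"
  shows "abs_cont_on a b (\<lambda>x. T (f x))"
  unfolding abs_cont_on_def
proof (intro allI impI)
  fix \<epsilon> :: real assume "0 < \<epsilon>"
  interpret bounded_linear T by fact
  obtain K where "K > 0" and K: "\<And>x. norm (T x) \<le> norm x * K"
    using pos_bounded by blast
  have "\<epsilon> / K > 0" using \<open>0 < \<epsilon>\<close> \<open>K > 0\<close> by simp
  then obtain d where "d > 0" and d: "\<And>(k::nat) s t.
        (\<forall>i<k. a \<le> s i \<and> s i \<le> t i \<and> t i \<le> b) \<and>
        disjoint_family_on (\<lambda>i. {s i<..<t i}) {..<k} \<and>
        (\<Sum>i<k. t i - s i) < d \<Longrightarrow> (\<Sum>i<k. norm (f (t i) - f (s i))) < \<epsilon> / K"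
    using assms(1) unfolding abs_cont_on_def by meson
  show "\<exists>\<delta>>0. \<forall>(k::nat) s t.
        (\<forall>i<k. a \<le> s i \<and> s i \<le> t i \<and> t i \<le> b) \<and>
        disjoint_family_on (\<lambda>i. {s i<..<t i}) {..<k} \<and>
        (\<Sum>i<k. t i - s i) < \<delta> \<longrightarrow> (\<Sum>i<k. norm (T (f (t i)) - T (f (s i)))) < \<epsilon>"
  proof (intro exI[of _ d] conjI allI impI)
    fix k :: nat and s t
    assume H: "(\<forall>i<k. a \<le> s i \<and> s i \<le> t i \<and> t i \<le> b) \<and>
        disjoint_family_on (\<lambda>i. {s i<..<t i}) {..<k} \<and> (\<Sum>i<k. t i - s i) < d"
    have "(\<Sum>i<k. norm (T (f (t i)) - T (f (s i)))) \<le> (\<Sum>i<k. norm (f (t i) - f (s i)) * K)"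
      by (intro sum_mono) (metis K diff)
    also have "\<dots> = (\<Sum>i<k. norm (f (t i) - f (s i))) * K"
      by (simp add: sum_distrib_right)
    also have "\<dots> < \<epsilon>"
      using d[OF H] \<open>K > 0\<close> by (simp add: field_simps)
    finally show "(\<Sum>i<k. norm (T (f (t i)) - T (f (s i)))) < \<epsilon>" .
  qed fact
qed

lemma abs_cont_on_bounded_bilinear:
  assumes f: "abs_cont_on a b f" and g: "abs_cont_on a b g" and "bounded_bilinear B"
  shows "abs_cont_on a b (\<lambda>x. B (f x) (g x))"
  unfolding abs_cont_on_def
proof (intro allI impI)
  fix \<epsilon> :: real assume "0 < \<epsilon>"
  interpret bounded_bilinear B by fact
  obtain K where "K > 0" and K: "\<And>x y. norm (B x y) \<le> norm x * norm y * K"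
    using pos_bounded by blast
  have "bounded (f ` {a..b})" "bounded (g ` {a..b})"
    using f g by (auto intro!: compact_imp_bounded compact_continuous_image abs_cont_on_imp_continuous_on)
  then obtain C1 C2 where "\<forall>x\<in>{a..b}. norm (f x) \<le> C1" "\<forall>x\<in>{a..b}. norm (g x) \<le> C2"
    unfolding bounded_iff by auto
  then obtain C where C: "C > 0" "\<And>x. x \<in> {a..b} \<Longrightarrow> norm (f x) \<le> C" "\<And>x. x \<in> {a..b} \<Longrightarrow> norm (g x) \<le> C"
    using that[of "max 1 (max C1 C2)"] by fastforce
  have e': "\<epsilon> / (2 * C * K) > 0" using \<open>0 < \<epsilon>\<close> \<open>K > 0\<close> C by simp
  then obtain d1 where "d1 > 0" and d1: "\<And>(k::nat) s t.
        (\<forall>i<k. a \<le> s i \<and> s i \<le> t i \<and> t i \<le> b) \<and>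
        disjoint_family_on (\<lambda>i. {s i<..<t i}) {..<k} \<and>
        (\<Sum>i<k. t i - s i) < d1 \<Longrightarrow> (\<Sum>i<k. norm (f (t i) - f (s i))) < \<epsilon> / (2 * C * K)"
    using f unfolding abs_cont_on_def by meson
  obtain d2 where "d2 > 0" and d2: "\<And>(k::nat) s t.
        (\<forall>i<k. a \<le> s i \<and> s i \<le> t i \<and> t i \<le> b) \<and>
        disjoint_family_on (\<lambda>i. {s i<..<t i}) {..<k} \<and>
        (\<Sum>i<k. t i - s i) < d2 \<Longrightarrow> (\<Sum>i<k. norm (g (t i) - g (s i))) < \<epsilon> / (2 * C * K)"
    using g e' unfolding abs_cont_on_def by meson
  show "\<exists>\<delta>>0. \<forall>(k::nat) s t.
        (\<forall>i<k. a \<le> s i \<and> s i \<le> t i \<and> t i \<le> b) \<and>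
        disjoint_family_on (\<lambda>i. {s i<..<t i}) {..<k} \<and>
        (\<Sum>i<k. t i - s i) < \<delta> \<longrightarrow> (\<Sum>i<k. norm (B (f (t i)) (g (t i)) - B (f (s i)) (g (s i)))) < \<epsilon>"
  proof (intro exI[of _ "min d1 d2"] conjI allI impI)
    fix k :: nat and s t
    assume H: "(\<forall>i<k. a \<le> s i \<and> s i \<le> t i \<and> t i \<le> b) \<and>
        disjoint_family_on (\<lambda>i. {s i<..<t i}) {..<k} \<and> (\<Sum>i<k. t i - s i) < min d1 d2"
    have "norm (B (f (t i)) (g (t i)) - B (f (s i)) (g (s i)))
        \<le> (C * K) * norm (f (t i) - f (s i)) + (C * K) * norm (g (t i) - g (s i))" if "i < k" for i
    proof -
      have st: "s i \<in> {a..b}" "t i \<in> {a..b}" using H that by force+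
      have "B (f (t i)) (g (t i)) - B (f (s i)) (g (s i)) =
          B (f (t i) - f (s i)) (g (t i)) + B (f (s i)) (g (t i) - g (s i))"
        by (simp add: diff_left diff_right)
      also have "norm \<dots> \<le> norm (f (t i) - f (s i)) * norm (g (t i)) * K
          + norm (f (s i)) * norm (g (t i) - g (s i)) * K"
        by (intro norm_triangle_mono K)
      also have "\<dots> \<le> norm (f (t i) - f (s i)) * C * K + C * norm (g (t i) - g (s i)) * K"
        using C st \<open>K > 0\<close> by (intro add_mono mult_right_mono mult_left_mono) auto
      finally show ?thesis by (simp add: mult_ac)
    qed
    then have "(\<Sum>i<k. norm (B (f (t i)) (g (t i)) - B (f (s i)) (g (s i))))
       \<le> (\<Sum>i<k. (C * K) * norm (f (t i) - f (s i)) + (C * K) * norm (g (t i) - g (s i)))"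
      by (intro sum_mono) auto
    also have "\<dots> = (C * K) * (\<Sum>i<k. norm (f (t i) - f (s i))) + (C * K) * (\<Sum>i<k. norm (g (t i) - g (s i)))"
      by (simp add: sum.distrib sum_distrib_left)
    also have "\<dots> < (C * K) * (\<epsilon> / (2 * C * K)) + (C * K) * (\<epsilon> / (2 * C * K))"
      using H \<open>K > 0\<close> C by (intro add_strict_mono mult_strict_left_mono d1 d2) auto
    also have "\<dots> = \<epsilon>" using \<open>K > 0\<close> C by (simp add: field_simps)
    finally show "(\<Sum>i<k. norm (B (f (t i)) (g (t i)) - B (f (s i)) (g (s i)))) < \<epsilon>" .
  qed (use \<open>d1 > 0\<close> \<open>d2 > 0\<close> in auto)
qed

lemma abs_cont_on_add:
  assumes f: "abs_cont_on a b f" and g: "abs_cont_on a b g"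
  shows "abs_cont_on a b (\<lambda>x. f x + g x)"
  unfolding abs_cont_on_def
proof (intro allI impI)
  fix \<epsilon> :: real assume "0 < \<epsilon>"
  then have e': "\<epsilon> / 2 > 0" by simp
  then obtain d1 where "d1 > 0" and d1: "\<And>(k::nat) s t.
        (\<forall>i<k. a \<le> s i \<and> s i \<le> t i \<and> t i \<le> b) \<and>
        disjoint_family_on (\<lambda>i. {s i<..<t i}) {..<k} \<and>
        (\<Sum>i<k. t i - s i) < d1 \<Longrightarrow> (\<Sum>i<k. norm (f (t i) - f (s i))) < \<epsilon> / 2"
    using f unfolding abs_cont_on_def by meson
  obtain d2 where "d2 > 0" and d2: "\<And>(k::nat) s t.
        (\<forall>i<k. a \<le> s i \<and> s i \<le> t i \<and> t i \<le> b) \<and>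
        disjoint_family_on (\<lambda>i. {s i<..<t i}) {..<k} \<and>
        (\<Sum>i<k. t i - s i) < d2 \<Longrightarrow> (\<Sum>i<k. norm (g (t i) - g (s i))) < \<epsilon> / 2"
    using g e' unfolding abs_cont_on_def by meson
  show "\<exists>\<delta>>0. \<forall>(k::nat) s t.
        (\<forall>i<k. a \<le> s i \<and> s i \<le> t i \<and> t i \<le> b) \<and>
        disjoint_family_on (\<lambda>i. {s i<..<t i}) {..<k} \<and>
        (\<Sum>i<k. t i - s i) < \<delta> \<longrightarrow> (\<Sum>i<k. norm (f (t i) + g (t i) - (f (s i) + g (s i)))) < \<epsilon>"
  proof (intro exI[of _ "min d1 d2"] conjI allI impI)
    fix k :: nat and s t
    assume H: "(\<forall>i<k. a \<le> s i \<and> s i \<le> t i \<and> t i \<le> b) \<and>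
        disjoint_family_on (\<lambda>i. {s i<..<t i}) {..<k} \<and> (\<Sum>i<k. t i - s i) < min d1 d2"
    have "(\<Sum>i<k. norm (f (t i) + g (t i) - (f (s i) + g (s i))))
       \<le> (\<Sum>i<k. norm (f (t i) - f (s i)) + norm (g (t i) - g (s i)))"
      by (intro sum_mono) (metis add_diff_add norm_triangle_ineq)
    also have "\<dots> = (\<Sum>i<k. norm (f (t i) - f (s i))) + (\<Sum>i<k. norm (g (t i) - g (s i)))"
      by (simp add: sum.distrib)
    also have "\<dots> < \<epsilon> / 2 + \<epsilon> / 2"
      using H by (intro add_strict_mono d1 d2) auto
    finally show "(\<Sum>i<k. norm (f (t i) + g (t i) - (f (s i) + g (s i)))) < \<epsilon>" by simp
  qed (use \<open>d1 > 0\<close> \<open>d2 > 0\<close> in auto)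
qed

lemma abs_cont_on_const: "abs_cont_on a b (\<lambda>x. c)"
  unfolding abs_cont_on_def by (auto intro!: exI[of _ 1])

text \<open>Integrability of \<open>f'\<close> is part of the conclusion, so Riemann sums are
  estimated directly. Tags outside a null set \<open>N\<close> are handled by differentiability.
  Intervals tagged in \<open>N\<close> lie in an open set of measure below \<delta>, where absolute
  continuity makes the sum of the increments of \<open>f\<close> small.\<close>

lemma fundamental_theorem_of_calculus_abs_cont:
  fixes f :: "real \<Rightarrow> 'a::banach"
  assumes "a \<le> b" and ac: "abs_cont_on a b f"
    and ae: "AE x in lebesgue. a < x \<and> x < b \<longrightarrow> (f has_vector_derivative f' x) (at x)"
  shows "(f' has_integral (f b - f a)) {a..b}"
proof -
  obtain N' where N': "negligible N'"
      "{x. \<not> (a < x \<and> x < b \<longrightarrow> (f has_vector_derivative f' x) (at x))} \<subseteq> N'"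
    using ae unfolding eventually_ae_filter_negligible by blast
  define N where "N = N' \<union> {a, b}"
  have N: "negligible N" using N' by (simp add: N_def negligible_Un)
  have vecd: "(f has_vector_derivative f' x) (at x within {a..b})" if "x \<in> {a..b} - N" for x
  proof (rule has_vector_derivative_at_within)
    have "a < x" "x < b" "x \<notin> N'" using that by (auto simp: N_def)
    then show "(f has_vector_derivative f' x) (at x)" using N'(2) by blast
  qed
  \<comment> \<open>With value 0 on \<open>N\<close>, the error of an interval tagged there is just
    the increment of \<open>f\<close>, whatever \<open>f'\<close> is at the tag.\<close>
  define g where "g x = (if x \<in> N then 0 else f' x)" for x
  have "(g has_integral (f b - f a)) {a..b}"
    unfolding has_integral_real
  proof (intro allI impI)
    fix e :: real assume "e > 0"
    \<comment> \<open>The summand 1 keeps \<open>e1\<close> positive when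
      \<open>a = b\<close>.\<close>
    define e1 where "e1 = e / (2 * (b - a + 1))"
    have "e1 > 0" and e1: "e1 * (b - a) < e / 2"
      using \<open>e > 0\<close> \<open>a \<le> b\<close> by (auto simp: e1_def field_simps)
    have "\<exists>d>0. x \<in> {a..b} - N \<longrightarrow>
         (\<forall>y\<in>{a..b}. norm (y-x) < d \<longrightarrow> norm (f y - f x - (y-x) *\<^sub>R f' x) \<le> e1 * norm (y-x))" for x
    proof (cases "x \<in> {a..b} - N")
      case True
      with vecd[OF True] \<open>e1 > 0\<close> show ?thesis
        unfolding has_vector_derivative_def has_derivative_within_alt by blast
    qed (use zero_less_one in blast)
    then obtain d where d: "\<And>x. 0 < d x"
        "\<And>x y. \<lbrakk>x \<in> {a..b} - N; y \<in> {a..b}; norm (y-x) < d x\<rbrakk>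
           \<Longrightarrow> norm (f y - f x - (y-x) *\<^sub>R f' x) \<le> e1 * norm (y-x)"
      by metis
    have "e / 2 > 0" using \<open>e > 0\<close> by simp
    obtain \<delta> where "\<delta> > 0" and \<delta>: "\<And>(I :: (real \<times> real set) set) s t. \<lbrakk>finite I; \<And>i. i \<in> I \<Longrightarrow> a \<le> s i \<and> s i \<le> t i \<and> t i \<le> b;
       disjoint_family_on (\<lambda>i. {s i<..<t i}) I; (\<Sum>i\<in>I. t i - s i) < \<delta>\<rbrakk>
       \<Longrightarrow> (\<Sum>i\<in>I. norm (f (t i) - f (s i))) < e / 2"
      by (rule abs_cont_onD[OF ac \<open>e/2 > 0\<close>]) (rule that, assumption, blast)
    have Nl: "N \<in> null_sets lebesgue" using N by (simp add: negligible_iff_null_sets)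
    then obtain T where T: "open T" "N \<subseteq> T" "(T - N) \<in> lmeasurable" "emeasure lebesgue (T - N) < ennreal \<delta>"
      using sets_lebesgue_outer_open[of N \<delta>] \<open>\<delta> > 0\<close> by (auto simp: null_sets_def)
    have TT: "T \<in> sets lebesgue" using \<open>open T\<close> by auto
    have emT: "emeasure lebesgue T < ennreal \<delta>"
      using T(4) emeasure_Diff_null_set[OF Nl TT] by simp
    then have lmT: "T \<in> lmeasurable"
      using TT by (intro fmeasurableI) (auto intro: order.strict_trans simp: top.not_eq_extremum)
    have meT: "measure lebesgue T < \<delta>"
      using emT \<open>\<delta> > 0\<close> lmT by (metis emeasure_eq_measure2 ennreal_less_iff measure_nonneg)
    have "\<exists>r>0. x \<in> N \<longrightarrow> ball x r \<subseteq> T" for x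
    proof (cases "x \<in> N")
      case True
      then show ?thesis using \<open>open T\<close> \<open>N \<subseteq> T\<close> by (meson open_contains_ball subsetD)
    qed (use zero_less_one in blast)
    then obtain r where r: "\<And>x. r x > 0" "\<And>x. x \<in> N \<Longrightarrow> ball x (r x) \<subseteq> T"
      by metis
    define \<gamma> where "\<gamma> x = ball x (min (d x) (r x))" for x
    show "\<exists>\<gamma>. gauge \<gamma> \<and> (\<forall>\<D>. \<D> tagged_division_of {a..b} \<and> \<gamma> fine \<D> \<longrightarrow>
        norm ((\<Sum>(x, k)\<in>\<D>. measure lborel k *\<^sub>R g x) - (f b - f a)) < e)"
    proof (intro exI[of _ \<gamma>] conjI allI impI)
      show "gauge \<gamma>" unfolding \<gamma>_def using d(1) r(1) by (intro gauge_ball_dependent) auto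
    next
      fix p assume p: "p tagged_division_of {a..b} \<and> \<gamma> fine p"
      then have ptag: "p tagged_division_of {a..b}" and fine: "\<gamma> fine p" by auto
      have fin: "finite p" using ptag by blast
      have K: "a \<le> Inf K \<and> Inf K \<le> x \<and> x \<le> Sup K \<and> Sup K \<le> b \<and> K = {Inf K..Sup K}" if xK: "(x, K) \<in> p" for x K
      proof -
        have "x \<in> K" "K \<subseteq> {a..b}" using tagged_division_ofD(2,3)[OF ptag xK] by auto
        moreover obtain u v where "K = cbox u v" using tagged_division_ofD(4)[OF ptag xK] by auto
        ultimately show ?thesis by auto
      qed
      define p1 where "p1 = {i \<in> p. fst i \<in> N}"
      define p2 where "p2 = {i \<in> p. fst i \<notin> N}"
      have pu: "p = p1 \<union> p2" "p1 \<inter> p2 = {}" by (auto simp: p1_def p2_def)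
      have fin12: "finite p1" "finite p2" using fin by (auto simp: p1_def p2_def)
      have disj: "disjoint_family_on (\<lambda>i. {Inf (snd i)<..<Sup (snd i)}) p"
        unfolding disjoint_family_on_def
      proof (intro ballI impI)
        fix i j assume ij: "i \<in> p" "j \<in> p" "i \<noteq> j"
        obtain x K y L where i: "i = (x,K)" "j = (y,L)" by fastforce
        have "interior K \<inter> interior L = {}"
          using tagged_division_ofD(5)[OF ptag] ij i by metis
        moreover have "K = {Inf K..Sup K}" "L = {Inf L..Sup L}" using K ij i by blast+
        ultimately show "{Inf (snd i)<..<Sup (snd i)} \<inter> {Inf (snd j)<..<Sup (snd j)} = {}"
          using i by (metis interior_atLeastAtMost_real snd_conv)
      qed
      have em: "emeasure lborel {u<..<v::real} \<noteq> top" for u v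
        using emeasure_lborel_box_finite[of u v] by (simp add: less_top)
      have s1: "(\<Sum>i\<in>p1. norm (f (Sup (snd i)) - f (Inf (snd i)))) < e / 2"
      proof (rule \<delta>)
        show dj1: "disjoint_family_on (\<lambda>i. {Inf (snd i)<..<Sup (snd i)}) p1"
          using disj by (rule disjoint_family_on_mono[rotated]) (auto simp: p1_def)
        have "(\<Sum>i\<in>p1. Sup (snd i) - Inf (snd i)) = (\<Sum>i\<in>p1. measure lebesgue {Inf (snd i)<..<Sup (snd i)})"
          using K by (intro sum.cong) (fastforce simp: p1_def)+
        also have "\<dots> = measure lebesgue (\<Union>i\<in>p1. {Inf (snd i)<..<Sup (snd i)})"
          by (rule measure_finite_Union[symmetric, OF fin12(1) _ dj1]) (auto simp: em)
        also have "\<dots> \<le> measure lebesgue T"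
        proof (rule measure_mono_fmeasurable)
          show "(\<Union>i\<in>p1. {Inf (snd i)<..<Sup (snd i)}) \<subseteq> T"
          proof (rule UN_least)
            fix i assume "i \<in> p1"
            then obtain x K' where i: "i = (x,K')" "(x,K') \<in> p" "x \<in> N" by (cases i) (auto simp: p1_def)
            have "K' \<subseteq> \<gamma> x" using fine i by blast
            also have "\<dots> \<subseteq> T" using r(2)[OF i(3)] by (auto simp: \<gamma>_def)
            finally show "{Inf (snd i)<..<Sup (snd i)} \<subseteq> T" using K[OF i(2)] i by force
          qed
          show "(\<Union>i\<in>p1. {Inf (snd i)<..<Sup (snd i)}) \<in> sets lebesgue" using fin12 by auto
        qed fact
        finally show "(\<Sum>i\<in>p1. Sup (snd i) - Inf (snd i)) < \<delta>" using meT by simp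
        show "a \<le> Inf (snd i) \<and> Inf (snd i) \<le> Sup (snd i) \<and> Sup (snd i) \<le> b" if "i \<in> p1" for i
          using K[of "fst i" "snd i"] that by (auto simp: p1_def)
      qed fact
      have s2: "norm (measure lborel (snd i) *\<^sub>R g (fst i) - (f (Sup (snd i)) - f (Inf (snd i)))) \<le> e1 * (Sup (snd i) - Inf (snd i))"
        if i2: "i \<in> p2" for i
      proof -
        obtain x L where i: "i = (x,L)" "(x,L) \<in> p" "x \<notin> N" using i2 by (cases i) (auto simp: p2_def)
        define u v where "u = Inf L" and "v = Sup L"
        have uv: "a \<le> u" "u \<le> x" "x \<le> v" "v \<le> b" "L = {u..v}" using K[OF i(2)] by (auto simp: u_def v_def)
        have "L \<subseteq> \<gamma> x" using fine i by blast
        then have "u \<in> \<gamma> x" "v \<in> \<gamma> x" using uv by auto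
        then have n: "norm (u - x) < d x" "norm (v - x) < d x" by (auto simp: \<gamma>_def dist_real_def)
        have "norm ((v - u) *\<^sub>R f' x - (f v - f u)) = norm (f u - f x - (u - x) *\<^sub>R f' x - (f v - f x - (v - x) *\<^sub>R f' x))"
          by (auto simp: algebra_simps)
        also have "\<dots> \<le> norm (f u - f x - (u - x) *\<^sub>R f' x) + norm (f v - f x - (v - x) *\<^sub>R f' x)"
          by (rule norm_triangle_ineq4)
        also have "\<dots> \<le> e1 * norm (u - x) + e1 * norm (v - x)"
          using uv i n by (intro add_mono d(2)) auto
        also have "\<dots> = e1 * (v - u)" using uv by (simp add: algebra_simps)
        finally show ?thesis using i uv by (simp add: g_def u_def[symmetric] v_def[symmetric])
      qed
      have fb: "f b - f a = (\<Sum>i\<in>p. f (Sup (snd i)) - f (Inf (snd i)))"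
        using additive_tagged_division_1[OF \<open>a \<le> b\<close> ptag, of f] by (simp add: split_def)
      have ba: "b - a = (\<Sum>i\<in>p. Sup (snd i) - Inf (snd i))"
        using additive_tagged_division_1[OF \<open>a \<le> b\<close> ptag, of "\<lambda>x. x"] by (simp add: split_def)
      have "(\<Sum>(x, k)\<in>p. measure lborel k *\<^sub>R g x) - (f b - f a) =
          (\<Sum>i\<in>p. measure lborel (snd i) *\<^sub>R g (fst i) - (f (Sup (snd i)) - f (Inf (snd i))))"
        unfolding fb by (simp add: sum_subtractf split_def)
      also have "\<dots> = (\<Sum>i\<in>p1. - (f (Sup (snd i)) - f (Inf (snd i)))) +
         (\<Sum>i\<in>p2. measure lborel (snd i) *\<^sub>R g (fst i) - (f (Sup (snd i)) - f (Inf (snd i))))"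
        unfolding pu(1) sum.union_disjoint[OF fin12 pu(2)]
        by (intro arg_cong2[where f="(+)"] sum.cong) (auto simp: p1_def g_def)
      also have "norm \<dots> \<le> (\<Sum>i\<in>p1. norm (f (Sup (snd i)) - f (Inf (snd i)))) + (\<Sum>i\<in>p2. e1 * (Sup (snd i) - Inf (snd i)))"
        by (intro norm_triangle_mono sum_norm_le s2) (auto simp: norm_minus_commute)
      also have "(\<Sum>i\<in>p2. e1 * (Sup (snd i) - Inf (snd i))) \<le> (\<Sum>i\<in>p. e1 * (Sup (snd i) - Inf (snd i)))"
      proof (rule sum_mono2[OF fin])
        fix i assume "i \<in> p - p2"
        then have "Inf (snd i) \<le> Sup (snd i)" using K[of "fst i" "snd i"] by auto
        then show "0 \<le> e1 * (Sup (snd i) - Inf (snd i))" using \<open>e1 > 0\<close> by simp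
      qed (auto simp: p2_def)
      also have "\<dots> = e1 * (b - a)" by (simp add: ba sum_distrib_left)
      finally show "norm ((\<Sum>(x, k)\<in>p. measure lborel k *\<^sub>R g x) - (f b - f a)) < e"
        using s1 e1 by simp
    qed
  qed
  then show ?thesis
    by (rule has_integral_spike[OF N, rotated]) (auto simp: g_def)
qed

text \<open>Only the interiors are disjoint, so \<open>h\<close> is cut off to the open intervals,
  which leaves the integrals unchanged; at each point at most one cut-off survives.\<close>

lemma sum_integral_disjoint_le:
  fixes h :: "real \<Rightarrow> real"
  assumes h: "h integrable_on {a..b}" "\<And>x. x \<in> {a..b} \<Longrightarrow> 0 \<le> h x" and "finite I"
    and st: "\<And>i. i \<in> I \<Longrightarrow> a \<le> s i \<and> s i \<le> t i \<and> t i \<le> b"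
    and disj: "disjoint_family_on (\<lambda>i. {s i<..<t i}) I"
  shows "(\<Sum>i\<in>I. integral {s i..t i} h) \<le> integral {a..b} h"
proof -
  let ?g = "\<lambda>i x. if x \<in> {s i<..<t i} then h x else 0"
  have sub: "{s i<..<t i} \<inter> {a..b} = {s i<..<t i}" if "i \<in> I" for i
    using st[OF that] by auto
  have int: "?g i integrable_on {a..b}" if "i \<in> I" for i
  proof -
    have "h integrable_on {s i..t i}"
      using h(1) st[OF that] by (auto intro: integrable_subinterval_real)
    then show ?thesis
      unfolding integrable_restrict_Int sub[OF that]
      by (simp add: integrable_on_open_interval_real)
  qed
  have "(\<Sum>i\<in>I. integral {s i..t i} h) = (\<Sum>i\<in>I. integral {a..b} (?g i))"
    unfolding Henstock_Kurzweil_Integration.integral_restrict_Int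
    using sub by (intro sum.cong) (auto simp: integral_open_interval_real)
  also have "\<dots> = integral {a..b} (\<lambda>x. \<Sum>i\<in>I. ?g i x)"
    using int \<open>finite I\<close> by (subst integral_sum) auto
  also have "\<dots> \<le> integral {a..b} h"
  proof (rule integral_le)
    show "(\<lambda>x. \<Sum>i\<in>I. ?g i x) integrable_on {a..b}"
      using int \<open>finite I\<close> by (intro integrable_sum) auto
    fix x assume x: "x \<in> {a..b}"
    show "(\<Sum>i\<in>I. ?g i x) \<le> h x"
    proof (cases "\<exists>j\<in>I. x \<in> {s j<..<t j}")
      case True
      then obtain j where j: "j \<in> I" "x \<in> {s j<..<t j}" by blast
      have "x \<notin> {s i<..<t i}" if "i \<in> I" "i \<noteq> j" for i
        using disjoint_family_onD[OF disj that(1) j(1) that(2)] j(2) by blast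
      then have "(\<Sum>i\<in>I. ?g i x) = (\<Sum>i\<in>I. if i = j then h x else 0)"
        using j(2) by (intro sum.cong) auto
      also have "\<dots> = h x" using j \<open>finite I\<close> by simp
      finally show ?thesis by simp
    next
      case False
      then have "(\<Sum>i\<in>I. ?g i x) = 0" by (intro sum.neutral) auto
      then show ?thesis using h(2)[OF x] by simp
    qed
  qed fact
  finally show ?thesis .
qed

text \<open>Truncating \<open>norm (f x)\<close> at height \<open>n\<close> splits it into a bounded
  part, whose integral over total length \<delta> is at most \<open>n * \<delta>\<close>, and a
  remainder \<open>h\<close> whose integral over all of \<open>{a..b}\<close> is already below
  \<open>\<epsilon> / 2\<close>.\<close>

lemma abs_cont_on_indefinite_integral:
  fixes f :: "real \<Rightarrow> 'a::euclidean_space"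
  assumes f: "f absolutely_integrable_on {a..b}"
  shows "abs_cont_on a b (\<lambda>x. integral {a..x} f)"
  unfolding abs_cont_on_def
proof (intro allI impI)
  fix \<epsilon> :: real assume "0 < \<epsilon>"
  have nf: "(\<lambda>x. norm (f x)) absolutely_integrable_on {a..b}"
    using f by (rule absolutely_integrable_norm[unfolded o_def])
  have fi: "f integrable_on {a..b}" "(\<lambda>x. norm (f x)) integrable_on {a..b}"
    using f nf by (auto dest: set_lebesgue_integral_eq_integral(1))
  define m where "m n x = min (norm (f x)) (real n)" for n x
  have ma: "m n absolutely_integrable_on {a..b}" for n
    unfolding m_def
    by (intro absolutely_integrable_min_1 nf) (auto intro!: absolutely_integrable_continuous_real)
  then have mi: "m n integrable_on {a..b}" for n
    by (auto dest: set_lebesgue_integral_eq_integral(1))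
  have "(\<lambda>n. integral {a..b} (m n)) \<longlonglongrightarrow> integral {a..b} (\<lambda>x. norm (f x))"
  proof (rule dominated_convergence(2)[OF mi fi(2)])
    show "norm (m n x) \<le> norm (f x)" for n x by (auto simp: m_def)
    fix x
    have "\<forall>\<^sub>F n in sequentially. m n x = norm (f x)"
      using eventually_ge_at_top[of "nat \<lceil>norm (f x)\<rceil>"]
      by eventually_elim (auto simp: m_def min_def nat_ceiling_le_eq)
    then show "(\<lambda>n. m n x) \<longlonglongrightarrow> norm (f x)" by (rule tendsto_eventually)
  qed
  then have "\<forall>\<^sub>F n in sequentially. dist (integral {a..b} (m n)) (integral {a..b} (\<lambda>x. norm (f x))) < \<epsilon> / 2"
    using \<open>0 < \<epsilon>\<close> by (intro tendstoD) auto
  then obtain n where n: "dist (integral {a..b} (m n)) (integral {a..b} (\<lambda>x. norm (f x))) < \<epsilon> / 2"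
    by (auto simp: eventually_sequentially)
  define h where "h x = norm (f x) - m n x" for x
  have hi: "h integrable_on {a..b}" unfolding h_def using fi mi by (intro integrable_diff)
  have h0: "0 \<le> h x" for x by (auto simp: h_def m_def)
  have hint: "integral {a..b} h < \<epsilon> / 2"
    using n unfolding h_def integral_diff[OF fi(2) mi] dist_real_def by linarith
  define \<delta> where "\<delta> = \<epsilon> / (2 * (real n + 1))"
  have "\<delta> > 0" and \<delta>: "real n * \<delta> \<le> \<epsilon> / 2" using \<open>0 < \<epsilon>\<close> by (auto simp: \<delta>_def field_simps)
  show "\<exists>\<delta>>0. \<forall>(k::nat) s t.
        (\<forall>i<k. a \<le> s i \<and> s i \<le> t i \<and> t i \<le> b) \<and>
        disjoint_family_on (\<lambda>i. {s i<..<t i}) {..<k} \<and>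
        (\<Sum>i<k. t i - s i) < \<delta> \<longrightarrow> (\<Sum>i<k. norm (integral {a..t i} f - integral {a..s i} f)) < \<epsilon>"
  proof (intro exI[of _ \<delta>] conjI allI impI)
    fix k :: nat and s t
    assume H: "(\<forall>i<k. a \<le> s i \<and> s i \<le> t i \<and> t i \<le> b) \<and>
        disjoint_family_on (\<lambda>i. {s i<..<t i}) {..<k} \<and> (\<Sum>i<k. t i - s i) < \<delta>"
    have "norm (integral {a..t i} f - integral {a..s i} f) \<le> integral {s i..t i} h + real n * (t i - s i)" if "i < k" for i
    proof -
      have st: "a \<le> s i" "s i \<le> t i" "t i \<le> b" using H that by auto
      have ii: "f integrable_on {s i..t i}" "h integrable_on {s i..t i}"
        using fi hi st by (auto intro: integrable_subinterval_real)
      have "f integrable_on {a..t i}"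
        using fi(1) st by (auto intro: integrable_subinterval_real)
      then have "integral {a..s i} f + integral {s i..t i} f = integral {a..t i} f"
        using st by (intro Henstock_Kurzweil_Integration.integral_combine) auto
      then have "norm (integral {a..t i} f - integral {a..s i} f) = norm (integral {s i..t i} f)"
        by (metis add_diff_cancel_left')
      also have "\<dots> \<le> integral {s i..t i} (\<lambda>x. h x + real n)"
      proof (rule integral_norm_bound_integral)
        show "(\<lambda>x. h x + real n) integrable_on {s i..t i}" using ii by (intro integrable_add) auto
        show "norm (f x) \<le> h x + real n" for x by (auto simp: h_def m_def)
      qed (rule ii)
      also have "\<dots> = integral {s i..t i} h + real n * (t i - s i)"
        using ii st by (subst integral_add) auto
      finally show ?thesis .
    qed
    then have "(\<Sum>i<k. norm (integral {a..t i} f - integral {a..s i} f)) \<le> (\<Sum>i<k. integral {s i..t i} h + real n * (t i - s i))"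
      by (intro sum_mono) auto
    also have "\<dots> = (\<Sum>i<k. integral {s i..t i} h) + real n * (\<Sum>i<k. t i - s i)"
      by (simp add: sum.distrib sum_distrib_left)
    also have "\<dots> \<le> integral {a..b} h + real n * \<delta>"
      using H hi h0 by (intro add_mono sum_integral_disjoint_le mult_left_mono) auto
    also have "\<dots> < \<epsilon>" using hint \<delta> by simp
    finally show "(\<Sum>i<k. norm (integral {a..t i} f - integral {a..s i} f)) < \<epsilon>" .
  qed fact
qed

text \<open>The intervals witnessing a bad difference
  quotient form a Vitali cover of the bad set, and Henstock's lemma bounds the total length of any
  disjoint subfamily.\<close>

lemma has_vector_derivative_indefinite_integral_ae:
  fixes f :: "real \<Rightarrow> 'a::euclidean_space"
  assumes f: "f integrable_on {a..b}"
  shows "AE x in lebesgue. a < x \<and> x < b \<longrightarrow> ((\<lambda>x. integral {a..x} f) has_vector_derivative f x) (at x)"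
proof -
  define F where "F x = integral {a..x} f" for x
  have Fdiff: "integral {x..y} f = F y - F x" if "a \<le> x" "x \<le> y" "y \<le> b" for x y
  proof -
    have "f integrable_on {a..y}"
      using f that by (auto intro: integrable_subinterval_real)
    then show ?thesis unfolding F_def
      using Henstock_Kurzweil_Integration.integral_combine[of a x y f] that by (metis add_diff_cancel_left')
  qed
  define bad where "bad e = {x \<in> {a<..<b}. \<forall>d>0. \<exists>y\<in>{a<..<b}. y \<noteq> x \<and> \<bar>y - x\<bar> < d \<and>
      norm (F y - F x - (y - x) *\<^sub>R f x) > e * \<bar>y - x\<bar>}" for e
  have neg: "negligible (bad e)" if "e > 0" for e
    unfolding negligible_outer_le
  proof (intro allI impI)
    fix \<epsilon> :: real assume "\<epsilon> > 0"
    then have "e * \<epsilon> > 0" using \<open>e > 0\<close> by simp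
    obtain \<gamma> where "gauge \<gamma>" and \<gamma>: "\<And>p. \<lbrakk>p tagged_partial_division_of (cbox a b); \<gamma> fine p\<rbrakk> \<Longrightarrow>
             sum (\<lambda>(x,k). norm (measure lborel k *\<^sub>R f x - integral k f)) p < e * \<epsilon>"
      using Henstock_lemma[of f a b, OF _ \<open>e * \<epsilon> > 0\<close>] f by auto
    \<comment> \<open>A pair \<open>(x, y)\<close> codes the interval between the tag
      \<open>x\<close> and the witness \<open>y\<close>; midpoint and half length present it as a
      ball for Vitali's theorem. The tag may be either endpoint, hence \<open>min\<close> and
      \<open>max\<close>.\<close>
    define c where "c = (\<lambda>(x::real, y). (x + y) / 2)"
    define r where "r = (\<lambda>(x::real, y). \<bar>y - x\<bar> / 2)"
    have seg: "cball (c (x,y)) (r (x,y)) = {min x y..max x y}" for x y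
      by (auto simp: cball_eq_atLeastAtMost c_def r_def abs_if min_def max_def field_simps)
    define K where "K = {(x,y). x \<in> {a<..<b} \<and> y \<in> {a<..<b} \<and> y \<noteq> x \<and>
        norm (F y - F x - (y - x) *\<^sub>R f x) > e * \<bar>y - x\<bar> \<and> cball (c (x,y)) (r (x,y)) \<subseteq> \<gamma> x}"
    obtain C where C: "countable C" "C \<subseteq> K"
     "pairwise (\<lambda>i j. disjnt (cball (c i) (r i)) (cball (c j) (r j))) C"
     "negligible (bad e - (\<Union>i \<in> C. cball (c i) (r i)))"
    proof (rule Vitali_covering_theorem_cballs[of K r "bad e" c])
      show "0 < r i" if "i \<in> K" for i using that by (auto simp: K_def r_def)
      fix x d :: real assume x: "x \<in> bad e" and "0 < d"
      obtain \<rho> where "\<rho> > 0" "ball x \<rho> \<subseteq> \<gamma> x"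
        using \<open>gauge \<gamma>\<close> by (meson gaugeD open_contains_ball)
      have "min d \<rho> > 0" using \<open>0 < d\<close> \<open>\<rho> > 0\<close> by simp
      then obtain y where y: "y \<in> {a<..<b}" "y \<noteq> x" "\<bar>y - x\<bar> < min d \<rho>" 
          "norm (F y - F x - (y - x) *\<^sub>R f x) > e * \<bar>y - x\<bar>"
        using x unfolding bad_def by blast
      have "{min x y..max x y} \<subseteq> ball x \<rho>" using y by (auto simp: dist_real_def)
      then have "(x,y) \<in> K" using y x \<open>ball x \<rho> \<subseteq> \<gamma> x\<close> unfolding K_def bad_def seg by auto
      moreover have "x \<in> cball (c (x,y)) (r (x,y))" unfolding seg by auto
      moreover have "r (x,y) < d" using y by (auto simp: r_def)
      ultimately show "\<exists>i. i \<in> K \<and> x \<in> cball (c i) (r i) \<and> r i < d" by blast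
    qed
    have bound: "measure lebesgue (\<Union>i\<in>C'. cball (c i) (r i)) \<le> \<epsilon>" if C': "C' \<subseteq> C" "finite C'" for C'
    proof -
      define g where "g i = (fst i, cball (c i) (r i))" for i
      have ne: "cball (c i) (r i) \<noteq> {}" for i
        by (simp add: r_def split: prod.splits)
      have dj: "disjnt (cball (c i) (r i)) (cball (c j) (r j))" if "i \<in> C'" "j \<in> C'" "i \<noteq> j" for i j
        using C(3) C' that unfolding pairwise_def by blast
      have inj: "inj_on g C'"
        using dj ne unfolding inj_on_def g_def disjnt_def by (metis Int_absorb snd_conv)
      have tag: "g ` C' tagged_partial_division_of (cbox a b)"
        unfolding tagged_partial_division_of_def
      proof (intro conjI allI impI)
        show "finite (g ` C')" using C' by simp
      next
        fix x k assume "(x, k) \<in> g ` C'"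
        then obtain y where xy: "(x,y) \<in> C'" "k = {min x y..max x y}" by (auto simp: g_def seg)
        then have "x \<in> {a<..<b}" "y \<in> {a<..<b}" using C C' by (auto simp: K_def)
        then show "x \<in> k" "k \<subseteq> cbox a b" "\<exists>u v. k = cbox u v" using xy by (auto simp: box_real)
      next
        fix x1 K1 x2 K2 assume "(x1, K1) \<in> g ` C' \<and> (x2, K2) \<in> g ` C' \<and> (x1, K1) \<noteq> (x2, K2)"
        then obtain i j where "i \<in> C'" "j \<in> C'" "K1 = cball (c i) (r i)" "K2 = cball (c j) (r j)" "i \<noteq> j"
          by (auto simp: g_def)
        then have "K1 \<inter> K2 = {}" using dj[of i j] by (simp add: disjnt_def)
        then show "interior K1 \<inter> interior K2 = {}" using interior_subset by blast
      qed
      have "cball (c i) (r i) \<subseteq> \<gamma> (fst i)" if "i \<in> C'" for i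
        using subsetD[OF C(2) subsetD[OF C'(1) that]] by (cases i) (simp add: K_def)
      then have fine: "\<gamma> fine (g ` C')"
        by (auto simp: fine_def g_def simp del: mem_cball)
      \<comment> \<open>The total error is below \<open>e * \<epsilon>\<close>, while every bad
        interval has error at least \<open>e\<close> times its length; dividing by \<open>e\<close>
        bounds the total length.\<close>
      have "(\<Sum>i\<in>C'. norm (measure lborel (cball (c i) (r i)) *\<^sub>R f (fst i) - integral (cball (c i) (r i)) f)) < e * \<epsilon>"
        using \<gamma>[OF tag fine] unfolding sum.reindex[OF inj] by (simp add: g_def o_def)
      moreover have "e * measure lebesgue (cball (c i) (r i)) \<le>
          norm (measure lborel (cball (c i) (r i)) *\<^sub>R f (fst i) - integral (cball (c i) (r i)) f)" if "i \<in> C'" for i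
      proof -
        obtain x y where i: "i = (x,y)" by fastforce
        then have xy: "x \<in> {a<..<b}" "y \<in> {a<..<b}" "y \<noteq> x" "norm (F y - F x - (y - x) *\<^sub>R f x) > e * \<bar>y - x\<bar>"
          using C C' that by (auto simp: K_def)
        have m: "measure lebesgue (cball (c i) (r i)) = \<bar>y - x\<bar>" "measure lborel (cball (c i) (r i)) = \<bar>y - x\<bar>"
          unfolding i seg by auto
        have "norm (\<bar>y - x\<bar> *\<^sub>R f x - integral {min x y..max x y} f) = norm (F y - F x - (y - x) *\<^sub>R f x)"
        proof (cases "x < y")
          case True
          then have "\<bar>y - x\<bar> *\<^sub>R f x - integral {min x y..max x y} f = - (F y - F x - (y - x) *\<^sub>R f x)"
            using xy Fdiff[of x y] by (simp add: min_def max_def)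
          then show ?thesis by (metis norm_minus_cancel)
        next
          case False
          then have "\<bar>y - x\<bar> *\<^sub>R f x - integral {min x y..max x y} f = (F y - F x - (y - x) *\<^sub>R f x)"
            using xy Fdiff[of y x] by (simp add: min_def max_def algebra_simps)
          then show ?thesis by simp
        qed
        then show ?thesis using xy unfolding m unfolding i seg by simp
      qed
      then have "e * (\<Sum>i\<in>C'. measure lebesgue (cball (c i) (r i))) \<le>
        (\<Sum>i\<in>C'. norm (measure lborel (cball (c i) (r i)) *\<^sub>R f (fst i) - integral (cball (c i) (r i)) f))"
        unfolding sum_distrib_left by (rule sum_mono)
      ultimately have "e * (\<Sum>i\<in>C'. measure lebesgue (cball (c i) (r i))) < e * \<epsilon>" by linarith
      then have "(\<Sum>i\<in>C'. measure lebesgue (cball (c i) (r i))) < \<epsilon>" using \<open>e > 0\<close> by simp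
      moreover have "measure lebesgue (\<Union>i\<in>C'. cball (c i) (r i)) \<le> (\<Sum>i\<in>C'. measure lebesgue (cball (c i) (r i)))"
        using C' by (intro measure_UNION_le) auto
      ultimately show ?thesis by linarith
    qed
    have U: "(\<Union>i\<in>C. cball (c i) (r i)) \<in> lmeasurable" "measure lebesgue (\<Union>i\<in>C. cball (c i) (r i)) \<le> \<epsilon>"
      using fmeasurable_UN_bound[OF C(1) _ bound] measure_UN_bound[OF C(1) _ bound] by auto
    let ?D = "bad e - (\<Union>i \<in> C. cball (c i) (r i))"
    show "\<exists>T. bad e \<subseteq> T \<and> T \<in> lmeasurable \<and> measure lebesgue T \<le> \<epsilon>"
    proof (intro exI[of _ "?D \<union> (\<Union>i\<in>C. cball (c i) (r i))"] conjI)
      show "?D \<union> (\<Union>i\<in>C. cball (c i) (r i)) \<in> lmeasurable"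
        using fmeasurable.Un[OF negligible_imp_measurable[OF C(4)] U(1)] .
      show "measure lebesgue (?D \<union> (\<Union>i\<in>C. cball (c i) (r i))) \<le> \<epsilon>"
        using U measure_Un_null_set[OF fmeasurableD[OF U(1)] C(4)[unfolded negligible_iff_null_sets]]
        by (metis Un_commute)
    qed blast
  qed
  show ?thesis
    unfolding eventually_ae_filter_negligible
  proof (intro exI[of _ "\<Union>k. bad (1 / real (Suc k))"] conjI)
    show "negligible (\<Union>k. bad (1 / real (Suc k)))"
      using neg by (intro negligible_countable_Union) auto
    have "((\<lambda>x. integral {a..x} f) has_vector_derivative f x) (at x)"
      if x: "x \<in> {a<..<b} - (\<Union>k. bad (1 / real (Suc k)))" for x
    proof -
      have "(F has_derivative (\<lambda>h. h *\<^sub>R f x)) (at x)"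
      unfolding has_derivative_at_alt
    proof (intro conjI allI impI)
      fix e :: real assume "e > 0"
      then obtain k where k: "1 / real (Suc k) < e" by (metis nat_approx_posE)
      have "x \<notin> bad (1 / real (Suc k))" using x by blast
      then have "\<not> (\<forall>d>0. \<exists>y\<in>{a<..<b}. y \<noteq> x \<and> \<bar>y - x\<bar> < d \<and>
          norm (F y - F x - (y - x) *\<^sub>R f x) > 1 / real (Suc k) * \<bar>y - x\<bar>)"
        using x unfolding bad_def by blast
      then obtain d where "d > 0" and nd: "\<not> (\<exists>y\<in>{a<..<b}. y \<noteq> x \<and> \<bar>y - x\<bar> < d \<and>
          norm (F y - F x - (y - x) *\<^sub>R f x) > 1 / real (Suc k) * \<bar>y - x\<bar>)"
        by blast
      have d: "norm (F y - F x - (y - x) *\<^sub>R f x) \<le> 1 / real (Suc k) * \<bar>y - x\<bar>"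
        if "y \<in> {a<..<b}" "y \<noteq> x" "\<bar>y - x\<bar> < d" for y
        using nd that not_le by blast
      define d' where "d' = min d (min (x - a) (b - x))"
      show "\<exists>d>0. \<forall>y. norm (y - x) < d \<longrightarrow> norm (F y - F x - (y - x) *\<^sub>R f x) \<le> e * norm (y - x)"
      proof (intro exI[of _ d'] conjI allI impI)
        show "d' > 0" using \<open>d > 0\<close> x by (auto simp: d'_def)
        fix y assume y: "norm (y - x) < d'"
        show "norm (F y - F x - (y - x) *\<^sub>R f x) \<le> e * norm (y - x)"
        proof (cases "y = x")
          case False
          then have "norm (F y - F x - (y - x) *\<^sub>R f x) \<le> 1 / real (Suc k) * \<bar>y - x\<bar>"
            using y False by (intro d) (auto simp: d'_def)
          also have "\<dots> \<le> e * \<bar>y - x\<bar>" using k by (intro mult_right_mono) auto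
          finally show ?thesis by simp
        qed simp
      qed
    qed (rule bounded_linear_scaleR_left)
      then show ?thesis
        unfolding has_vector_derivative_def F_def .
    qed
    then show "{x. \<not> (a < x \<and> x < b \<longrightarrow> ((\<lambda>x. integral {a..x} f) has_vector_derivative f x) (at x))}
        \<subseteq> (\<Union>k. bad (1 / real (Suc k)))"
      by auto
  qed
qed

subsection \<open>Linear systems with integrable coefficients\<close>

lemma bilinear_matrix_vector_mult:
  "bilinear (\<lambda>(A :: complex^'m^'k) x. A *v x)"
  unfolding bilinear_def
  by (auto intro!: linearI simp: algebra_simps vec.add matrix_vector_mult_def vec_eq_iff scaleR_sum_right sum.distrib)

lemma bilinear_swap: "bilinear h \<Longrightarrow> bilinear (\<lambda>x y. h y x)"
  unfolding bilinear_def by blast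

lemmas bounded_bilinear_matrix_vector_mult =
  bilinear_matrix_vector_mult[unfolded bilinear_conv_bounded_bilinear]

lemma absolutely_integrable_matrix_vector_mult:
  fixes A :: "real \<Rightarrow> complex^'m^'k"
  assumes A: "A absolutely_integrable_on {a..b}" and u: "continuous_on {a..b} u"
  shows "(\<lambda>t. A t *v u t) absolutely_integrable_on {a..b}"
proof (rule absolutely_integrable_bounded_measurable_product[OF bilinear_swap[OF bilinear_matrix_vector_mult]])
  show "u \<in> borel_measurable (lebesgue_on {a..b})"
    using u by (intro continuous_imp_measurable_on_sets_lebesgue) auto
  show "bounded (u ` {a..b})"
    using u by (auto intro!: compact_imp_bounded compact_continuous_image)
qed (use A in auto)

lemma abs_cont_on_power:
  fixes m :: "real \<Rightarrow> real"
  assumes "abs_cont_on a b m"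
  shows "abs_cont_on a b (\<lambda>x. m x ^ k)"
proof (induction k)
  case (Suc k)
  show ?case
    using abs_cont_on_bounded_bilinear[OF assms Suc bounded_bilinear_mult] by simp
qed (simp add: abs_cont_on_const)

text \<open>Serves the factorial bound on Picard iterates. As \<open>\<alpha>\<close> is only
  integrable, the substitution is made by differentiating the power of the integral almost
  everywhere.\<close>

lemma has_integral_indefinite_power:
  fixes \<alpha> :: "real \<Rightarrow> real"
  assumes "\<alpha> absolutely_integrable_on {0..x}" "0 \<le> x"
  shows "((\<lambda>t. integral {0..t} \<alpha> ^ k * \<alpha> t) has_integral (integral {0..x} \<alpha> ^ Suc k / real (Suc k))) {0..x}"
proof -
  have i: "\<alpha> integrable_on {0..x}" using assms by (auto dest: set_lebesgue_integral_eq_integral(1))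
  have "((\<lambda>t. real (Suc k) * (integral {0..t} \<alpha> ^ k * \<alpha> t)) has_integral
      (integral {0..x} \<alpha> ^ Suc k - integral {0..0} \<alpha> ^ Suc k)) {0..x}"
  proof (rule fundamental_theorem_of_calculus_abs_cont[OF \<open>0 \<le> x\<close>])
    show "abs_cont_on 0 x (\<lambda>x. integral {0..x} \<alpha> ^ Suc k)"
      by (intro abs_cont_on_power abs_cont_on_indefinite_integral assms)
    show "AE t in lebesgue. 0 < t \<and> t < x \<longrightarrow>
        ((\<lambda>x. integral {0..x} \<alpha> ^ Suc k) has_vector_derivative real (Suc k) * (integral {0..t} \<alpha> ^ k * \<alpha> t)) (at t)"
      using has_vector_derivative_indefinite_integral_ae[OF i]
    proof eventually_elim
      case (elim t)
      show ?case
      proof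
        assume "0 < t \<and> t < x"
        then have d: "((\<lambda>x. integral {0..x} \<alpha>) has_field_derivative \<alpha> t) (at t)"
          using elim by (simp add: has_real_derivative_iff_has_vector_derivative)
        show "((\<lambda>x. integral {0..x} \<alpha> ^ Suc k) has_vector_derivative real (Suc k) * (integral {0..t} \<alpha> ^ k * \<alpha> t)) (at t)"
          unfolding has_real_derivative_iff_has_vector_derivative[symmetric]
          by (rule DERIV_cong[OF DERIV_power[OF d]]) (simp add: mult_ac)
      qed
    qed
  qed
  from has_integral_mult_right[OF this, of "1 / real (Suc k)"] show ?thesis
    by (simp add: field_simps del: of_nat_Suc)
qed

text \<open>Picard series: its k-th term is at most \<open>norm v * m x ^ k / fact k\<close>, where
  \<open>m\<close> is the integral of \<open>K * norm (A t)\<close>. It therefore converges on the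
  whole half line at once, without splitting into short intervals, and dominated convergence passes
  the iteration to the limit.\<close>

lemma linear_integral_equation_solvable:
  fixes A :: "real \<Rightarrow> complex^'m^'m"
  assumes A: "\<And>b. A absolutely_integrable_on {0..b}"
  obtains u where "\<And>b. continuous_on {0..b} u"
    "\<And>x. 0 \<le> x \<Longrightarrow> u x = v + integral {0..x} (\<lambda>t. A t *v u t)"
proof -
  \<comment> \<open>\<open>T k\<close> is the increment between consecutive Picard iterates; the
    iterates themselves are the partial sums \<open>S\<close> below.\<close>
  define T where "T = rec_nat (\<lambda>x. v) (\<lambda>k f x. integral {0..x} (\<lambda>t. A t *v f t))"
  have T0: "T 0 = (\<lambda>x. v)" and TS: "T (Suc k) = (\<lambda>x. integral {0..x} (\<lambda>t. A t *v T k t))" for k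
    by (simp_all add: T_def)
  have Tc: "continuous_on {0..b} (T k)" for k b
  proof (induction k)
    case (Suc k)
    then have "(\<lambda>t. A t *v T k t) integrable_on {0..b}"
      using absolutely_integrable_matrix_vector_mult[OF A] by (auto dest: set_lebesgue_integral_eq_integral(1))
    then show ?case unfolding TS by (rule indefinite_integral_continuous_1)
  qed (simp add: T0)
  have Ta: "(\<lambda>t. A t *v T k t) absolutely_integrable_on {0..b}" for k b
    by (rule absolutely_integrable_matrix_vector_mult[OF A Tc])
  have Ti: "(\<lambda>t. A t *v T k t) integrable_on {0..b}" for k b
    using Ta by (auto dest: set_lebesgue_integral_eq_integral(1))
  obtain K where K: "K > 0" "\<And>(B :: complex^'m^'m) x. norm (B *v x) \<le> norm B * norm x * K"
    using bounded_bilinear.pos_bounded[OF bounded_bilinear_matrix_vector_mult] by blast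
  define \<alpha> where "\<alpha> t = K * norm (A t)" for t
  define m where "m x = integral {0..x} \<alpha>" for x
  have \<alpha>0: "0 \<le> \<alpha> t" for t using K by (simp add: \<alpha>_def)
  have \<alpha>a: "\<alpha> absolutely_integrable_on {0..b}" for b
    unfolding \<alpha>_def using absolutely_integrable_norm[OF A, unfolded o_def]
    by (intro set_integrable_mult_right) auto
  then have \<alpha>i: "\<alpha> integrable_on {0..b}" for b by (auto dest: set_lebesgue_integral_eq_integral(1))
  have m0: "0 \<le> m x" for x unfolding m_def by (rule integral_nonneg[OF \<alpha>i]) (rule \<alpha>0)
  have mmono: "m x \<le> m y" if "x \<le> y" for x y
    unfolding m_def using that by (intro integral_subset_le \<alpha>i) (auto simp: \<alpha>0)
  have norm_A: "norm (A t *v x) \<le> \<alpha> t * norm x" for t x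
    using K(2)[of "A t" x] by (simp add: \<alpha>_def mult_ac)
  have T_le: "norm (T k x) \<le> norm v * m x ^ k / fact k" if "0 \<le> x" for k x
    using that
  proof (induction k arbitrary: x)
    case (Suc k)
    note hi = has_integral_mult_right[OF has_integral_indefinite_power[OF \<alpha>a Suc.prems, of k], of "norm v / fact k"]
    have "norm (T (Suc k) x) \<le> integral {0..x} (\<lambda>t. norm v / fact k * (integral {0..t} \<alpha> ^ k * \<alpha> t))"
      unfolding TS
    proof (rule integral_norm_bound_integral[OF Ti])
      show "(\<lambda>t. norm v / fact k * (integral {0..t} \<alpha> ^ k * \<alpha> t)) integrable_on {0..x}"
        using hi by blast
      fix t assume "t \<in> {0..x}"
      then have "norm (A t *v T k t) \<le> \<alpha> t * (norm v * m t ^ k / fact k)"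
        using Suc.IH[of t] \<alpha>0 by (intro order_trans[OF norm_A] mult_left_mono) auto
      then show "norm (A t *v T k t) \<le> norm v / fact k * (integral {0..t} \<alpha> ^ k * \<alpha> t)"
        by (simp add: m_def mult_ac)
    qed
    also have "\<dots> = norm v / fact k * (m x ^ Suc k / real (Suc k))"
      using hi unfolding m_def by (rule integral_unique)
    also have "\<dots> = norm v * m x ^ Suc k / fact (Suc k)" by (simp add: field_simps)
    finally show ?case .
  qed (simp add: T0)
  have summ: "summable (\<lambda>k. norm v * m x ^ k / fact k)" for x
    using summable_mult[OF summable_exp_generic[of "m x"], of "norm v"] by (simp add: field_simps)
  have sm: "summable (\<lambda>k. T k x)" if "0 \<le> x" for x
    by (rule summable_comparison_test'[OF summ]) (rule T_le[OF that])
  define u where "u x = (\<Sum>k. T k x)" for x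
  define S where "S n x = (\<Sum>k<n. T k x)" for n x
  have Su: "(\<lambda>n. S n x) \<longlonglongrightarrow> u x" if "0 \<le> x" for x
    unfolding S_def u_def by (rule summable_LIMSEQ[OF sm[OF that]])
  have S_le: "norm (S n t) \<le> norm v * exp (m x)" if "0 \<le> t" "t \<le> x" for n t x
  proof -
    have "norm (S n t) \<le> (\<Sum>k<n. norm v * m t ^ k / fact k)"
      unfolding S_def using T_le that by (intro sum_norm_le) auto
    also have "\<dots> \<le> (\<Sum>k. norm v * m t ^ k / fact k)"
      by (rule sum_le_suminf[OF summ]) (auto simp: m0)
    also have "\<dots> = norm v * exp (m t)"
      using suminf_mult[OF summable_exp_generic[of "m t"], of "norm v"] by (simp add: exp_def field_simps)
    also have "\<dots> \<le> norm v * exp (m x)" using mmono[OF that(2)] by (intro mult_left_mono) auto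
    finally show ?thesis .
  qed
  have AS: "A t *v S n t = (\<Sum>k<n. A t *v T k t)" for n t
    unfolding S_def by (induction n) (auto simp: vec.add matrix_vector_right_distrib)
  have ASi: "(\<lambda>t. A t *v S n t) integrable_on {0..x}" for n x
    unfolding AS by (intro integrable_sum Ti) auto
  have SS: "S (Suc n) x = v + integral {0..x} (\<lambda>t. A t *v S n t)" for n x
  proof -
    have "S (Suc n) x = v + (\<Sum>k<n. T (Suc k) x)"
      unfolding S_def by (subst sum.lessThan_Suc_shift) (simp add: T0)
    also have "(\<Sum>k<n. T (Suc k) x) = integral {0..x} (\<lambda>t. \<Sum>k<n. A t *v T k t)"
      unfolding TS by (subst integral_sum) (auto intro: Ti)
    finally show ?thesis unfolding AS .
  qed
  have conv: "(\<lambda>t. A t *v u t) integrable_on {0..x}" 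
     "(\<lambda>n. integral {0..x} (\<lambda>t. A t *v S n t)) \<longlonglongrightarrow> integral {0..x} (\<lambda>t. A t *v u t)" for x
  proof -
    have h: "(\<lambda>t. \<alpha> t * (norm v * exp (m x))) integrable_on {0..x}"
      using \<alpha>i by (rule integrable_on_mult_left)
    have le: "norm (A t *v S n t) \<le> \<alpha> t * (norm v * exp (m x))" if "t \<in> {0..x}" for n t
      using S_le[of t x n] that \<alpha>0 by (intro order_trans[OF norm_A] mult_left_mono) auto
    have lim: "(\<lambda>n. A t *v S n t) \<longlonglongrightarrow> A t *v u t" if "t \<in> {0..x}" for t
      using Su[of t] that
      by (intro bounded_linear.tendsto[OF bounded_bilinear.bounded_linear_right[OF bounded_bilinear_matrix_vector_mult]]) auto
    show "(\<lambda>t. A t *v u t) integrable_on {0..x}" 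
     "(\<lambda>n. integral {0..x} (\<lambda>t. A t *v S n t)) \<longlonglongrightarrow> integral {0..x} (\<lambda>t. A t *v u t)"
      using dominated_convergence[OF ASi h le lim] by auto
  qed
  have ueq: "u x = v + integral {0..x} (\<lambda>t. A t *v u t)" if "0 \<le> x" for x
  proof (rule LIMSEQ_unique)
    show "(\<lambda>n. S (Suc n) x) \<longlonglongrightarrow> u x" using Su[OF that] by (rule LIMSEQ_Suc)
    show "(\<lambda>n. S (Suc n) x) \<longlonglongrightarrow> v + integral {0..x} (\<lambda>t. A t *v u t)"
      unfolding SS by (intro tendsto_intros conv)
  qed
  show thesis
  proof (rule that[of u])
    fix b
    \<comment> \<open>Continuity is read off the integral equation, not from uniform convergence of
      the series.\<close>
    have "continuous_on {0..b} (\<lambda>x. v + integral {0..x} (\<lambda>t. A t *v u t))"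
      by (intro continuous_intros indefinite_integral_continuous_1 conv)
    then show "continuous_on {0..b} u"
      by (rule continuous_on_eq) (simp add: ueq[symmetric])
  qed (rule ueq)
qed

lemma linear_ode_solvable:
  fixes A :: "real \<Rightarrow> complex^'m^'m"
  assumes A: "\<And>b. A absolutely_integrable_on {0..b}"
  obtains u where "u 0 = v" "\<And>b. abs_cont_on 0 b u"
    "AE x in lebesgue. 0 < x \<longrightarrow> (u has_vector_derivative A x *v u x) (at x)"
proof -
  obtain u where uc: "\<And>b. continuous_on {0..b} u"
    and ueq: "\<And>x. 0 \<le> x \<Longrightarrow> u x = v + integral {0..x} (\<lambda>t. A t *v u t)"
    using linear_integral_equation_solvable[OF A] by metis
  have Aa: "(\<lambda>t. A t *v u t) absolutely_integrable_on {0..b}" for b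
    by (rule absolutely_integrable_matrix_vector_mult[OF A uc])
  then have Ai: "(\<lambda>t. A t *v u t) integrable_on {0..b}" for b
    by (auto dest: set_lebesgue_integral_eq_integral(1))
  show thesis
  proof (rule that[of u])
    show "u 0 = v" using ueq[of 0] by simp
    fix b
    have "abs_cont_on 0 b (\<lambda>x. v + integral {0..x} (\<lambda>t. A t *v u t))"
      by (intro abs_cont_on_add abs_cont_on_const abs_cont_on_indefinite_integral Aa)
    then show "abs_cont_on 0 b u"
      unfolding abs_cont_on_def using ueq by (smt (verit) sum.cong lessThan_iff)
  next
    \<comment> \<open>Differentiability of indefinite integrals is available on bounded intervals;
      countably many of them give one common null set.\<close>
    have "AE x in lebesgue. \<forall>n::nat. 0 < x \<and> x < real n \<longrightarrow>
        ((\<lambda>x. integral {0..x} (\<lambda>t. A t *v u t)) has_vector_derivative A x *v u x) (at x)"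
      unfolding AE_all_countable by (intro allI has_vector_derivative_indefinite_integral_ae Ai)
    then show "AE x in lebesgue. 0 < x \<longrightarrow> (u has_vector_derivative A x *v u x) (at x)"
    proof eventually_elim
      case (elim x)
      show ?case
      proof
        assume "0 < x"
        obtain n :: nat where "x < real n" using reals_Archimedean2 by blast
        with elim \<open>0 < x\<close> have "((\<lambda>x. v + integral {0..x} (\<lambda>t. A t *v u t)) has_vector_derivative 0 + A x *v u x) (at x)"
          by (intro has_vector_derivative_add has_vector_derivative_const) auto
        then have "((\<lambda>x. v + integral {0..x} (\<lambda>t. A t *v u t)) has_vector_derivative A x *v u x) (at x)" by simp
        then show "(u has_vector_derivative A x *v u x) (at x)"
        proof (rule has_vector_derivative_transform_within_open)
          show "open {0::real<..}" by simp
        qed (use \<open>0 < x\<close> ueq in auto)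
      qed
    qed
  qed
qed

subsection \<open>Hermitian forms and boundary coordinates\<close>

lemma sum_UNIV_Plus:
  fixes f :: "'a::finite + 'b::finite \<Rightarrow> 'c::comm_monoid_add"
  shows "(\<Sum>i\<in>UNIV. f i) = (\<Sum>i\<in>UNIV. f (Inl i)) + (\<Sum>i\<in>UNIV. f (Inr i))"
  using sum.Plus[of "UNIV :: 'a set" "UNIV :: 'b set" f] by (simp add: o_def)

lemma Jmat_mult_Inl [simp]: "(Jmat *v w) $ Inl i = - (w $ Inr i)"
  and Jmat_mult_Inr [simp]: "(Jmat *v w) $ Inr i = w $ Inl i"
  by (simp_all add: matrix_vector_mult_def Jmat_def sum_UNIV_Plus if_distrib[of "\<lambda>c. c * _"] cong: if_cong)

lemma Jmat_Jmat [simp]: "Jmat *v (Jmat *v w) = - w"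
  unfolding vec_eq_iff
proof
  show "(Jmat *v (Jmat *v w)) $ i = (- w) $ i" for i by (cases i) auto
qed

lemma hip_add_left: "hip (v + w) x = hip v x + hip w x"
  and hip_add_right: "hip x (v + w) = hip x v + hip x w"
  and hip_minus_right: "hip x (- v) = - hip x v"
  and hip_diff_left: "hip (v - w) x = hip v x - hip w x"
  and hip_diff_right: "hip x (v - w) = hip x v - hip x w"
  and hip_smult_left: "hip (c *s v) x = cnj c * hip v x"
  and hip_smult_right: "hip x (c *s v) = c * hip x v"
  and hip_scaleR_left: "hip (r *\<^sub>R v) x = r *\<^sub>R hip v x"
  and hip_scaleR_right: "hip x (r *\<^sub>R v) = r *\<^sub>R hip x v"
  by (simp_all add: hip_def algebra_simps sum.distrib sum_subtractf sum_negf sum_distrib_left scaleR_sum_right)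

lemma hip_zero [simp]: "hip 0 x = 0" "hip x 0 = 0"
  by (simp_all add: hip_def)

lemma bilinear_hip: "bilinear hip"
  unfolding bilinear_def
  by (auto intro!: linearI simp: hip_add_left hip_add_right hip_scaleR_left hip_scaleR_right)

lemma cnj_hip: "cnj (hip v w) = hip w v"
  by (simp add: hip_def mult.commute)

lemma hip_self: "hip v v = complex_of_real ((norm v)\<^sup>2)"
proof -
  have "hip v v = complex_of_real (\<Sum>i\<in>UNIV. (norm (v $ i))\<^sup>2)"
    unfolding hip_def of_real_sum by (intro sum.cong) (simp_all add: complex_norm_square mult.commute del: of_real_power)
  then show ?thesis by (simp add: norm_vec_def L2_set_def sum_nonneg)
qed

lemma norm_hip_le: "norm (hip v w) \<le> norm v * norm w"
proof -
  have "norm (hip v w) \<le> (\<Sum>i\<in>UNIV. norm (v $ i) * norm (w $ i))"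
    unfolding hip_def by (intro sum_norm_le) (simp add: norm_mult)
  also have "\<dots> = (\<Sum>i\<in>UNIV. \<bar>norm (v $ i)\<bar> * \<bar>norm (w $ i)\<bar>)" by simp
  also have "\<dots> \<le> norm v * norm w"
    unfolding norm_vec_def by (rule L2_set_mult_ineq)
  finally show ?thesis .
qed

lemma hip_hermitian:
  assumes "\<And>i j. A $ i $ j = cnj (A $ j $ i)"
  shows "hip (A *v v) w = hip v (A *v w)"
proof -
  have "hip (A *v v) w = (\<Sum>i\<in>UNIV. \<Sum>j\<in>UNIV. cnj (A $ i $ j) * cnj (v $ j) * w $ i)"
    by (simp add: hip_def matrix_vector_mult_def sum_distrib_right)
  also have "\<dots> = (\<Sum>j\<in>UNIV. \<Sum>i\<in>UNIV. cnj (A $ i $ j) * cnj (v $ j) * w $ i)"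
    by (rule sum.swap)
  also have "\<dots> = (\<Sum>j\<in>UNIV. \<Sum>i\<in>UNIV. cnj (v $ j) * (A $ j $ i * w $ i))"
  proof (intro sum.cong refl)
    fix i j
    have "cnj (A $ i $ j) = A $ j $ i" by (subst assms[of j i]) simp
    then show "cnj (A $ i $ j) * cnj (v $ j) * w $ i = cnj (v $ j) * (A $ j $ i * w $ i)" by simp
  qed
  also have "\<dots> = hip v (A *v w)"
    by (simp add: hip_def matrix_vector_mult_def sum_distrib_left)
  finally show ?thesis .
qed

lemma hip_psd: "psd A \<Longrightarrow> hip (A *v v) w = hip v (A *v w)"
  by (rule hip_hermitian) (unfold psd_def, blast)

lemma hip_Jmat_left: "hip (Jmat *v v) w = - hip v (Jmat *v w)"
  by (simp add: hip_def sum_UNIV_Plus sum_negf)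

lemma hip_Jmat_Jmat: "hip (Jmat *v v) (Jmat *v w) = hip v w"
  by (simp add: hip_Jmat_left hip_minus_right)

lemma mv_add: "(A :: complex^'m^'k) *v (v + w) = A *v v + A *v w"
  by (rule matrix_vector_right_distrib)

lemma mv_smult: "(A :: complex^'m^'k) *v (c *s v) = c *s (A *v v)"
  by (simp add: vector_scalar_commute)

lemma psd_nonneg: "psd A \<Longrightarrow> 0 \<le> Re (hip v (A *v v))"
  unfolding psd_def by blast

text \<open>Expand the form at \<open>t v - c w\<close> with a phase \<open>c\<close>. Unlike a
  product of square roots, the weighted mean stays additive under integration, and \<open>t\<close>
  can be tuned later to shift smallness between the two energies.\<close>

lemma psd_weighted_Cauchy_Schwarz:
  assumes A: "psd A" and "t > 0"
  shows "norm (hip v (A *v w)) \<le> (t * Re (hip v (A *v v)) + Re (hip w (A *v w)) / t) / 2"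
proof -
  define h where "h = hip v (A *v w)"
  \<comment> \<open>The unimodular factor with \<open>c * h = norm h\<close>; any unimodular value
    serves when \<open>h = 0\<close>.\<close>
  define c where "c = (if h = 0 then 1 else cnj h / norm h)"
  have hh: "cnj h * h = norm h * norm h"
    by (simp add: complex_norm_square[symmetric] power2_eq_square mult.commute del: of_real_mult flip: of_real_mult)
  have nc: "cnj c * c = 1" and ch: "c * h = norm h"
    using hh by (auto simp: c_def mult.commute)
  have h': "hip w (A *v v) = cnj h"
    unfolding h_def using hip_psd[OF A, of v w] by (metis cnj_hip)
  let ?x = "complex_of_real t *s v - c *s w"
  have "hip ?x (A *v ?x) = t * t * hip v (A *v v) - t * (c * h) - t * (cnj c * cnj h) + (cnj c * c) * hip w (A *v w)"
    by (simp add: matrix_vector_mult_diff_distrib mv_smult hip_diff_left hip_diff_right hip_smult_left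
        hip_smult_right h' h_def[symmetric] algebra_simps)
  also have "cnj c * cnj h = norm h" using ch by (metis complex_cnj_mult complex_cnj_complex_of_real)
  finally have "Re (hip ?x (A *v ?x)) = t * t * Re (hip v (A *v v)) - 2 * t * norm h + Re (hip w (A *v w))"
    unfolding nc ch by simp
  with psd_nonneg[OF A, of ?x] have "2 * t * norm h \<le> t * t * Re (hip v (A *v v)) + Re (hip w (A *v w))" by simp
  then show ?thesis using \<open>t > 0\<close> by (simp add: h_def[symmetric] field_simps)
qed

text \<open>The weighted inequality for \<open>A *v v\<close> and \<open>v\<close> bounds the
  squared norm of \<open>A *v v\<close> by \<open>t * c / 2\<close> for every
  \<open>t > 0\<close>.\<close>

lemma psd_form_eq_0:
  assumes A: "psd A" and 0: "Re (hip v (A *v v)) = 0"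
  shows "A *v v = 0"
proof (rule ccontr)
  assume nz: "A *v v \<noteq> 0"
  let ?w = "A *v v"
  define c where "c = Re (hip ?w (A *v ?w))"
  have c0: "0 \<le> c" unfolding c_def by (rule psd_nonneg[OF A])
  have le: "(norm ?w)\<^sup>2 \<le> t * c / 2" if "t > 0" for t
    using psd_weighted_Cauchy_Schwarz[OF A that, of ?w v] 0 by (simp add: hip_self c_def norm_power)
  have pos: "(norm ?w)\<^sup>2 > 0" using nz by simp
  \<comment> \<open>This is \<open>t * c\<close> for \<open>t = (norm ?w)\<^sup>2 / (c + 1)\<close>,
    with 1 added to cover \<open>c = 0\<close>. It is at most the positive number
    \<open>(norm ?w)\<^sup>2\<close> and also at least twice that number.\<close>
  define X where "X = (norm ?w)\<^sup>2 / (c + 1) * c"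
  have "X \<le> (norm ?w)\<^sup>2" using pos c0 by (simp add: X_def field_simps)
  moreover have "(norm ?w)\<^sup>2 / (c + 1) > 0" using pos c0 by (intro divide_pos_pos) auto
  then have "(norm ?w)\<^sup>2 \<le> X / 2" unfolding X_def by (rule le)
  ultimately show False using pos by linarith
qed

text \<open>The eigenspace coordinates of \<open>J\<close>: for \<open>z = \<plusminus>i\<close>, \<open>bproj z v\<close> and \<open>bproj (-z) v\<close> diagonalise
  the boundary form, see \<open>boundary_form_diag\<close>.\<close>

definition bproj :: "complex \<Rightarrow> complex^('n::finite + 'n) \<Rightarrow> complex^'n" where
  "bproj z v = (\<chi> i. v $ Inl i + z * v $ Inr i)"

text \<open>Inverse of the coordinate map \<open>v \<mapsto> (bproj z v, bproj (- z) v)\<close> for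
  nonzero \<open>z\<close>.\<close>

definition bcomb :: "complex \<Rightarrow> complex^'n::finite \<Rightarrow> complex^'n \<Rightarrow> complex^('n + 'n)" where
  "bcomb z p q = (\<chi> k. case k of Inl i \<Rightarrow> (p $ i + q $ i) / 2 | Inr i \<Rightarrow> (p $ i - q $ i) / (2 * z))"

lemma bproj_bcomb [simp]:
  assumes "z \<noteq> 0"
  shows "bproj z (bcomb z p q) = p" "bproj (- z) (bcomb z p q) = q"
  using assms by (simp_all add: bproj_def bcomb_def vec_eq_iff field_simps)

lemma bproj_add: "bproj z (v + w) = bproj z v + bproj z w"
  and bproj_smult: "bproj z (c *s v) = c *s bproj z v"
  and bproj_scaleR: "bproj z (r *\<^sub>R v) = r *\<^sub>R bproj z v"
  by (simp_all add: bproj_def vec_eq_iff algebra_simps)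

lemma bproj_0 [simp]: "bproj z 0 = 0"
  by (simp add: bproj_def vec_eq_iff)

lemma linear_bproj: "linear (bproj z)"
  by (rule linearI) (simp_all add: bproj_add bproj_scaleR)

lemma bcomb_add: "bcomb z (p + p') (q + q') = bcomb z p q + bcomb z p' q'"
  and bcomb_scaleR: "bcomb z (r *\<^sub>R p) (r *\<^sub>R q) = r *\<^sub>R bcomb z p q"
  by (auto simp: bcomb_def vec_eq_iff algebra_simps add_divide_distrib diff_divide_distrib scaleR_conv_of_real[where 'a=complex]
      split: sum.splits)

lemma linear_bcomb: "linear (bcomb z 0)"
  using bcomb_add[of z 0 0] bcomb_scaleR[of z _ 0] by (intro linearI) auto

lemma boundary_form_diag:
  assumes "z = \<i> \<or> z = - \<i>"
  shows "hip (bproj z v) (bproj z w) - hip (bproj (- z) v) (bproj (- z) w) = - 2 * z * hip v (Jmat *v w)"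
proof -
  have "(\<Sum>i\<in>UNIV. cnj (v $ Inl i + z * v $ Inr i) * (w $ Inl i + z * w $ Inr i)) -
      (\<Sum>i\<in>UNIV. cnj (v $ Inl i - z * v $ Inr i) * (w $ Inl i - z * w $ Inr i)) =
      (\<Sum>i\<in>UNIV. - 2 * z * (cnj (v $ Inl i) * (- w $ Inr i)) + - 2 * z * (cnj (v $ Inr i) * w $ Inl i))"
    unfolding sum_subtractf[symmetric] using assms by (intro sum.cong) (auto simp: algebra_simps)
  then show ?thesis
    by (simp add: hip_def bproj_def sum_UNIV_Plus sum.distrib sum_distrib_left algebra_simps sum_negf sum_subtractf)
qed

text \<open>The form \<open>b\<^sub>z\<close> of the overview as a difference of squares: real by
  construction and with visible signature. \<open>bform_eq\<close> gives its expression through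
  \<open>Jmat\<close>.\<close>

definition bform :: "complex \<Rightarrow> complex^('n::finite + 'n) \<Rightarrow> real" where
  "bform z v = (norm (bproj z v))\<^sup>2 - (norm (bproj (- z) v))\<^sup>2"

lemma bform_eq:
  assumes "z = \<i> \<or> z = - \<i>"
  shows "complex_of_real (bform z v) = - 2 * z * hip v (Jmat *v v)"
  using boundary_form_diag[OF assms, of v v] by (simp add: bform_def hip_self)

lemma bform_uminus: "bform (- z) v = - bform z v"
  by (simp add: bform_def)

text \<open>Both cross terms vanish because \<open>Jmat\<close> is skew-adjoint. This splits a
  coupled boundary value into a given vector and a remainder.\<close>

lemma bform_add_orth:
  assumes "z = \<i> \<or> z = - \<i>" and "hip a (Jmat *v r) = 0"
  shows "bform z (a + r) = bform z a + bform z r"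
proof -
  have "hip r (Jmat *v a) = 0"
    using assms(2) hip_Jmat_left[of a r] cnj_hip[of "Jmat *v a" r] by (metis add.inverse_neutral complex_cnj_zero)
  then have "complex_of_real (bform z (a + r)) = complex_of_real (bform z a + bform z r)"
    unfolding of_real_add bform_eq[OF assms(1)] using assms(2)
    by (simp add: mv_add hip_add_left hip_add_right algebra_simps)
  then show ?thesis by (simp only: of_real_eq_iff)
qed

subsection \<open>Canonical systems\<close>

lemma measurable_bilinear:
  fixes h :: "'a::euclidean_space \<Rightarrow> 'b::euclidean_space \<Rightarrow> 'c::euclidean_space"
  assumes "bilinear h" "f \<in> borel_measurable M" "g \<in> borel_measurable M"
  shows "(\<lambda>x. h (f x) (g x)) \<in> borel_measurable M"
proof (rule borel_measurable_continuous_Pair[OF assms(2,3)])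
  show "continuous_on UNIV (\<lambda>x. h (fst x) (snd x))"
    using bounded_bilinear.continuous_on[OF _ continuous_on_fst[OF continuous_on_id] continuous_on_snd[OF continuous_on_id]]
      assms(1) unfolding bilinear_conv_bounded_bilinear by blast
qed

definition qf :: "(real \<Rightarrow> complex^'m::finite^'m) \<Rightarrow> (real \<Rightarrow> complex^'m) \<Rightarrow> real \<Rightarrow> real" where
  "qf H f x = Re (hip (f x) (H x *v f x))"

text \<open>Positivity is asked at every point; the final theorem reduces to this by replacing
  \<open>H\<close> with 0 on a null set and outside the open half line.\<close>

locale canonical_system =
  fixes H :: "real \<Rightarrow> complex^('n::finite + 'n)^('n + 'n)"
  assumes H_meas: "H \<in> borel_measurable lebesgue"
    and psd_H: "\<And>x. psd (H x)"
    and H_int: "\<And>b. H absolutely_integrable_on {0..b}"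
    and H_definite: "\<And>v. (AE x in lebesgue. 0 < x \<longrightarrow> H x *v v = 0) \<Longrightarrow> v = 0"
begin

text \<open>\<open>L2H\<close> in terms of the gauge integral. Measurability is asked on the half
  line alone, since nothing controls solutions of the system at negative arguments.\<close>

definition sq_int :: "(real \<Rightarrow> complex^('n + 'n)) \<Rightarrow> bool" where
  "sq_int f \<longleftrightarrow> f \<in> borel_measurable (lebesgue_on {0<..}) \<and> qf H f integrable_on {0<..}"

text \<open>The equation \<open>J f' = - H g\<close> solved for the derivative by means of
  \<open>J J = - 1\<close>.\<close>

definition solves_on :: "real \<Rightarrow> real \<Rightarrow> (real \<Rightarrow> complex^('n + 'n)) \<Rightarrow> (real \<Rightarrow> complex^('n + 'n)) \<Rightarrow> bool" where
  "solves_on a b f g \<longleftrightarrow> abs_cont_on a b f \<and>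
     (AE x in lebesgue. a < x \<and> x < b \<longrightarrow> (f has_vector_derivative Jmat *v (H x *v g x)) (at x))"

lemma qf_nonneg: "0 \<le> qf H f x"
  unfolding qf_def by (rule psd_nonneg[OF psd_H])

lemma hip_H_swap: "hip (H x *v v) w = hip v (H x *v w)"
  by (rule hip_psd[OF psd_H])

lemma H_meas_on: "H \<in> borel_measurable (lebesgue_on S)"
  using H_meas by (rule measurable_restrict_space1)

lemma form_measurable:
  assumes "f \<in> borel_measurable (lebesgue_on S)" "g \<in> borel_measurable (lebesgue_on S)"
  shows "(\<lambda>x. hip (f x) (H x *v g x)) \<in> borel_measurable (lebesgue_on S)"
  by (intro measurable_bilinear[OF bilinear_hip] measurable_bilinear[OF bilinear_matrix_vector_mult] assms H_meas_on)

lemma norm_form_le: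
  assumes "t > 0"
  shows "norm (hip (f x) (H x *v g x)) \<le> (t * qf H f x + qf H g x / t) / 2"
  unfolding qf_def by (rule psd_weighted_Cauchy_Schwarz[OF psd_H assms])

lemma sq_int_integrable_on:
  assumes "sq_int f" "0 \<le> a"
  shows "qf H f integrable_on {a..b}"
proof -
  have "qf H f absolutely_integrable_on {0<..}"
    using assms(1) by (intro nonnegative_absolutely_integrable_1) (auto simp: sq_int_def qf_nonneg)
  then have "qf H f absolutely_integrable_on {a<..<b}"
    by (rule set_integrable_subset) (use assms in auto)
  then have "qf H f integrable_on {a<..<b}"
    by (rule set_lebesgue_integral_eq_integral(1))
  then show ?thesis by (simp add: integrable_on_open_interval_real)
qed

lemma sq_int_integral_le:
  assumes "sq_int f" "0 \<le> a"
  shows "integral {a..b} (qf H f) \<le> integral {0<..} (qf H f)"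
proof -
  have "integral {a..b} (qf H f) = integral {a<..<b} (qf H f)" by (rule integral_open_interval_real)
  also have "\<dots> \<le> integral {0<..} (qf H f)"
    using assms sq_int_integrable_on[OF assms, of b]
    by (intro integral_subset_le) (auto simp: qf_nonneg sq_int_def integrable_on_open_interval_real)
  finally show ?thesis .
qed

lemma continuous_qf_integrable:
  assumes "continuous_on {0..b} f"
  shows "(\<lambda>x. hip (f x) (H x *v f x)) absolutely_integrable_on {0..b}" "qf H f integrable_on {0..b}"
proof -
  have Hf: "(\<lambda>x. H x *v f x) absolutely_integrable_on {0..b}"
    by (rule absolutely_integrable_matrix_vector_mult[OF H_int assms])
  show *: "(\<lambda>x. hip (f x) (H x *v f x)) absolutely_integrable_on {0..b}"
  proof (rule absolutely_integrable_bounded_measurable_product[OF bilinear_hip _ _ _ Hf])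
    show "f \<in> borel_measurable (lebesgue_on {0..b})"
      using assms by (intro continuous_imp_measurable_on_sets_lebesgue) auto
    show "bounded (f ` {0..b})"
      using assms by (auto intro!: compact_imp_bounded compact_continuous_image)
  qed auto
  have "(\<lambda>x. hip (f x) (H x *v f x)) integrable_on {0..b}"
    using * by (rule set_lebesgue_integral_eq_integral(1))
  from integrable_linear[OF this bounded_linear_Re] show "qf H f integrable_on {0..b}"
    by (simp add: o_def qf_def[abs_def])
qed

lemma form_absolutely_integrable:
  assumes f: "f \<in> borel_measurable (lebesgue_on {a..b})" "qf H f integrable_on {a..b}"
    and g: "g \<in> borel_measurable (lebesgue_on {a..b})" "qf H g integrable_on {a..b}"
  shows "(\<lambda>x. hip (f x) (H x *v g x)) absolutely_integrable_on {a..b}"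
proof (rule measurable_bounded_by_integrable_imp_absolutely_integrable)
  show "(\<lambda>x. hip (f x) (H x *v g x)) \<in> borel_measurable (lebesgue_on {a..b})"
    by (rule form_measurable[OF f(1) g(1)])
  show "(\<lambda>x. (1 * qf H f x + qf H g x / 1) / 2) integrable_on {a..b}"
    using integrable_add[OF f(2) g(2)] by (auto intro: integrable_on_divide)
  show "norm (hip (f x) (H x *v g x)) \<le> (1 * qf H f x + qf H g x / 1) / 2" for x
    by (rule norm_form_le) simp
qed auto

lemma integral_norm_form_le:
  assumes f: "f \<in> borel_measurable (lebesgue_on {a..b})" "qf H f integrable_on {a..b}"
    and g: "g \<in> borel_measurable (lebesgue_on {a..b})" "qf H g integrable_on {a..b}"
    and "t > 0"
  shows "integral {a..b} (\<lambda>x. norm (hip (f x) (H x *v g x))) \<le>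
    (t * integral {a..b} (qf H f) + integral {a..b} (qf H g) / t) / 2"
proof -
  have i: "(\<lambda>x. t * qf H f x) integrable_on {a..b}" "(\<lambda>x. qf H g x / t) integrable_on {a..b}"
    using integrable_on_mult_right[OF f(2), of t] integrable_on_divide[OF g(2), of t] by auto
  have "integral {a..b} (\<lambda>x. norm (hip (f x) (H x *v g x))) \<le> integral {a..b} (\<lambda>x. (t * qf H f x + qf H g x / t) / 2)"
  proof (rule integral_le)
    show "(\<lambda>x. norm (hip (f x) (H x *v g x))) integrable_on {a..b}"
      using form_absolutely_integrable[OF f g] by (simp add: absolutely_integrable_on_def)
    show "(\<lambda>x. (t * qf H f x + qf H g x / t) / 2) integrable_on {a..b}"
      using integrable_add[OF i] by (rule integrable_on_divide)
  qed (rule norm_form_le[OF \<open>t > 0\<close>])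
  also have "\<dots> = (t * integral {a..b} (qf H f) + integral {a..b} (qf H g) / t) / 2"
    using i by (simp add: integral_add)
  finally show ?thesis .
qed

text \<open>In the derivative of \<open>hip (f x) (Jmat *v h x)\<close> the factors
  \<open>Jmat\<close> cancel, since \<open>Jmat\<close> preserves \<open>hip\<close> and squares to
  -1. The product is absolutely continuous, so the derivative integrates back.\<close>

lemma Lagrange_identity:
  assumes "a \<le> b" and f: "solves_on a b f g" and h: "solves_on a b h k"
  shows "((\<lambda>x. hip (g x) (H x *v h x) - hip (f x) (H x *v k x)) has_integral
    (hip (f b) (Jmat *v h b) - hip (f a) (Jmat *v h a))) {a..b}"
proof (rule fundamental_theorem_of_calculus_abs_cont[OF \<open>a \<le> b\<close>])
  have J: "bounded_linear (\<lambda>v. Jmat *v v :: complex^('n + 'n))"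
    by (rule bounded_bilinear.bounded_linear_right[OF bounded_bilinear_matrix_vector_mult])
  have bh: "bounded_bilinear (hip :: complex^('n + 'n) \<Rightarrow> _)"
    using bilinear_hip by (simp add: bilinear_conv_bounded_bilinear)
  show "abs_cont_on a b (\<lambda>x. hip (f x) (Jmat *v h x))"
    using f h unfolding solves_on_def
    by (intro abs_cont_on_bounded_bilinear[OF _ _ bh] abs_cont_on_bounded_linear[OF _ J]) auto
  have "AE x in lebesgue. a < x \<and> x < b \<longrightarrow> (f has_vector_derivative Jmat *v (H x *v g x)) (at x)"
       "AE x in lebesgue. a < x \<and> x < b \<longrightarrow> (h has_vector_derivative Jmat *v (H x *v k x)) (at x)"
    using f h by (auto simp: solves_on_def)
  then show "AE x in lebesgue. a < x \<and> x < b \<longrightarrow> ((\<lambda>x. hip (f x) (Jmat *v h x)) has_vector_derivative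
      hip (g x) (H x *v h x) - hip (f x) (H x *v k x)) (at x)"
  proof eventually_elim
    case (elim x)
    show ?case
    proof
      assume "a < x \<and> x < b"
      with elim have d: "(f has_vector_derivative Jmat *v (H x *v g x)) (at x)"
        "((\<lambda>x. Jmat *v h x) has_vector_derivative Jmat *v (Jmat *v (H x *v k x))) (at x)"
        using bounded_linear.has_vector_derivative[OF J, of h _ "at x"] by blast+
      from bounded_bilinear.has_vector_derivative[OF bh d]
      show "((\<lambda>x. hip (f x) (Jmat *v h x)) has_vector_derivative
          hip (g x) (H x *v h x) - hip (f x) (H x *v k x)) (at x)"
        by (simp add: hip_Jmat_Jmat hip_minus_right hip_H_swap)
    qed
  qed
qed

lemma energy_has_integral:
  assumes "a \<le> b" and z: "z = \<i> \<or> z = - \<i>" and u: "solves_on a b u (\<lambda>x. z *s u x)"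
  shows "(qf H u has_integral (bform z (u a) - bform z (u b)) / 4) {a..b}"
proof -
  have zz: "cnj z = - z" "z * z = -1" using z by auto
  have "((\<lambda>x. hip (z *s u x) (H x *v u x) - hip (u x) (H x *v (z *s u x))) has_integral
    (hip (u b) (Jmat *v u b) - hip (u a) (Jmat *v u a))) {a..b}"
    by (rule Lagrange_identity[OF \<open>a \<le> b\<close> u u])
  also have "(\<lambda>x. hip (z *s u x) (H x *v u x) - hip (u x) (H x *v (z *s u x))) = (\<lambda>x. - 2 * z * hip (u x) (H x *v u x))"
    by (simp add: mv_smult hip_smult_left hip_smult_right zz mult.assoc)
  \<comment> \<open>As \<open>z * z = -1\<close>, the factor \<open>z / 2\<close> turns
    \<open>- 2 * z\<close> into 1; combined with the factor in \<open>bform_eq\<close> it produces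
    the denominator 4.\<close>
  finally have "((\<lambda>x. z / 2 * (- 2 * z * hip (u x) (H x *v u x))) has_integral
    z / 2 * (hip (u b) (Jmat *v u b) - hip (u a) (Jmat *v u a))) {a..b}"
    by (rule has_integral_mult_right)
  also have "(\<lambda>x. z / 2 * (- 2 * z * hip (u x) (H x *v u x))) = (\<lambda>x. hip (u x) (H x *v u x))"
    using zz(2) by (simp add: algebra_simps flip: mult.assoc)
  also have "z / 2 * (hip (u b) (Jmat *v u b) - hip (u a) (Jmat *v u a)) =
      complex_of_real ((bform z (u a) - bform z (u b)) / 4)"
    using bform_eq[OF z, of "u a"] bform_eq[OF z, of "u b"] by (simp add: algebra_simps)
  finally have "((\<lambda>x. hip (u x) (H x *v u x)) has_integral complex_of_real ((bform z (u a) - bform z (u b)) / 4)) {a..b}" .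
  from has_integral_linear[OF this bounded_linear_Re] show ?thesis
    by (simp only: o_def qf_def[abs_def] Re_complex_of_real)
qed

text \<open>In contrast to \<open>loc_abs_cont\<close>, absolute continuity includes the endpoint 0,
  so that \<open>u 0\<close> is a genuine initial value.\<close>

definition is_sol :: "complex \<Rightarrow> (real \<Rightarrow> complex^('n + 'n)) \<Rightarrow> bool" where
  "is_sol z u \<longleftrightarrow> (\<forall>b. abs_cont_on 0 b u) \<and>
     (AE x in lebesgue. 0 < x \<longrightarrow> (u has_vector_derivative Jmat *v (H x *v (z *s u x))) (at x))"

lemma is_sol_imp_solves_on:
  assumes u: "is_sol z u" and "0 \<le> a"
  shows "solves_on a b u (\<lambda>x. z *s u x)"
  unfolding solves_on_def
proof
  show "abs_cont_on a b u"
    using u \<open>0 \<le> a\<close> unfolding is_sol_def by (blast intro: abs_cont_on_subset)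
  have "AE x in lebesgue. 0 < x \<longrightarrow> (u has_vector_derivative Jmat *v (H x *v (z *s u x))) (at x)"
    using u by (simp add: is_sol_def)
  then show "AE x in lebesgue. a < x \<and> x < b \<longrightarrow> (u has_vector_derivative Jmat *v (H x *v (z *s u x))) (at x)"
    by (rule eventually_mono) (use \<open>0 \<le> a\<close> in auto)
qed

lemma is_sol_continuous: "is_sol z u \<Longrightarrow> continuous_on {0..b} u"
  unfolding is_sol_def by (blast intro: abs_cont_on_imp_continuous_on)

lemma is_sol_measurable: "is_sol z u \<Longrightarrow> u \<in> borel_measurable (lebesgue_on {0<..})"
proof -
  assume u: "is_sol z u"
  have "continuous_on {0<..} u"
  proof (intro continuous_at_imp_continuous_on ballI)
    fix x :: real assume "x \<in> {0<..}"
    then have "x \<in> interior {0..x+1}" by simp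
    then show "isCont u x" using is_sol_continuous[OF u, of "x + 1"] by (meson continuous_on_interior)
  qed
  then show ?thesis by (intro continuous_imp_measurable_on_sets_lebesgue) auto
qed

lemma is_sol_energy:
  assumes "is_sol z u" "z = \<i> \<or> z = - \<i>" "0 \<le> a" "a \<le> b"
  shows "qf H u integrable_on {a..b}" "integral {a..b} (qf H u) = (bform z (u a) - bform z (u b)) / 4"
  using energy_has_integral[OF assms(4,2) is_sol_imp_solves_on[OF assms(1,3)]] by (auto simp: integral_unique)

lemma is_sol_add:
  assumes u: "is_sol z u" and v: "is_sol z v"
  shows "is_sol z (\<lambda>x. u x + v x)"
proof -
  have "AE x in lebesgue. 0 < x \<longrightarrow> (u has_vector_derivative Jmat *v (H x *v (z *s u x))) (at x)"
    "AE x in lebesgue. 0 < x \<longrightarrow> (v has_vector_derivative Jmat *v (H x *v (z *s v x))) (at x)"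
    using u v by (auto simp: is_sol_def)
  then have "AE x in lebesgue. 0 < x \<longrightarrow>
      ((\<lambda>x. u x + v x) has_vector_derivative Jmat *v (H x *v (z *s (u x + v x)))) (at x)"
  proof eventually_elim
    case (elim x)
    then show ?case
      using has_vector_derivative_add[of u _ "at x" v] by (simp add: mv_add vector_add_ldistrib)
  qed
  with u v show ?thesis unfolding is_sol_def by (auto intro: abs_cont_on_add)
qed

lemma bounded_linear_smult: "bounded_linear (\<lambda>v :: complex^'k. c *s v)"
proof -
  have "linear (\<lambda>v :: complex^'k. c *s v)"
    by (rule linearI) (simp_all add: vec_eq_iff algebra_simps)
  then show ?thesis by (simp add: linear_conv_bounded_linear)
qed

lemma is_sol_smult: "is_sol z u \<Longrightarrow> is_sol z (\<lambda>x. c *s u x)"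
proof -
  assume u: "is_sol z u"
  have "AE x in lebesgue. 0 < x \<longrightarrow> (u has_vector_derivative Jmat *v (H x *v (z *s u x))) (at x)"
    using u by (simp add: is_sol_def)
  then have "AE x in lebesgue. 0 < x \<longrightarrow> ((\<lambda>x. c *s u x) has_vector_derivative Jmat *v (H x *v (z *s (c *s u x)))) (at x)"
  proof eventually_elim
    case (elim x)
    show ?case
    proof
      assume "0 < x"
      with elim have "((\<lambda>x. c *s u x) has_vector_derivative c *s (Jmat *v (H x *v (z *s u x)))) (at x)"
        using bounded_linear.has_vector_derivative[OF bounded_linear_smult, of u _ "at x" c] by blast
      then show "((\<lambda>x. c *s u x) has_vector_derivative Jmat *v (H x *v (z *s (c *s u x)))) (at x)"
        by (simp add: mv_smult mult.commute)
    qed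
  qed
  with u show ?thesis
    unfolding is_sol_def by (auto intro: abs_cont_on_bounded_linear[OF _ bounded_linear_smult])
qed

lemma is_sol_zero: "is_sol z (\<lambda>x. 0)"
  unfolding is_sol_def by (auto intro: abs_cont_on_const)

lemma is_sol_sum: "finite I \<Longrightarrow> (\<And>i. i \<in> I \<Longrightarrow> is_sol z (u i)) \<Longrightarrow> is_sol z (\<lambda>x. \<Sum>i\<in>I. u i x)"
  by (induction I rule: finite_induct) (auto intro: is_sol_zero is_sol_add)

lemma is_sol_exists: "\<exists>u. u 0 = v \<and> is_sol z u"
proof -
  define T where "T B = (\<chi> i j. z * (Jmat ** B) $ i $ j)" for B :: "complex^('n + 'n)^('n + 'n)"
  have "linear T"
    by (rule linearI) (simp_all add: T_def vec_eq_iff matrix_matrix_mult_def algebra_simps sum.distrib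
        scaleR_sum_right sum_distrib_left)
  then have T: "bounded_linear T" by (simp add: linear_conv_bounded_linear)
  have Tv: "T B *v w = Jmat *v (B *v (z *s w))" for B w
    by (simp add: matrix_vector_mul_assoc) (simp add: T_def matrix_vector_mult_def vec_eq_iff mult_ac)
  have "(\<lambda>x. T (H x)) absolutely_integrable_on {0..b}" for b
    using absolutely_integrable_linear[OF H_int T] by (simp add: o_def)
  from linear_ode_solvable[OF this] obtain u where "u 0 = v" "\<And>b. abs_cont_on 0 b u"
    "AE x in lebesgue. 0 < x \<longrightarrow> (u has_vector_derivative T (H x) *v u x) (at x)"
    by blast
  then show ?thesis unfolding is_sol_def Tv by blast
qed

text \<open>Uniqueness for the initial value problem is never needed: superposing one solution per basis
  vector gives solutions that depend linearly on the initial value.\<close>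

definition fsol :: "complex \<Rightarrow> complex^('n + 'n) \<Rightarrow> real \<Rightarrow> complex^('n + 'n)" where
  "fsol z v x = (\<Sum>i\<in>UNIV. v $ i *s (SOME u. u 0 = axis i 1 \<and> is_sol z u) x)"

lemma is_sol_fsol: "is_sol z (fsol z v)" and fsol_0: "fsol z v 0 = v"
proof -
  have *: "(SOME u. u 0 = axis i 1 \<and> is_sol z u) 0 = axis i 1 \<and> is_sol z (SOME u. u 0 = axis i 1 \<and> is_sol z u)" for i
    by (rule someI_ex[OF is_sol_exists])
  show "is_sol z (fsol z v)"
    unfolding fsol_def[abs_def] using * by (intro is_sol_sum is_sol_smult) auto
  show "fsol z v 0 = v" unfolding fsol_def using * by (simp add: basis_expansion)
qed

lemma fsol_add: "fsol z (v + w) x = fsol z v x + fsol z w x"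
  by (simp add: fsol_def vec.scale_left_distrib sum.distrib)

lemma fsol_smult: "fsol z (c *s v) x = c *s fsol z v x"
  unfolding fsol_def vec.scale_sum_right by simp

lemma fsol_scaleR: "fsol z (r *\<^sub>R v) x = r *\<^sub>R fsol z v x"
proof -
  have sc: "r *\<^sub>R w = complex_of_real r *s w" for w :: "complex^('n + 'n)"
    by (simp add: vec_eq_iff scaleR_conv_of_real[where 'a=complex])
  show ?thesis unfolding sc by (rule fsol_smult)
qed

lemma linear_fsol: "linear (\<lambda>v. fsol z v x)"
  by (rule linearI) (simp_all add: fsol_add fsol_scaleR)

lemma fsol_sum: "finite I \<Longrightarrow> fsol z (\<Sum>i\<in>I. w i) x = (\<Sum>i\<in>I. fsol z (w i) x)"
  using linear_sum[OF linear_fsol] by blast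

lemma sq_int_solI:
  assumes u: "is_sol z u" and z: "z = \<i> \<or> z = - \<i>"
    and bd: "\<And>b. 0 \<le> b \<Longrightarrow> integral {0..b} (qf H u) \<le> C"
  shows "sq_int u"
  unfolding sq_int_def
proof
  show "u \<in> borel_measurable (lebesgue_on {0<..})" by (rule is_sol_measurable[OF u])
  let ?f = "\<lambda>(k::nat) x. if x \<in> {0..real k} then qf H u x else 0"
  have i: "qf H u integrable_on {0..real k}" for k
    by (rule is_sol_energy(1)[OF u z]) auto
  have I: "integral {0<..} (?f k) = integral {0..real k} (qf H u)" for k
  proof -
    have "integral {0<..} (?f k) = integral ({0..real k} \<inter> {0<..}) (qf H u)"
      by (rule Henstock_Kurzweil_Integration.integral_restrict_Int)
    also have "\<dots> = integral {0..real k} (qf H u)"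
      by (rule integral_spike_set) (auto intro: negligible_subset[of "{0}"])
    finally show ?thesis .
  qed
  have "qf H u integrable_on {0<..} \<and> (\<lambda>k. integral {0<..} (?f k)) \<longlonglongrightarrow> integral {0<..} (qf H u)"
  proof (rule monotone_convergence_increasing)
    show "?f k integrable_on {0<..}" for k
      unfolding integrable_restrict_Int
      by (rule integrable_spike_set[OF i[of k]]) (auto intro: negligible_subset[of "{0}"])
    show "?f k x \<le> ?f (Suc k) x" for k x using qf_nonneg by auto
    show "(\<lambda>k. ?f k x) \<longlonglongrightarrow> qf H u x" if "x \<in> {0<..}" for x
    proof (rule tendsto_eventually)
      show "\<forall>\<^sub>F k in sequentially. ?f k x = qf H u x"
        using eventually_ge_at_top[of "nat \<lceil>x\<rceil>"]
      proof eventually_elim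
        case (elim k)
        then show ?case using that by (auto simp: nat_ceiling_le_eq)
      qed
    qed
    have "norm (integral {0<..} (?f k)) \<le> C" for k
      unfolding I using bd[of "real k"] integral_nonneg[OF i[of k]] qf_nonneg by auto
    then show "bounded (range (\<lambda>k. integral {0<..} (?f k)))"
      unfolding bounded_iff by blast
  qed
  then show "qf H u integrable_on {0<..}" by blast
qed

end

section \<open>Square integrable solutions as limits of boundary problems on finite
  intervals\<close>

context canonical_system
begin

lemma tendsto_linear:
  fixes T :: "'a::euclidean_space \<Rightarrow> 'b::real_normed_vector"
  shows "linear T \<Longrightarrow> (f \<longlongrightarrow> l) F \<Longrightarrow> ((\<lambda>x. T (f x)) \<longlongrightarrow> T l) F"
  using bounded_linear.tendsto[of T] by (simp add: linear_conv_bounded_linear)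

lemma tendsto_bform: "(f \<longlongrightarrow> l) F \<Longrightarrow> ((\<lambda>x. bform z (f x)) \<longlongrightarrow> bform z l) F"
  unfolding bform_def by (intro tendsto_intros tendsto_linear[OF linear_bproj])

text \<open>The energy on \<open>{0..b}\<close> depends only on the values at 0 and
  \<open>b\<close>, which are linear in the initial value; no estimate of the solution in between
  enters.\<close>

lemma energy_tendsto:
  assumes z: "z = \<i> \<or> z = - \<i>" and "0 \<le> b" and v: "v \<longlonglongrightarrow> l"
  shows "(\<lambda>k. integral {0..b} (qf H (fsol z (v k)))) \<longlonglongrightarrow> integral {0..b} (qf H (fsol z l))"
  unfolding is_sol_energy(2)[OF is_sol_fsol z order_refl \<open>0 \<le> b\<close>] fsol_0
  by (intro tendsto_intros tendsto_bform v tendsto_linear[OF linear_fsol]) auto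

lemma energy_mono:
  assumes z: "z = \<i> \<or> z = - \<i>" and u: "is_sol z u" and "0 \<le> a" "a \<le> b" "b \<le> c"
  shows "integral {a..b} (qf H u) \<le> integral {0..c} (qf H u)"
  using assms by (intro integral_subset_le is_sol_energy(1)[OF u z]) (auto simp: qf_nonneg)

text \<open>For fixed \<open>b\<close> the energy on \<open>{0..b}\<close> is eventually at most
  \<open>C\<close>, because \<open>L k\<close> passes \<open>b\<close>. The initial values converge
  first, and \<open>b\<close> grows afterwards.\<close>

lemma sq_int_limit_solution:
  assumes z: "z = \<i> \<or> z = - \<i>" and v: "v \<longlonglongrightarrow> l" and L: "filterlim L at_top sequentially"
    and bd: "\<And>k. integral {0..L k} (qf H (fsol z (v k))) \<le> C"
  shows "sq_int (fsol z l)"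
proof (rule sq_int_solI[OF is_sol_fsol z])
  fix b :: real assume "0 \<le> b"
  have "\<forall>\<^sub>F k in sequentially. b \<le> L k" using L by (simp add: filterlim_at_top)
  then have "\<forall>\<^sub>F k in sequentially. integral {0..b} (qf H (fsol z (v k))) \<le> C"
  proof eventually_elim
    case (elim k)
    then show ?case
      using energy_mono[OF z is_sol_fsol, of 0 b "L k" "v k"] bd[of k] \<open>0 \<le> b\<close> by simp
  qed
  then show "integral {0..b} (qf H (fsol z l)) \<le> C"
    by (intro tendsto_upperbound[OF energy_tendsto[OF z \<open>0 \<le> b\<close> v]]) auto
qed

text \<open>In the coordinates of \<open>bproj\<close> the graph of a contraction \<open>K\<close>
  is a subspace on which \<open>bform z\<close> is nonnegative. The condition at \<open>L\<close> is
  an affine system with as many equations as unknowns \<open>q\<close>. It is uniquely solvable: for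
  \<open>p = 0\<close> and \<open>a = 0\<close> the form is minus the squared norm of
  \<open>q\<close> at 0 and nonnegative at \<open>L\<close>, so nonnegative energy forces
  \<open>q = 0\<close>.\<close>

lemma boundary_problem_solvable:
  fixes K :: "complex^'n \<Rightarrow> complex^'n"
  assumes z: "z = \<i> \<or> z = - \<i>" and K: "linear K" "\<And>p. norm (K p) \<le> norm p" and "0 \<le> L"
  obtains q where "bproj (- z) (fsol z (bcomb z p q) L - a) = K (bproj z (fsol z (bcomb z p q) L - a))"
proof -
  have z0: "z \<noteq> 0" using z by auto
  define R where "R v = bproj (- z) v - K (bproj z v)" for v
  have linR: "linear R"
    unfolding R_def by (intro linear_compose_sub linear_bproj linear_compose[OF linear_bproj K(1), unfolded o_def])
  define G where "G q = R (fsol z (bcomb z 0 q) L)" for q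
  have linG: "linear G"
    unfolding G_def
    using linear_compose[OF linear_compose[OF linear_bcomb linear_fsol] linR] by (simp add: o_def)
  have "inj G"
    unfolding linear_injective_0[OF linG]
  proof (intro allI impI)
    fix q assume "G q = 0"
    then have "bproj (- z) (fsol z (bcomb z 0 q) L) = K (bproj z (fsol z (bcomb z 0 q) L))"
      by (simp add: G_def R_def)
    then have "0 \<le> bform z (fsol z (bcomb z 0 q) L)"
      using K(2) by (simp add: bform_def power_mono)
    moreover have "bform z (bcomb z 0 q) = - (norm q)\<^sup>2"
      using z0 by (simp add: bform_def)
    moreover have "0 \<le> integral {0..L} (qf H (fsol z (bcomb z 0 q)))"
      using is_sol_energy(1)[OF is_sol_fsol z order_refl \<open>0 \<le> L\<close>] qf_nonneg by (intro integral_nonneg) auto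
    moreover have "4 * integral {0..L} (qf H (fsol z (bcomb z 0 q))) = bform z (bcomb z 0 q) - bform z (fsol z (bcomb z 0 q) L)"
      using is_sol_energy(2)[OF is_sol_fsol z order_refl \<open>0 \<le> L\<close>, of "bcomb z 0 q"] unfolding fsol_0 by simp
    ultimately have "(norm q)\<^sup>2 \<le> 0" by linarith
    then show "q = 0" by simp
  qed
  then have "surj G" by (rule linear_injective_imp_surjective[OF linG]) (rule refl)
  then obtain q where q: "G q = - R (fsol z (bcomb z p 0) L - a)" by (metis surjD)
  have "bcomb z p q = bcomb z p 0 + bcomb z 0 q" using bcomb_add[of z p 0 0 q] by simp
  then have "R (fsol z (bcomb z p q) L - a) = R (fsol z (bcomb z p 0) L - a) + G q"
    by (simp add: fsol_add G_def linear_add[OF linR] linear_diff[OF linR])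
  then have "R (fsol z (bcomb z p q) L - a) = 0" using q by simp
  then show thesis by (intro that[of q]) (simp add: R_def)
qed

text \<open>Weyl's limiting argument: impose the condition with \<open>K = 0\<close> at
  \<open>L = k\<close>. The form is then nonnegative at \<open>k\<close>, which bounds the energy
  and keeps \<open>q k\<close> in the ball of radius \<open>norm p\<close>, so a subsequence
  converges.\<close>

lemma sq_int_solution_exists:
  assumes z: "z = \<i> \<or> z = - \<i>"
  shows "\<exists>q. sq_int (fsol z (bcomb z p q))"
proof -
  have z0: "z \<noteq> 0" using z by auto
  have "\<exists>q. bproj (- z) (fsol z (bcomb z p q) (real k)) = 0" for k
    using boundary_problem_solvable[OF z, of "\<lambda>_. 0" "real k" p 0] by (auto intro: linear_zero)
  then obtain q where q: "\<And>k. bproj (- z) (fsol z (bcomb z p (q k)) (real k)) = 0" by metis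
  have E: "integral {0..real k} (qf H (fsol z (bcomb z p (q k)))) \<le> ((norm p)\<^sup>2 - (norm (q k))\<^sup>2) / 4" for k
    unfolding is_sol_energy(2)[OF is_sol_fsol z order_refl of_nat_0_le_iff] fsol_0
    using z0 q[of k] by (simp add: bform_def)
  have "0 \<le> integral {0..real k} (qf H (fsol z (bcomb z p (q k))))" for k
    using is_sol_energy(1)[OF is_sol_fsol z order_refl] qf_nonneg by (intro integral_nonneg) auto
  then have "0 \<le> ((norm p)\<^sup>2 - (norm (q k))\<^sup>2) / 4" for k using E[of k] by (rule order_trans)
  then have "(norm (q k))\<^sup>2 \<le> (norm p)\<^sup>2" for k by simp
  then have "q k \<in> cball 0 (norm p)" for k by (simp add: power2_le_iff_abs_le)
  then obtain l r where r: "strict_mono r" "(q \<circ> r) \<longlonglongrightarrow> l"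
    using compact_cball[of "0 :: complex^'n" "norm p"] unfolding compact_def by metis
  have lin: "bcomb z p q' = bcomb z p 0 + bcomb z 0 q'" for q' using bcomb_add[of z p 0 0 q'] by simp
  have "sq_int (fsol z (bcomb z p l))"
  proof (rule sq_int_limit_solution[OF z])
    have "(\<lambda>k. bcomb z p 0 + bcomb z 0 ((q \<circ> r) k)) \<longlonglongrightarrow> bcomb z p 0 + bcomb z 0 l"
      by (intro tendsto_intros tendsto_linear[OF linear_bcomb] r)
    then show "(\<lambda>k. bcomb z p (q (r k))) \<longlonglongrightarrow> bcomb z p l"
      unfolding lin[symmetric] by simp
    show "filterlim (\<lambda>k. real (r k)) at_top sequentially"
      by (intro filterlim_compose[OF filterlim_real_sequentially] filterlim_subseq r)
    show "integral {0..real (r k)} (qf H (fsol z (bcomb z p (q (r k))))) \<le> (norm p)\<^sup>2 / 4" for k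
      by (rule order_trans[OF E]) simp
  qed
  then show ?thesis by blast
qed

text \<open>The condition is imposed on the difference \<open>r\<close> between the solution at
  \<open>L\<close> and \<open>a\<close>. The rank one map \<open>K\<close> is chosen so that it
  makes \<open>r\<close> orthogonal to \<open>a\<close> with respect to \<open>Jmat\<close>; it is a
  contraction exactly because \<open>bform z a < 0\<close> gives
  \<open>norm p1 \<le> norm q1\<close>. Hence the form at \<open>L\<close> is that of
  \<open>a\<close> plus the nonnegative form of \<open>r\<close>, and the pairing with
  \<open>a\<close> sees \<open>a\<close> alone.\<close>

lemma coupled_solution:
  assumes z: "z = \<i> \<or> z = - \<i>" and "0 \<le> L" and a: "bform z a < 0"
  obtains q where "bform z a \<le> bform z (fsol z (bcomb z 0 q) L)"
    "- 2 * z * hip a (Jmat *v fsol z (bcomb z 0 q) L) = bform z a"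
proof -
  define p1 q1 where "p1 = bproj z a" and "q1 = bproj (- z) a"
  have lt: "(norm p1)\<^sup>2 < (norm q1)\<^sup>2" using a by (simp add: bform_def p1_def q1_def)
  then have le: "norm p1 \<le> norm q1" and q1: "q1 \<noteq> 0"
    using power2_le_imp_le[OF less_imp_le[OF lt]] by auto
  define K where "K p = (hip p1 p / hip q1 q1) *s q1" for p :: "complex^'n"
  have K: "linear K"
    unfolding K_def by (rule linearI)
      (simp_all add: hip_add_right hip_scaleR_right vec_eq_iff add_divide_distrib scaleR_conv_of_real[where 'a=complex] algebra_simps)
  have hq: "hip q1 q1 \<noteq> 0" using q1 by (simp add: hip_self)
  have nK: "norm (K p) \<le> norm p" for p
  proof -
    have smult: "norm (c *s w) = norm c * norm w" for c and w :: "complex^'n"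
      by (simp add: norm_vec_def norm_mult L2_set_right_distrib)
    have "norm (K p) = norm (hip p1 p) / norm q1"
      using q1 by (simp add: K_def smult norm_divide hip_self norm_mult power2_eq_square)
    also have "\<dots> \<le> norm p1 * norm p / norm q1" by (intro divide_right_mono norm_hip_le) auto
    also have "\<dots> \<le> norm p" using mult_right_mono[OF le, of "norm p"] q1 by (simp add: divide_le_eq mult.commute)
    finally show ?thesis .
  qed
  obtain q where q: "bproj (- z) (fsol z (bcomb z 0 q) L - a) = K (bproj z (fsol z (bcomb z 0 q) L - a))"
    using boundary_problem_solvable[OF z K nK \<open>0 \<le> L\<close>] by metis
  define r where "r = fsol z (bcomb z 0 q) L - a"
  have w: "fsol z (bcomb z 0 q) L = a + r" by (simp add: r_def)
  have "hip p1 (bproj z r) - hip q1 (bproj (- z) r) = 0"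
    using q[folded r_def] hq by (simp add: K_def hip_smult_right)
  then have orth: "hip a (Jmat *v r) = 0"
    using boundary_form_diag[OF z, of a r] z by (auto simp: p1_def q1_def)
  have "0 \<le> bform z r"
    using q[folded r_def] nK by (simp add: bform_def power_mono)
  then have 1: "bform z a \<le> bform z (fsol z (bcomb z 0 q) L)"
    unfolding w bform_add_orth[OF z orth] by simp
  have 2: "- 2 * z * hip a (Jmat *v fsol z (bcomb z 0 q) L) = bform z a"
    unfolding w bform_eq[OF z] using orth by (simp add: mv_add hip_add_right)
  show thesis by (rule that[OF 1 2])
qed

lemma sq_int_measurable: "sq_int f \<Longrightarrow> 0 < a \<Longrightarrow> f \<in> borel_measurable (lebesgue_on {a..b})"
  unfolding sq_int_def by (auto elim: measurable_restrict_mono)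

text \<open>The exhausting intervals avoid 0 because members of the maximal relation satisfy their
  equation on \<open>{a..b}\<close> with \<open>a > 0\<close>.\<close>

lemma sq_int_tendsto:
  assumes f: "sq_int f"
  shows "(\<lambda>k. integral {inverse (real (Suc k))..real k} (qf H f)) \<longlonglongrightarrow> integral {0<..} (qf H f)"
proof -
  let ?I = "\<lambda>k. {inverse (real (Suc k))..real k}"
  let ?f = "\<lambda>(k::nat) x. if x \<in> ?I k then qf H f x else 0"
  have sub: "?I k \<inter> {0<..} = ?I k" for k by (auto intro: less_le_trans[of 0 "inverse (real (Suc k))"])
  have I: "integral {0<..} (?f k) = integral (?I k) (qf H f)" for k
    unfolding Henstock_Kurzweil_Integration.integral_restrict_Int sub ..
  have "(\<lambda>k. integral {0<..} (?f k)) \<longlonglongrightarrow> integral {0<..} (qf H f)"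
  proof (rule dominated_convergence(2))
    show "?f k integrable_on {0<..}" for k
      unfolding integrable_restrict_Int sub by (rule sq_int_integrable_on[OF f]) simp
    show "qf H f integrable_on {0<..}" using f by (simp add: sq_int_def)
    show "norm (?f k x) \<le> qf H f x" for k x using qf_nonneg[of f x] by auto
    show "(\<lambda>k. ?f k x) \<longlonglongrightarrow> qf H f x" if "x \<in> {0<..}" for x
    proof (rule tendsto_eventually)
      have "x > 0" using that by simp
      then obtain n where n: "inverse (real (Suc n)) < x" using reals_Archimedean by blast
      show "\<forall>\<^sub>F k in sequentially. ?f k x = qf H f x"
        using eventually_ge_at_top[of "nat \<lceil>x\<rceil>"] eventually_ge_at_top[of n]
      proof eventually_elim
        case (elim k)
        have "inverse (real (Suc k)) \<le> inverse (real (Suc n))" using elim by (intro le_imp_inverse_le) auto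
        then have "inverse (real (Suc k)) \<le> x" using n by linarith
        then show ?case using elim \<open>x > 0\<close> by (auto simp: nat_ceiling_le_eq)
      qed
    qed
  qed
  then show ?thesis unfolding I .
qed

lemma sq_int_tail:
  assumes f: "sq_int f" and "\<epsilon> > 0"
  obtains x where "1 \<le> x" "\<And>L. integral {x..L} (qf H f) < \<epsilon>"
proof -
  have "\<forall>\<^sub>F k in sequentially. integral {0<..} (qf H f) - \<epsilon> < integral {inverse (real (Suc k))..real k} (qf H f)"
    by (rule order_tendstoD(1)[OF sq_int_tendsto[OF f]]) (use \<open>\<epsilon> > 0\<close> in simp)
  then have "\<forall>\<^sub>F k in sequentially. 1 \<le> k \<and> integral {0<..} (qf H f) - \<epsilon> < integral {inverse (real (Suc k))..real k} (qf H f)"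
    using eventually_ge_at_top[of 1] by eventually_elim auto
  then obtain k where k: "1 \<le> k" "integral {0<..} (qf H f) - \<epsilon> < integral {inverse (real (Suc k))..real k} (qf H f)"
    by (auto simp: eventually_sequentially)
  show thesis
  proof (rule that[of "real k"])
    fix L
    show "integral {real k..L} (qf H f) < \<epsilon>"
    proof (cases "real k \<le> L")
      case True
      have "inverse (real (Suc k)) \<le> 1" by (simp add: field_simps)
      also have "1 \<le> real k" using k by simp
      finally have "integral {inverse (real (Suc k))..real k} (qf H f) + integral {real k..L} (qf H f)
          = integral {inverse (real (Suc k))..L} (qf H f)"
        using True by (intro Henstock_Kurzweil_Integration.integral_combine sq_int_integrable_on[OF f]) auto
      also have "\<dots> \<le> integral {0<..} (qf H f)" by (rule sq_int_integral_le[OF f]) simp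
      finally show ?thesis using k by linarith
    qed (use \<open>\<epsilon> > 0\<close> in simp)
  qed (use k in simp)
qed

text \<open>Split at a point \<open>x\<close> beyond which \<open>g\<close> has little energy. On
  \<open>{1..x}\<close> the energy of the solutions tends to 0; on \<open>{x..L k}\<close> it is
  only bounded, and the small tail of \<open>g\<close> compensates.\<close>

lemma mixed_integral_tendsto_0:
  assumes z: "z = \<i> \<or> z = - \<i>" and g: "sq_int g" and v: "v \<longlonglongrightarrow> 0" and L: "filterlim L at_top sequentially"
    and bd: "\<And>k. integral {0..L k} (qf H (fsol z (v k))) \<le> C"
  shows "(\<lambda>k. integral {1..L k} (\<lambda>x. norm (hip (g x) (H x *v fsol z (v k) x)))) \<longlonglongrightarrow> 0"
proof (rule tendstoI)
  fix \<epsilon> :: real assume "\<epsilon> > 0"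
  define G where "G = integral {0<..} (qf H g)"
  have G0: "0 \<le> G" unfolding G_def using g qf_nonneg by (intro integral_nonneg) (auto simp: sq_int_def)
  \<comment> \<open>The weights come before \<open>x\<close>: \<open>s\<close> makes the share of
    \<open>g\<close> small on \<open>{1..x}\<close>, \<open>t\<close> makes the bounded share of the
    solutions at most \<open>\<epsilon> / 2\<close> on the tail, and \<open>x\<close> is then chosen
    in terms of \<open>t\<close>. The summands 1 guard against \<open>G = 0\<close> and
    \<open>C = 0\<close>.\<close>
  define s where "s = \<epsilon> / (2 * (G + 1))"
  define t where "t = 2 * (\<bar>C\<bar> + 1) / \<epsilon>"
  have s: "s > 0" "s * G < \<epsilon> / 2" using \<open>\<epsilon> > 0\<close> G0 by (auto simp: s_def field_simps intro: add_nonneg_pos)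
  have t: "t > 0" using \<open>\<epsilon> > 0\<close> by (simp add: t_def add_nonneg_pos)
  have "t * (\<epsilon> / 2) = \<bar>C\<bar> + 1" using \<open>\<epsilon> > 0\<close> by (simp add: t_def)
  then have Ct: "C / t \<le> \<epsilon> / 2" using t by (simp add: divide_le_eq mult.commute)
  obtain x where x: "1 \<le> x" and tail: "\<And>L. integral {x..L} (qf H g) < \<epsilon> / 2 / t"
    using sq_int_tail[OF g, of "\<epsilon> / 2 / t"] \<open>\<epsilon> > 0\<close> t by (metis divide_pos_pos zero_less_numeral)
  have "(\<lambda>k. integral {0..x} (qf H (fsol z (v k)))) \<longlonglongrightarrow> integral {0..x} (qf H (fsol z 0))"
    using x by (intro energy_tendsto[OF z _ v]) auto
  also have "integral {0..x} (qf H (fsol z 0)) = 0"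
    by (simp add: qf_def[abs_def] fsol_def)
  finally have "\<forall>\<^sub>F k in sequentially. integral {0..x} (qf H (fsol z (v k))) < \<epsilon> / 2 * s"
    using \<open>\<epsilon> > 0\<close> s by (intro order_tendstoD(2)) auto
  moreover have "\<forall>\<^sub>F k in sequentially. x \<le> L k" using L by (simp add: filterlim_at_top)
  ultimately show "\<forall>\<^sub>F k in sequentially. dist (integral {1..L k} (\<lambda>x. norm (hip (g x) (H x *v fsol z (v k) x)))) 0 < \<epsilon>"
  proof eventually_elim
    case (elim k)
    let ?y = "fsol z (v k)" and ?h = "\<lambda>x. norm (hip (g x) (H x *v fsol z (v k) x))"
    have ym: "?y \<in> borel_measurable (lebesgue_on {a..b})" if "0 < a" for a b
      using is_sol_measurable[OF is_sol_fsol] by (rule measurable_restrict_mono) (use that in auto)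
    have yi: "qf H ?y integrable_on {a..b}" if "0 < a" for a b
      using is_sol_energy(1)[OF is_sol_fsol z, of a b] that by (cases "a \<le> b") auto
    note gm = sq_int_measurable[OF g] and gi = sq_int_integrable_on[OF g]
    have A: "integral {1..x} ?h \<le> (s * integral {1..x} (qf H g) + integral {1..x} (qf H ?y) / s) / 2"
      by (rule integral_norm_form_le) (use gm gi ym yi s in auto)
    have B: "integral {x..L k} ?h \<le> (t * integral {x..L k} (qf H g) + integral {x..L k} (qf H ?y) / t) / 2"
      by (rule integral_norm_form_le) (use gm gi ym yi t x in auto)
    have a1: "s * integral {1..x} (qf H g) \<le> s * G"
      unfolding G_def using s by (intro mult_left_mono sq_int_integral_le[OF g]) auto
    have "integral {1..x} (qf H ?y) \<le> integral {0..x} (qf H ?y)"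
      using x by (intro energy_mono[OF z is_sol_fsol]) auto
    then have a2: "integral {1..x} (qf H ?y) / s < \<epsilon> / 2"
      using elim s by (simp add: divide_less_eq)
    have b1: "t * integral {x..L k} (qf H g) \<le> \<epsilon> / 2"
      using tail[of "L k"] t by (simp add: field_simps)
    have "integral {x..L k} (qf H ?y) \<le> C"
      using energy_mono[OF z is_sol_fsol, of x "L k" "L k" "v k"] bd[of k] x elim by simp
    then have "integral {x..L k} (qf H ?y) / t \<le> C / t" using t by (intro divide_right_mono) auto
    then have b2: "integral {x..L k} (qf H ?y) / t \<le> \<epsilon> / 2" using Ct by linarith
    have hi: "?h integrable_on {1..L k}"
      using form_absolutely_integrable[OF gm gi ym yi, of 1 "L k"] by (simp add: absolutely_integrable_on_def)
    have "integral {1..L k} ?h = integral {1..x} ?h + integral {x..L k} ?h"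
      using Henstock_Kurzweil_Integration.integral_combine[OF x, of "L k" ?h] elim hi by simp
    moreover have "0 \<le> integral {1..L k} ?h" by (intro integral_nonneg hi) auto
    moreover have "2 * integral {1..x} ?h \<le> s * integral {1..x} (qf H g) + integral {1..x} (qf H ?y) / s"
      "2 * integral {x..L k} ?h \<le> t * integral {x..L k} (qf H g) + integral {x..L k} (qf H ?y) / t"
      using A B by simp_all
    ultimately have "integral {1..L k} ?h < \<epsilon>" "0 \<le> integral {1..L k} ?h"
      using a1 a2 b1 b2 s(2) by linarith+
    then show ?case by simp
  qed
qed

text \<open>The base point 1 is an arbitrary positive number; it stays away from 0, where elements
  of the maximal relation are not prescribed.\<close>

lemma Lagrange_norm_le:
  assumes "1 \<le> L" and f: "solves_on 1 L f g" and h: "solves_on 1 L h k"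
    and gh: "(\<lambda>x. hip (g x) (H x *v h x)) absolutely_integrable_on {1..L}"
    and fk: "(\<lambda>x. hip (f x) (H x *v k x)) absolutely_integrable_on {1..L}"
  shows "norm (hip (f L) (Jmat *v h L)) \<le> norm (hip (f 1) (Jmat *v h 1)) +
     integral {1..L} (\<lambda>x. norm (hip (g x) (H x *v h x))) + integral {1..L} (\<lambda>x. norm (hip (f x) (H x *v k x)))"
proof -
  have i: "(\<lambda>x. hip (g x) (H x *v h x)) integrable_on {1..L}" "(\<lambda>x. norm (hip (g x) (H x *v h x))) integrable_on {1..L}"
    "(\<lambda>x. hip (f x) (H x *v k x)) integrable_on {1..L}" "(\<lambda>x. norm (hip (f x) (H x *v k x))) integrable_on {1..L}"
    using gh fk by (simp_all add: absolutely_integrable_on_def)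
  have "hip (f L) (Jmat *v h L) = hip (f 1) (Jmat *v h 1) +
      (integral {1..L} (\<lambda>x. hip (g x) (H x *v h x)) - integral {1..L} (\<lambda>x. hip (f x) (H x *v k x)))"
    using integral_unique[OF Lagrange_identity[OF \<open>1 \<le> L\<close> f h]] integral_diff[OF i(1,3)] by (simp add: algebra_simps)
  also have "norm \<dots> \<le> norm (hip (f 1) (Jmat *v h 1)) +
      (norm (integral {1..L} (\<lambda>x. hip (g x) (H x *v h x))) + norm (integral {1..L} (\<lambda>x. hip (f x) (H x *v k x))))"
    by (intro norm_triangle_mono norm_triangle_le_diff order_refl)
  also have "norm (integral {1..L} (\<lambda>x. hip (g x) (H x *v h x))) \<le> integral {1..L} (\<lambda>x. norm (hip (g x) (H x *v h x)))"
    using i by (intro integral_norm_bound_integral) auto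
  also have "norm (integral {1..L} (\<lambda>x. hip (f x) (H x *v k x))) \<le> integral {1..L} (\<lambda>x. norm (hip (f x) (H x *v k x)))"
    using i by (intro integral_norm_bound_integral) auto
  finally show ?thesis by simp
qed

lemma norm_bform: "z = \<i> \<or> z = - \<i> \<Longrightarrow> \<bar>bform z a\<bar> = 2 * norm (hip a (Jmat *v a))"
  using arg_cong[OF bform_eq[of z a], of norm] by (auto simp: norm_mult)

text \<open>If the boundary form of \<open>f\<close> stays negative along \<open>L k\<close>, solutions coupled to \<open>f\<close> at \<open>L k\<close>
  have bounded energy; a limit of them cannot vanish, because by Lagrange's identity its boundary pairing
  with \<open>f\<close> would then tend to 0.\<close>

lemma sq_int_solution_from_boundary:
  assumes z: "z = \<i> \<or> z = - \<i>" and f: "sq_int f" and g: "sq_int g" and adm: "\<And>b. solves_on 1 b f g"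
    and "\<epsilon> > 0" and L: "filterlim L at_top sequentially" and L1: "\<And>k. 1 \<le> L k"
    and neg: "\<And>k. bform z (f (L k)) \<le> - \<epsilon>"
  shows "\<exists>q. q \<noteq> 0 \<and> sq_int (fsol z (bcomb z 0 q))"
proof -
  have z0: "z \<noteq> 0" and nz: "norm z = 1" using z by auto
  note fm = sq_int_measurable[OF f zero_less_one] and fi = sq_int_integrable_on[OF f zero_le_one]
  note gm = sq_int_measurable[OF g zero_less_one] and gi = sq_int_integrable_on[OF g zero_le_one]
  define F G where "F = integral {0<..} (qf H f)" and "G = integral {0<..} (qf H g)"
  \<comment> \<open>Lagrange's identity for \<open>f\<close> with itself, with both integrals
    estimated at weight 1; the factor 2 is that of \<open>norm_bform\<close>.\<close>
  define C where "C = 2 * (norm (hip (f 1) (Jmat *v f 1)) + F + G)"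
  have bound: "\<bar>bform z (f b)\<bar> \<le> C" if "1 \<le> b" for b
  proof -
    have le: "integral {1..b} (qf H f) \<le> F" "integral {1..b} (qf H g) \<le> G"
      unfolding F_def G_def by (auto intro: sq_int_integral_le f g)
    have "norm (hip (f b) (Jmat *v f b)) \<le> norm (hip (f 1) (Jmat *v f 1)) +
        integral {1..b} (\<lambda>x. norm (hip (g x) (H x *v f x))) + integral {1..b} (\<lambda>x. norm (hip (f x) (H x *v g x)))"
      by (rule Lagrange_norm_le[OF that adm adm form_absolutely_integrable[OF gm gi fm fi]
          form_absolutely_integrable[OF fm fi gm gi]])
    moreover have "integral {1..b} (\<lambda>x. norm (hip (g x) (H x *v f x))) \<le>
        (1 * integral {1..b} (qf H g) + integral {1..b} (qf H f) / 1) / 2"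
      by (rule integral_norm_form_le) (auto intro: fm fi gm gi)
    moreover have "integral {1..b} (\<lambda>x. norm (hip (f x) (H x *v g x))) \<le>
        (1 * integral {1..b} (qf H f) + integral {1..b} (qf H g) / 1) / 2"
      by (rule integral_norm_form_le) (auto intro: fm fi gm gi)
    ultimately show ?thesis
      unfolding norm_bform[OF z] C_def using le by simp
  qed
  have "\<exists>q. bform z (f (L k)) \<le> bform z (fsol z (bcomb z 0 q) (L k)) \<and>
      - 2 * z * hip (f (L k)) (Jmat *v fsol z (bcomb z 0 q) (L k)) = bform z (f (L k))" for k
  proof -
    have "0 \<le> L k" "bform z (f (L k)) < 0" using L1[of k] neg[of k] \<open>\<epsilon> > 0\<close> by auto
    from coupled_solution[OF z this] show ?thesis by metis
  qed
  then obtain q where q1: "\<And>k. bform z (f (L k)) \<le> bform z (fsol z (bcomb z 0 (q k)) (L k))"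
    and q2: "\<And>k. - 2 * z * hip (f (L k)) (Jmat *v fsol z (bcomb z 0 (q k)) (L k)) = bform z (f (L k))"
    by metis
  \<comment> \<open>Since \<open>p = 0\<close>, the initial form is minus the squared norm of
    \<open>q k\<close>, and the form at \<open>L k\<close> is at least \<open>- C\<close> by the
    coupling. One inequality thus bounds the energy and \<open>q k\<close> together.\<close>
  have E: "4 * integral {0..L k} (qf H (fsol z (bcomb z 0 (q k)))) \<le> C - (norm (q k))\<^sup>2" for k
  proof -
    have "0 \<le> L k" using L1[of k] by simp
    then have "4 * integral {0..L k} (qf H (fsol z (bcomb z 0 (q k)))) = - (norm (q k))\<^sup>2 - bform z (fsol z (bcomb z 0 (q k)) (L k))"
      unfolding is_sol_energy(2)[OF is_sol_fsol z order_refl \<open>0 \<le> L k\<close>] fsol_0 using z0 by (simp add: bform_def)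
    then show ?thesis using q1[of k] bound[OF L1[of k]] by linarith
  qed
  have E0: "0 \<le> integral {0..L k} (qf H (fsol z (bcomb z 0 (q k))))" for k
    using is_sol_energy(1)[OF is_sol_fsol z order_refl, of "L k"] L1[of k] qf_nonneg by (intro integral_nonneg) auto
  have "(norm (q k))\<^sup>2 \<le> C" for k using E[of k] E0[of k] by linarith
  then have "q k \<in> cball 0 (sqrt C)" for k by (simp add: real_le_rsqrt)
  then obtain l r where r: "strict_mono r" "(q \<circ> r) \<longlonglongrightarrow> l"
    using compact_cball[of "0 :: complex^'n" "sqrt C"] unfolding compact_def by metis
  have v: "(\<lambda>k. bcomb z 0 (q (r k))) \<longlonglongrightarrow> bcomb z 0 l"
    using tendsto_linear[OF linear_bcomb r(2)] by (simp add: o_def)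
  have Lr: "filterlim (\<lambda>k. L (r k)) at_top sequentially"
    by (intro filterlim_compose[OF L] filterlim_subseq r)
  have bd: "integral {0..L (r k)} (qf H (fsol z (bcomb z 0 (q (r k))))) \<le> C / 4" for k
  proof -
    have "4 * integral {0..L (r k)} (qf H (fsol z (bcomb z 0 (q (r k))))) \<le> C"
      by (rule order_trans[OF E]) simp
    then show ?thesis by simp
  qed
  have "sq_int (fsol z (bcomb z 0 l))"
    by (rule sq_int_limit_solution[OF z v Lr bd])
  moreover have "l \<noteq> 0"
  proof
    assume "l = 0"
    then have v0: "(\<lambda>k. bcomb z 0 (q (r k))) \<longlonglongrightarrow> 0" using v by (simp add: \<open>l = 0\<close> linear_0[OF linear_bcomb])
    let ?y = "\<lambda>k. fsol z (bcomb z 0 (q (r k)))"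
    let ?u = "\<lambda>k. norm (hip (f 1) (Jmat *v ?y k 1)) +
        integral {1..L (r k)} (\<lambda>x. norm (hip (g x) (H x *v ?y k x))) +
        integral {1..L (r k)} (\<lambda>x. norm (hip (f x) (H x *v ?y k x)))"
    have "linear (\<lambda>w. hip (f 1) (Jmat *v fsol z w 1))"
      by (rule linearI) (simp_all add: fsol_add fsol_scaleR mv_add hip_add_right
          linear_scale[OF bilinear_matrix_vector_mult[unfolded bilinear_def, THEN conjunct1, rule_format]] hip_scaleR_right)
    from tendsto_linear[OF this v0] have "(\<lambda>k. hip (f 1) (Jmat *v ?y k 1)) \<longlonglongrightarrow> 0"
      by (simp add: fsol_def)
    then have "(\<lambda>k. norm (hip (f 1) (Jmat *v ?y k 1))) \<longlonglongrightarrow> 0" by (rule tendsto_norm_zero)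
    then have "?u \<longlonglongrightarrow> 0 + 0 + 0"
      by (intro tendsto_add mixed_integral_tendsto_0[OF z _ v0 Lr bd] f g)
    then have "\<forall>\<^sub>F k in sequentially. ?u k < \<epsilon> / 2"
      using \<open>\<epsilon> > 0\<close> by (intro order_tendstoD(2)) auto
    then obtain k where k: "?u k < \<epsilon> / 2" by (auto simp: eventually_sequentially)
    have ym: "?y k \<in> borel_measurable (lebesgue_on {1..b})" for b
      using is_sol_measurable[OF is_sol_fsol] by (rule measurable_restrict_mono) auto
    have yi: "qf H (?y k) integrable_on {1..b}" for b
      using is_sol_energy(1)[OF is_sol_fsol z, of 1 b] by (cases "1 \<le> b") auto
    have nrm: "norm (hip (f x) (H x *v (z *s ?y k x))) = norm (hip (f x) (H x *v ?y k x))" for x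
      by (simp add: mv_smult hip_smult_right norm_mult nz)
    have "(\<lambda>x. z * hip (f x) (H x *v ?y k x)) absolutely_integrable_on {1..L (r k)}"
      by (intro set_integrable_mult_right form_absolutely_integrable fm fi ym yi)
    then have fk: "(\<lambda>x. hip (f x) (H x *v (z *s ?y k x))) absolutely_integrable_on {1..L (r k)}"
      by (simp add: mv_smult hip_smult_right)
    have "norm (hip (f (L (r k))) (Jmat *v ?y k (L (r k)))) \<le> norm (hip (f 1) (Jmat *v ?y k 1)) +
        integral {1..L (r k)} (\<lambda>x. norm (hip (g x) (H x *v ?y k x))) +
        integral {1..L (r k)} (\<lambda>x. norm (hip (f x) (H x *v (z *s ?y k x))))"
      by (rule Lagrange_norm_le[OF L1 adm is_sol_imp_solves_on[OF is_sol_fsol zero_le_one]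
          form_absolutely_integrable[OF gm gi ym yi] fk])
    then have "norm (hip (f (L (r k))) (Jmat *v ?y k (L (r k)))) < \<epsilon> / 2"
      unfolding nrm using k by linarith
    \<comment> \<open>The coupling identity: this quantity is at least \<epsilon>, while the
      preceding estimate puts it below \<epsilon>.\<close>
    moreover have "2 * norm (hip (f (L (r k))) (Jmat *v ?y k (L (r k)))) = \<bar>bform z (f (L (r k)))\<bar>"
      using arg_cong[OF q2[of "r k"], of norm] nz by (simp add: norm_mult)
    ultimately show False using neg[of "r k"] \<open>\<epsilon> > 0\<close> by linarith
  qed
  ultimately show ?thesis by blast
qed

end

subsection \<open>The maximal relation and deficiency indices\<close>

lemma nontrivial_relation:
  fixes p :: "nat \<Rightarrow> complex^'n::finite"
  assumes "CARD('n) < k"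
  obtains c where "\<exists>i<k. c i \<noteq> 0" "(\<Sum>i<k. c i *s p i) = 0"
proof (cases "inj_on p {..<k}")
  case True
  have "\<not> vec.independent (p ` {..<k})"
  proof
    assume "vec.independent (p ` {..<k})"
    then have "card (p ` {..<k}) \<le> vec.dim (UNIV :: (complex^'n) set)"
      by (intro vec.independent_card_le_dim) auto
    then have "card (p ` {..<k}) \<le> CARD('n)" by (simp only: vec_dim_card)
    then show False using assms by (simp add: card_image[OF True])
  qed
  then obtain u where u: "\<exists>v\<in>p ` {..<k}. u v \<noteq> 0" "(\<Sum>v\<in>p ` {..<k}. u v *s v) = 0"
    using vec.dependent_finite[of "p ` {..<k}"] by auto
  show thesis
  proof (rule that[of "\<lambda>i. u (p i)"])
    show "\<exists>i<k. u (p i) \<noteq> 0" using u(1) by auto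
    show "(\<Sum>i<k. u (p i) *s p i) = 0" using u(2) by (simp add: sum.reindex[OF True])
  qed
next
  case False
  \<comment> \<open>Linear dependence of a set does not see repetitions in a family; two equal
    members give the relation with coefficients 1 and -1.\<close>
  then obtain i j where ij: "i < k" "j < k" "i \<noteq> j" "p i = p j" by (auto simp: inj_on_def)
  have "(\<Sum>m<k. (if m = i then 1 else if m = j then -1 else 0) *s p m) =
      (\<Sum>m<k. (if m = i then p i else 0) + (if m = j then - p j else 0))"
    using ij by (intro sum.cong) (auto simp: vec_eq_iff)
  also have "\<dots> = 0" using ij by (simp add: sum.distrib)
  finally show thesis using ij
    by (intro that[of "\<lambda>m. if m = i then 1 else if m = j then -1 else 0"]) (auto intro!: exI[of _ i])
qed

lemma mv_minus: "(A :: complex^'m^'k) *v (- v) = - (A *v v)"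
  by (simp add: matrix_vector_mult_def vec_eq_iff sum_negf)

lemma Jmat_mult_eq_uminus_iff: "Jmat *v d = - w \<longleftrightarrow> d = Jmat *v w"
proof
  assume "Jmat *v d = - w"
  then have "Jmat *v (Jmat *v d) = Jmat *v (- w)" by simp
  then show "d = Jmat *v w" by (simp add: mv_minus)
qed simp

lemma loc_abs_cont_measurable:
  fixes f :: "real \<Rightarrow> 'a::euclidean_space"
  assumes "loc_abs_cont f"
  shows "f \<in> borel_measurable (lebesgue_on {0<..})"
proof -
  have "isCont f x" if "x > 0" for x
  proof -
    have "continuous_on {x/2..x+1} f"
      using assms that unfolding loc_abs_cont_def by (intro abs_cont_on_imp_continuous_on) auto
    moreover have "x \<in> interior {x/2..x+1}" using that by simp
    ultimately show ?thesis by (meson continuous_on_interior)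
  qed
  then have "continuous_on {0<..} f" by (intro continuous_at_imp_continuous_on) auto
  then show ?thesis by (intro continuous_imp_measurable_on_sets_lebesgue) auto
qed

section \<open>Linear structure of the maximal relation and limits at 0\<close>

context canonical_system
begin

lemma qf_measurable:
  assumes "f \<in> borel_measurable (lebesgue_on {0<..})"
  shows "qf H f \<in> borel_measurable (lebesgue_on {0<..})"
proof -
  have "(\<lambda>x. Re (hip (f x) (H x *v f x))) \<in> borel_measurable (lebesgue_on {0<..})"
    by (rule measurable_compose[OF form_measurable[OF assms assms]]) simp
  then show ?thesis by (simp add: qf_def[abs_def])
qed

text \<open>Bridge from the extended nonnegative integral of the definitions to the gauge integral;
  for the nonnegative \<open>qf H f\<close>, gauge and absolute integrability coincide.\<close>

lemma Hform_finite_iff: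
  assumes f: "f \<in> borel_measurable (lebesgue_on {0<..})"
  shows "Hform H f < \<infinity> \<longleftrightarrow> qf H f integrable_on {0<..}"
proof -
  have m: "(\<lambda>x. indicator {0<..} x *\<^sub>R qf H f x) \<in> borel_measurable lebesgue"
    using qf_measurable[OF f] by (simp add: borel_measurable_restrict_space_iff)
  have "Hform H f = (\<integral>\<^sup>+ x. ennreal (norm (indicator {0<..} x *\<^sub>R qf H f x)) \<partial>lebesgue)"
    unfolding Hform_def qf_def[symmetric]
    by (intro nn_integral_cong) (auto simp: indicator_def qf_nonneg)
  then have "Hform H f < \<infinity> \<longleftrightarrow> qf H f absolutely_integrable_on {0<..}"
    unfolding set_integrable_def integrable_iff_bounded using m by simp
  also have "\<dots> \<longleftrightarrow> qf H f integrable_on {0<..}"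
    by (auto intro: nonnegative_absolutely_integrable_1 qf_nonneg set_lebesgue_integral_eq_integral(1))
  finally show ?thesis .
qed

lemma L2H_iff: "f \<in> L2H H \<longleftrightarrow> f \<in> borel_measurable lebesgue \<and> sq_int f"
proof (cases "f \<in> borel_measurable lebesgue")
  case True
  have "f \<in> borel_measurable (lebesgue_on {0<..})" using True by (rule measurable_restrict_space1)
  then show ?thesis using True Hform_finite_iff by (simp add: L2H_def sq_int_def)
qed (simp add: L2H_def)

lemma Hform_eq: "sq_int f \<Longrightarrow> Hform H f = ennreal (integral {0<..} (qf H f))"
  unfolding Hform_def qf_def[symmetric] nn_integral_completion
  by (rule nn_integral_has_integral_lebesgue') (auto simp: qf_nonneg sq_int_def)

text \<open>By \<open>psd_form_eq_0\<close>, null functions are those annihilated by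
  \<open>H\<close>, so the differential equation cannot distinguish \<open>f\<close> from its
  representative.\<close>

lemma Hnull_iff:
  assumes f: "f \<in> borel_measurable (lebesgue_on {0<..})"
  shows "Hnull H f \<longleftrightarrow> (AE x in lebesgue. 0 < x \<longrightarrow> H x *v f x = 0)"
proof -
  have "(\<lambda>x. ennreal (qf H f x)) \<in> borel_measurable (lebesgue_on {0<..})"
    using qf_measurable[OF f] by simp
  then have m: "(\<lambda>x. ennreal (qf H f x) * indicator {0<..} x) \<in> borel_measurable lebesgue"
    by (simp add: borel_measurable_restrict_space_iff_ennreal)
  have "qf H f x = 0 \<longleftrightarrow> H x *v f x = 0" for x
    using psd_form_eq_0[OF psd_H, of "f x" x] by (auto simp: qf_def)
  then have "ennreal (qf H f x) * indicator {0<..} x = 0 \<longleftrightarrow> (0 < x \<longrightarrow> H x *v f x = 0)" for x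
    using qf_nonneg[of f x] by (auto simp: indicator_def ennreal_eq_zero_iff)
  then show ?thesis
    unfolding Hnull_def Hform_def qf_def[symmetric] nn_integral_0_iff_AE[OF m] by simp
qed

lemma sq_int_cong:
  assumes f: "sq_int f" and h: "h \<in> borel_measurable (lebesgue_on {0<..})"
    and ae: "AE x in lebesgue. 0 < x \<longrightarrow> H x *v f x = H x *v h x"
  shows "sq_int h"
proof -
  obtain N where N: "negligible N" "{x. \<not> (0 < x \<longrightarrow> H x *v f x = H x *v h x)} \<subseteq> N"
    using ae unfolding eventually_ae_filter_negligible by blast
  have "qf H h integrable_on {0<..}"
  proof (rule integrable_spike[OF _ N(1)])
    show "qf H f integrable_on {0<..}" using f by (simp add: sq_int_def)
    fix x assume "x \<in> {0<..} - N"
    then have e: "H x *v f x = H x *v h x" using N(2) by auto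
    \<comment> \<open>The form depends on \<open>H x *v f x\<close> alone: move \<open>H\<close>
      across the product and exchange the arguments one at a time.\<close>
    have "hip (h x) (H x *v h x) = hip (f x) (H x *v f x)"
      by (metis e hip_H_swap)
    then show "qf H h x = qf H f x" by (simp add: qf_def)
  qed
  then show ?thesis using h by (simp add: sq_int_def)
qed

lemma T_rep_iff: "T_rep H f g f0 \<longleftrightarrow> f \<in> borel_measurable lebesgue \<and> g \<in> borel_measurable lebesgue \<and>
    sq_int f \<and> sq_int g \<and> loc_abs_cont f0 \<and>
    (AE x in lebesgue. 0 < x \<longrightarrow> H x *v f x = H x *v f0 x) \<and>
    (AE x in lebesgue. 0 < x \<longrightarrow> (f0 has_vector_derivative Jmat *v (H x *v g x)) (at x))"
proof -
  have "Hnull H (\<lambda>x. f x - f0 x) \<longleftrightarrow> (AE x in lebesgue. 0 < x \<longrightarrow> H x *v f x = H x *v f0 x)"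
    if "f \<in> borel_measurable lebesgue" "loc_abs_cont f0"
  proof -
    have "(\<lambda>x. f x - f0 x) \<in> borel_measurable (lebesgue_on {0<..})"
      using measurable_restrict_space1[OF that(1)] loc_abs_cont_measurable[OF that(2)]
      by (intro borel_measurable_diff) auto
    then show ?thesis by (simp add: Hnull_iff matrix_vector_mult_diff_distrib)
  qed
  moreover have "(\<exists>d. (f0 has_vector_derivative d) (at x) \<and> Jmat *v d = - (H x *v g x)) \<longleftrightarrow>
      (f0 has_vector_derivative Jmat *v (H x *v g x)) (at x)" for x
    by (auto simp: Jmat_mult_eq_uminus_iff)
  ultimately show ?thesis unfolding T_rep_def L2H_iff by auto
qed

lemma T_rep_sq_int: "T_rep H f g f0 \<Longrightarrow> sq_int f0"
  unfolding T_rep_iff by (elim conjE, rule sq_int_cong[OF _ loc_abs_cont_measurable])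

lemma T_rep_solves_on:
  assumes "T_rep H f g f0" "0 < a"
  shows "solves_on a b f0 g"
  unfolding solves_on_def
proof
  show "abs_cont_on a b f0"
  proof (cases "a \<le> b")
    case True
    then show ?thesis using assms unfolding T_rep_iff loc_abs_cont_def by blast
  next
    case False
    have "abs_cont_on a a f0" using assms unfolding T_rep_iff loc_abs_cont_def by blast
    then show ?thesis by (rule abs_cont_on_subset) (use False in auto)
  qed
  have "AE x in lebesgue. 0 < x \<longrightarrow> (f0 has_vector_derivative Jmat *v (H x *v g x)) (at x)"
    using assms unfolding T_rep_iff by blast
  then show "AE x in lebesgue. a < x \<and> x < b \<longrightarrow> (f0 has_vector_derivative Jmat *v (H x *v g x)) (at x)"
    by (rule eventually_mono) (use assms in auto)
qed

lemma sq_int_add: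
  assumes f: "sq_int f" and g: "sq_int g"
  shows "sq_int (\<lambda>x. f x + g x)"
proof -
  have m: "(\<lambda>x. f x + g x) \<in> borel_measurable (lebesgue_on {0<..})"
    using f g by (auto simp: sq_int_def)
  have "qf H (\<lambda>x. f x + g x) absolutely_integrable_on {0<..}"
  proof (rule measurable_bounded_by_integrable_imp_absolutely_integrable[OF qf_measurable[OF m]])
    show "(\<lambda>x. 2 * qf H f x + 2 * qf H g x) integrable_on {0<..}"
      using f g by (intro integrable_add) (auto simp: sq_int_def)
    fix x
    \<comment> \<open>Parallelogram identity; dropping its nonnegative second term gives the
      majorant.\<close>
    have "qf H (\<lambda>x. f x + g x) x + qf H (\<lambda>x. f x - g x) x = 2 * qf H f x + 2 * qf H g x"
      by (simp add: qf_def mv_add matrix_vector_mult_diff_distrib hip_add_left hip_add_right hip_diff_left hip_diff_right)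
    then show "norm (qf H (\<lambda>x. f x + g x) x) \<le> 2 * qf H f x + 2 * qf H g x"
      using qf_nonneg[of "\<lambda>x. f x - g x" x] qf_nonneg[of "\<lambda>x. f x + g x" x] by simp
  qed auto
  then show ?thesis using m by (auto simp: sq_int_def intro: set_lebesgue_integral_eq_integral(1))
qed

lemma smult_measurable: "f \<in> borel_measurable M \<Longrightarrow> (\<lambda>x. c *s f x :: complex^'k) \<in> borel_measurable M"
  using measurable_compose[OF _ borel_measurable_continuous_onI[OF
      linear_continuous_on[OF bounded_linear_smult]], of f M c] by simp

lemma sq_int_smult:
  assumes f: "sq_int f"
  shows "sq_int (\<lambda>x. c *s f x)"
proof -
  have "qf H (\<lambda>x. c *s f x) = (\<lambda>x. (norm c)\<^sup>2 * qf H f x)"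
  proof
    fix x
    have "c * cnj c = complex_of_real ((norm c)\<^sup>2)"
      by (metis complex_norm_square mult.commute)
    then have "hip (c *s f x) (H x *v (c *s f x)) = (norm c)\<^sup>2 *\<^sub>R hip (f x) (H x *v f x)"
      by (simp only: scaleR_conv_of_real mv_smult hip_smult_left hip_smult_right mult.assoc[symmetric])
    then show "qf H (\<lambda>x. c *s f x) x = (norm c)\<^sup>2 * qf H f x"
      by (simp add: qf_def)
  qed
  then show ?thesis using f by (auto simp: sq_int_def smult_measurable intro: integrable_on_mult_right)
qed

lemma T_rep_add:
  assumes f: "T_rep H f g f0" and h: "T_rep H h k h0"
  shows "T_rep H (\<lambda>x. f x + h x) (\<lambda>x. g x + k x) (\<lambda>x. f0 x + h0 x)"
proof -
  have "loc_abs_cont (\<lambda>x. f0 x + h0 x)"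
    using f h unfolding T_rep_iff loc_abs_cont_def by (blast intro: abs_cont_on_add)
  moreover have "AE x in lebesgue. 0 < x \<longrightarrow> H x *v (f x + h x) = H x *v (f0 x + h0 x)"
  proof -
    have "AE x in lebesgue. 0 < x \<longrightarrow> H x *v f x = H x *v f0 x" "AE x in lebesgue. 0 < x \<longrightarrow> H x *v h x = H x *v h0 x"
      using f h unfolding T_rep_iff by blast+
    then show ?thesis by eventually_elim (simp add: mv_add)
  qed
  moreover have "AE x in lebesgue. 0 < x \<longrightarrow> ((\<lambda>x. f0 x + h0 x) has_vector_derivative Jmat *v (H x *v (g x + k x))) (at x)"
  proof -
    have "AE x in lebesgue. 0 < x \<longrightarrow> (f0 has_vector_derivative Jmat *v (H x *v g x)) (at x)"
      "AE x in lebesgue. 0 < x \<longrightarrow> (h0 has_vector_derivative Jmat *v (H x *v k x)) (at x)"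
      using f h unfolding T_rep_iff by blast+
    then show ?thesis
    proof eventually_elim
      case (elim x)
      then show ?case using has_vector_derivative_add[of f0 _ "at x" h0] by (simp add: mv_add)
    qed
  qed
  ultimately show ?thesis
    using f h unfolding T_rep_iff by (auto intro: sq_int_add)
qed

lemma T_rep_smult:
  assumes f: "T_rep H f g f0"
  shows "T_rep H (\<lambda>x. c *s f x) (\<lambda>x. c *s g x) (\<lambda>x. c *s f0 x)"
proof -
  have "loc_abs_cont (\<lambda>x. c *s f0 x)"
    using f unfolding T_rep_iff loc_abs_cont_def
    by (blast intro: abs_cont_on_bounded_linear[OF _ bounded_linear_smult])
  moreover have "AE x in lebesgue. 0 < x \<longrightarrow> H x *v (c *s f x) = H x *v (c *s f0 x)"
  proof -
    have "AE x in lebesgue. 0 < x \<longrightarrow> H x *v f x = H x *v f0 x"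
      using f unfolding T_rep_iff by blast
    then show ?thesis by eventually_elim (simp add: mv_smult)
  qed
  moreover have "AE x in lebesgue. 0 < x \<longrightarrow> ((\<lambda>x. c *s f0 x) has_vector_derivative Jmat *v (H x *v (c *s g x))) (at x)"
  proof -
    have "AE x in lebesgue. 0 < x \<longrightarrow> (f0 has_vector_derivative Jmat *v (H x *v g x)) (at x)"
      using f unfolding T_rep_iff by blast
    then show ?thesis
    proof eventually_elim
      case (elim x)
      then show ?case
        using bounded_linear.has_vector_derivative[OF bounded_linear_smult, of f0 _ "at x" c] by (simp add: mv_smult)
    qed
  qed
  ultimately show ?thesis
    using f unfolding T_rep_iff by (auto intro: sq_int_smult smult_measurable)
qed

lemma T_rep_zero: "T_rep H (\<lambda>x. 0) (\<lambda>x. 0) (\<lambda>x. 0)"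
  unfolding T_rep_iff loc_abs_cont_def
  by (auto simp: sq_int_def qf_def[abs_def] intro: abs_cont_on_const integrable_0)

lemma T_rep_sum: "finite I \<Longrightarrow> (\<And>i. i \<in> I \<Longrightarrow> T_rep H (f i) (g i) (f0 i)) \<Longrightarrow>
   T_rep H (\<lambda>x. \<Sum>i\<in>I. f i x) (\<lambda>x. \<Sum>i\<in>I. g i x) (\<lambda>x. \<Sum>i\<in>I. f0 i x)"
proof (induction I rule: finite_induct)
  case (insert i I)
  have "T_rep H (\<lambda>x. f i x + (\<Sum>i\<in>I. f i x)) (\<lambda>x. g i x + (\<Sum>i\<in>I. g i x)) (\<lambda>x. f0 i x + (\<Sum>i\<in>I. f0 i x))"
    by (intro T_rep_add insert) auto
  then show ?case using insert(1,2) by simp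
qed (simp add: T_rep_zero)

text \<open>The right-hand side contains \<open>f\<close>, not \<open>f0\<close>; since
  \<open>H f = H f0\<close> almost everywhere, the equation closes up in \<open>f0\<close> and the
  energy identity applies.\<close>

lemma T_rep_eigen_solves_on:
  assumes f: "T_rep H f (\<lambda>x. z *s f x) f0" and "0 < a"
  shows "solves_on a b f0 (\<lambda>x. z *s f0 x)"
proof -
  have "AE x in lebesgue. a < x \<and> x < b \<longrightarrow> (f0 has_vector_derivative Jmat *v (H x *v (z *s f x))) (at x)"
    using T_rep_solves_on[OF assms, of b] by (simp add: solves_on_def)
  moreover have "AE x in lebesgue. 0 < x \<longrightarrow> H x *v f x = H x *v f0 x"
    using f unfolding T_rep_iff by blast
  ultimately have "AE x in lebesgue. a < x \<and> x < b \<longrightarrow> (f0 has_vector_derivative Jmat *v (H x *v (z *s f0 x))) (at x)"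
    by eventually_elim (use \<open>0 < a\<close> in \<open>auto simp: mv_smult\<close>)
  then show ?thesis using T_rep_solves_on[OF assms, of b] by (simp add: solves_on_def)
qed

text \<open>Each component of \<open>H x *v g x\<close> is the form of a unit vector with
  \<open>g\<close>, bounded by the mean of a diagonal entry of \<open>H\<close> and
  \<open>qf H g\<close>; both are integrable up to 0.\<close>

lemma sq_int_imp_H_integrable:
  assumes g: "sq_int g"
  shows "(\<lambda>x. H x *v g x) absolutely_integrable_on {0..1}"
proof -
  have gm: "g \<in> borel_measurable (lebesgue_on {0<..<1})"
    using g unfolding sq_int_def by (auto elim: measurable_restrict_mono)
  have "(\<lambda>x. H x *v g x) absolutely_integrable_on {0<..<1}"
  proof (rule measurable_bounded_by_integrable_imp_absolutely_integrable)
    show "(\<lambda>x. H x *v g x) \<in> borel_measurable (lebesgue_on {0<..<1})"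
      by (intro measurable_bilinear[OF bilinear_matrix_vector_mult] gm H_meas_on)
    show "(\<lambda>x. \<Sum>i\<in>UNIV. (qf H (\<lambda>_. axis i 1) x + qf H g x) / 2) integrable_on {0<..<1}"
    proof (intro integrable_sum integrable_on_divide integrable_add finite)
      show "qf H g integrable_on {0<..<1}"
        using sq_int_integrable_on[OF g, of 0 1] by (simp add: integrable_on_open_interval_real)
      show "qf H (\<lambda>_. axis i 1) integrable_on {0<..<1}" for i
        using continuous_qf_integrable(2)[of 1 "\<lambda>_. axis i 1"] by (simp add: integrable_on_open_interval_real)
    qed
    fix x
    have hx: "(H x *v g x) $ i = hip (axis i 1) (H x *v g x)" for i
      by (simp add: hip_def axis_def if_distrib[of "\<lambda>c. cnj c * _"] cong: if_cong)
    have "norm (H x *v g x) \<le> (\<Sum>i\<in>UNIV. norm ((H x *v g x) $ i))"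
      unfolding norm_vec_def by (rule L2_set_le_sum) simp
    also have "\<dots> \<le> (\<Sum>i\<in>UNIV. (qf H (\<lambda>_. axis i 1) x + qf H g x) / 2)"
      unfolding hx using norm_form_le[of 1 "\<lambda>_. axis _ 1" x g] by (intro sum_mono) simp
    finally show "norm (H x *v g x) \<le> (\<Sum>i\<in>UNIV. (qf H (\<lambda>_. axis i 1) x + qf H g x) / 2)" .
  qed auto
  then show ?thesis
    by (rule absolutely_integrable_spike_set) (auto intro: negligible_subset[of "{0, 1}"])
qed

text \<open>Supplies an initial value for functions known to be absolutely continuous only away from
  0: the derivative is integrable up to 0, so integrate back from 1.\<close>

lemma T_rep_limit_at_0:
  assumes f: "T_rep H f g f0"
  shows "\<exists>l. (f0 \<longlongrightarrow> l) (at_right 0)"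
proof -
  define F where "F x = Jmat *v (H x *v g x)" for x
  have "sq_int g" using f unfolding T_rep_iff by blast
  then have "F absolutely_integrable_on {0..1}"
    unfolding F_def using absolutely_integrable_linear[OF sq_int_imp_H_integrable
        bounded_bilinear.bounded_linear_right[OF bounded_bilinear_matrix_vector_mult]] by (simp add: o_def)
  then have F: "F integrable_on {0..1}" by (rule set_lebesgue_integral_eq_integral(1))
  have eq: "f0 x = f0 1 - integral {x..1} F" if "0 < x" "x \<le> 1" for x
  proof -
    have "(F has_integral f0 1 - f0 x) {x..1}"
      using T_rep_solves_on[OF f \<open>0 < x\<close>, of 1] unfolding F_def solves_on_def
      by (intro fundamental_theorem_of_calculus_abs_cont that) auto
    then show ?thesis by (simp add: integral_unique)
  qed
  have "continuous_on {0..1} (\<lambda>x. integral {x..1} F)"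
    by (rule indefinite_integral_continuous_1'[OF F])
  then have "((\<lambda>x. integral {x..1} F) \<longlongrightarrow> integral {0..1} F) (at 0 within {0..1})"
    unfolding continuous_on_def by (rule bspec) simp
  then have "((\<lambda>x. integral {x..1} F) \<longlongrightarrow> integral {0..1} F) (at_right 0)"
    using at_within_Icc_at_right[of 0 "1::real"] by simp
  then have "((\<lambda>x. f0 1 - integral {x..1} F) \<longlongrightarrow> f0 1 - integral {0..1} F) (at_right 0)"
    by (intro tendsto_intros)
  moreover have "\<forall>\<^sub>F x in at_right 0. f0 1 - integral {x..1} F = f0 x"
    using eventually_at_right_less[of "0::real"] eventually_at_right_real[OF zero_less_one]
  proof eventually_elim
    case (elim x)
    then show ?case by (intro eq[symmetric]) auto
  qed
  ultimately have "(f0 \<longlongrightarrow> f0 1 - integral {0..1} F) (at_right 0)" by (rule Lim_transform_eventually)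
  then show ?thesis ..
qed

end

section \<open>Bounds for the deficiency indices and the boundary form at infinity\<close>

context canonical_system
begin

text \<open>The cut-off is there because \<open>L2H\<close> demands measurability on the whole line,
  whereas \<open>fsol\<close> is uncontrolled at negative arguments.\<close>

lemma T_rep_solution:
  assumes "sq_int (fsol z v)"
  shows "T_rep H (\<lambda>x. indicator {0<..} x *\<^sub>R fsol z v x) (\<lambda>x. z *s (indicator {0<..} x *\<^sub>R fsol z v x)) (fsol z v)"
proof -
  let ?f = "\<lambda>x. indicator {0<..} x *\<^sub>R fsol z v x"
  have ym: "fsol z v \<in> borel_measurable (lebesgue_on {0<..})" using assms by (simp add: sq_int_def)
  then have m: "?f \<in> borel_measurable lebesgue" by (simp add: borel_measurable_restrict_space_iff)
  have sq: "sq_int ?f"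
    by (rule sq_int_cong[OF assms measurable_restrict_space1[OF m]]) (auto simp: indicator_def)
  have sol: "AE x in lebesgue. 0 < x \<longrightarrow> (fsol z v has_vector_derivative Jmat *v (H x *v (z *s fsol z v x))) (at x)"
    using is_sol_fsol[of z v] by (simp add: is_sol_def)
  have "AE x in lebesgue. 0 < x \<longrightarrow> (fsol z v has_vector_derivative Jmat *v (H x *v (z *s ?f x))) (at x)"
    using sol by eventually_elim (auto simp: indicator_def)
  moreover have "loc_abs_cont (fsol z v)"
    using is_sol_fsol[of z v] unfolding loc_abs_cont_def is_sol_def
    by (auto intro: abs_cont_on_subset[where a = 0])
  ultimately show ?thesis
    unfolding T_rep_iff using m sq by (auto intro: smult_measurable sq_int_smult simp: indicator_def)
qed

text \<open>If \<open>H u = 0\<close> then \<open>u' = 0\<close>, so \<open>u\<close> is the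
  constant \<open>v\<close> and definiteness applies.\<close>

lemma solution_null_imp_zero:
  assumes "AE x in lebesgue. 0 < x \<longrightarrow> H x *v fsol z v x = 0"
  shows "v = 0"
proof (rule H_definite)
  have const: "fsol z v b = v" if "0 < b" for b
  proof -
    have "AE x in lebesgue. 0 < x \<longrightarrow> (fsol z v has_vector_derivative Jmat *v (H x *v (z *s fsol z v x))) (at x)"
      using is_sol_fsol[of z v] by (simp add: is_sol_def)
    then have "AE x in lebesgue. 0 < x \<and> x < b \<longrightarrow> (fsol z v has_vector_derivative 0) (at x)"
      using assms by eventually_elim (auto simp: mv_smult)
    moreover have "abs_cont_on 0 b (fsol z v)" using is_sol_fsol[of z v] by (simp add: is_sol_def)
    ultimately have "((\<lambda>x. 0) has_integral (fsol z v b - fsol z v 0)) {0..b}"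
      using that by (intro fundamental_theorem_of_calculus_abs_cont) auto
    then show ?thesis using has_integral_unique[OF _ has_integral_0] by (fastforce simp: fsol_0)
  qed
  show "AE x in lebesgue. 0 < x \<longrightarrow> H x *v v = 0"
    using assms by eventually_elim (use const in auto)
qed

text \<open>\<open>solution_null_imp_zero\<close> converts independence of initial values into
  independence modulo null functions.\<close>

lemma def_index_ge:
  assumes sq: "\<And>i. i < k \<Longrightarrow> sq_int (fsol z (v i))"
    and indep: "\<And>c. (\<Sum>i<k. c i *s v i) = 0 \<Longrightarrow> \<forall>i<k. c i = 0"
  shows "enat k \<le> def_index H z"
  unfolding def_index_def
proof (intro Sup_upper CollectI exI[of _ k] conjI refl)
  let ?f = "\<lambda>i x. indicator {0<..} x *\<^sub>R fsol z (v i) x"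
  show "\<exists>fs. (\<forall>i<k. Tmax H (fs i) (\<lambda>x. z *s fs i x)) \<and>
      (\<forall>c. Hnull H (\<lambda>x. \<Sum>i<k. c i *s fs i x) \<longrightarrow> (\<forall>i<k. c i = 0))"
  proof (intro exI[of _ ?f] conjI allI impI)
    fix i assume "i < k"
    then show "Tmax H (?f i) (\<lambda>x. z *s ?f i x)"
      unfolding Tmax_def using T_rep_solution[OF sq] by blast
  next
    fix c i assume null: "Hnull H (\<lambda>x. \<Sum>i<k. c i *s ?f i x)" and "i < k"
    have "?f i \<in> borel_measurable (lebesgue_on {0<..})" if "i < k" for i
      using T_rep_solution[OF sq[OF that]] by (simp add: T_rep_iff sq_int_def)
    then have "(\<lambda>x. \<Sum>i<k. c i *s ?f i x) \<in> borel_measurable (lebesgue_on {0<..})"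
      by (intro borel_measurable_sum smult_measurable) auto
    then have "AE x in lebesgue. 0 < x \<longrightarrow> H x *v (\<Sum>i<k. c i *s ?f i x) = 0"
      using null by (simp add: Hnull_iff)
    then have "AE x in lebesgue. 0 < x \<longrightarrow> H x *v fsol z (\<Sum>i<k. c i *s v i) x = 0"
      by eventually_elim (simp add: fsol_sum fsol_smult)
    then have "(\<Sum>i<k. c i *s v i) = 0" by (rule solution_null_imp_zero)
    then show "c i = 0" using indep \<open>i < k\<close> by blast
  qed
qed

lemma sum_axis_eq_0:
  fixes h :: "nat \<Rightarrow> 'n"
  assumes h: "bij_betw h {..<k} UNIV" and 0: "(\<Sum>i<k. c i *s axis (h i) 1) = (0 :: complex^'n)" and "i < k"
  shows "c i = 0"
proof -
  have "(\<Sum>j<k. c j *s axis (h j) 1) $ h i = (\<Sum>j<k. if j = i then c j else 0)"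
  proof -
    have "h i = h j \<longleftrightarrow> j = i" if "j < k" for j
      using h \<open>i < k\<close> that by (auto simp: bij_betw_def inj_on_def)
    then show ?thesis by (simp add: axis_def if_distrib[of "\<lambda>y. _ * y"] cong: if_cong)
  qed
  then show ?thesis using 0 \<open>i < k\<close> by simp
qed

text \<open>Under \<open>bproj z\<close> the initial values become the unit vectors, so they are
  independent whatever the components \<open>q\<close> are.\<close>

lemma card_le_def_index:
  assumes z: "z = \<i> \<or> z = - \<i>"
  shows "enat CARD('n) \<le> def_index H z"
proof -
  have z0: "z \<noteq> 0" using z by auto
  obtain h where h: "bij_betw h {..<CARD('n)} (UNIV :: 'n set)"
    using ex_bij_betw_nat_finite[of "UNIV :: 'n set"] by (auto simp: atLeast0LessThan)
  obtain q where q: "\<And>p. sq_int (fsol z (bcomb z p (q p)))"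
    using sq_int_solution_exists[OF z] by metis
  let ?v = "\<lambda>i. bcomb z (axis (h i) 1) (q (axis (h i) 1))"
  show ?thesis
  proof (rule def_index_ge[of _ z ?v])
    fix c assume "(\<Sum>i<CARD('n). c i *s ?v i) = 0"
    then have "bproj z (\<Sum>i<CARD('n). c i *s ?v i) = 0" by simp
    then have "(\<Sum>i<CARD('n). c i *s axis (h i) 1) = (0 :: complex^'n)"
      by (simp add: linear_sum[OF linear_bproj] bproj_smult z0)
    then show "\<forall>i<CARD('n). c i = 0" using sum_axis_eq_0[OF h] by blast
  qed (rule q)
qed

text \<open>The additional initial value is killed by \<open>bproj z\<close>, so the first n
  coefficients are detected as before and the last one by \<open>bproj (- z)\<close>.\<close>

lemma Suc_card_le_def_index:
  assumes z: "z = \<i> \<or> z = - \<i>" and "r \<noteq> 0" "sq_int (fsol z (bcomb z 0 r))"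
  shows "enat (Suc CARD('n)) \<le> def_index H z"
proof -
  have z0: "z \<noteq> 0" using z by auto
  obtain h where h: "bij_betw h {..<CARD('n)} (UNIV :: 'n set)"
    using ex_bij_betw_nat_finite[of "UNIV :: 'n set"] by (auto simp: atLeast0LessThan)
  obtain q where q: "\<And>p. sq_int (fsol z (bcomb z p (q p)))"
    using sq_int_solution_exists[OF z] by metis
  let ?v = "\<lambda>i. if i < CARD('n) then bcomb z (axis (h i) 1) (q (axis (h i) 1)) else bcomb z 0 r"
  show ?thesis
  proof (rule def_index_ge[of _ z ?v])
    fix c assume 0: "(\<Sum>i<Suc CARD('n). c i *s ?v i) = 0"
    then have "bproj z (\<Sum>i<Suc CARD('n). c i *s ?v i) = 0" by simp
    then have "(\<Sum>i<CARD('n). c i *s axis (h i) 1) = (0 :: complex^'n)"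
      by (simp add: linear_sum[OF linear_bproj] bproj_add bproj_smult z0)
    then have c: "\<forall>i<CARD('n). c i = 0" using sum_axis_eq_0[OF h] by blast
    then have "c CARD('n) *s bcomb z 0 r = 0" using 0 by simp
    then have "bproj (- z) (c CARD('n) *s bcomb z 0 r) = 0" by (simp only: bproj_0)
    then have "c CARD('n) *s r = 0" by (simp add: bproj_smult z0)
    then have "c CARD('n) = 0" using \<open>r \<noteq> 0\<close> by simp
    then show "\<forall>i<Suc CARD('n). c i = 0" using c less_Suc_eq by auto
  qed (use q assms in auto)
qed

text \<open>Energies over larger intervals dominate. Letting the right end go to infinity and then
  the left end to 0 bounds four times the energy by \<open>bform z l\<close>, which is nonpositive
  once \<open>bproj z l = 0\<close>.\<close>

lemma eigen_energy_zero:
  assumes z: "z = \<i> \<or> z = - \<i>" and u: "T_rep H f (\<lambda>x. z *s f x) u"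
    and inf: "((\<lambda>x. bform z (u x)) \<longlongrightarrow> 0) at_top"
    and l: "(u \<longlongrightarrow> l) (at_right 0)" and "bproj z l = 0"
  shows "integral {0<..} (qf H u) = 0"
proof -
  note sq = T_rep_sq_int[OF u]
  have le: "integral {a..b} (qf H u) \<le> 0" if "0 < a" "a \<le> b" for a b
  proof -
    have E: "(qf H u has_integral (bform z (u a') - bform z (u b')) / 4) {a'..b'}" if "0 < a'" "a' \<le> b'" for a' b'
      using energy_has_integral[OF that(2) z T_rep_eigen_solves_on[OF u that(1)]] .
    have 1: "4 * integral {a..b} (qf H u) \<le> bform z (u a') - bform z (u b')" if "0 < a'" "a' \<le> a" "b \<le> b'" for a' b'
    proof -
      have "a' \<le> b'" using that \<open>a \<le> b\<close> by simp
      have "integral {a..b} (qf H u) \<le> integral {a'..b'} (qf H u)"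
        using E[OF \<open>0 < a\<close> \<open>a \<le> b\<close>] E[OF \<open>0 < a'\<close> \<open>a' \<le> b'\<close>] that
        by (intro integral_subset_le) (auto simp: qf_nonneg)
      also have "\<dots> = (bform z (u a') - bform z (u b')) / 4"
        using E[OF \<open>0 < a'\<close> \<open>a' \<le> b'\<close>] by (rule integral_unique)
      finally show ?thesis by simp
    qed
    have 2: "4 * integral {a..b} (qf H u) \<le> bform z (u a')" if "0 < a'" "a' \<le> a" for a'
    proof (rule tendsto_lowerbound)
      show "((\<lambda>b'. bform z (u a') - bform z (u b')) \<longlongrightarrow> bform z (u a')) at_top"
        using tendsto_diff[OF tendsto_const inf, of "bform z (u a')"] by simp
      show "\<forall>\<^sub>F b' in at_top. 4 * integral {a..b} (qf H u) \<le> bform z (u a') - bform z (u b')"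
        using eventually_ge_at_top[of b] by eventually_elim (use 1 that in auto)
    qed simp
    have "4 * integral {a..b} (qf H u) \<le> bform z l"
    proof (rule tendsto_lowerbound)
      show "((\<lambda>x. bform z (u x)) \<longlongrightarrow> bform z l) (at_right 0)" by (rule tendsto_bform[OF l])
      show "\<forall>\<^sub>F a' in at_right 0. 4 * integral {a..b} (qf H u) \<le> bform z (u a')"
        using eventually_at_right_less[of "0::real"] eventually_at_right_real[OF \<open>0 < a\<close>]
        by eventually_elim (use 2 in auto)
    qed simp
    also have "bform z l \<le> 0" using \<open>bproj z l = 0\<close> by (simp add: bform_def)
    finally show ?thesis by simp
  qed
  have "integral {0<..} (qf H u) \<le> 0"
  proof (rule tendsto_upperbound[OF sq_int_tendsto[OF sq]])
    show "\<forall>\<^sub>F k in sequentially. integral {inverse (real (Suc k))..real k} (qf H u) \<le> 0"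
    proof (rule always_eventually, rule allI)
      fix k
      show "integral {inverse (real (Suc k))..real k} (qf H u) \<le> 0"
        using le[of "inverse (real (Suc k))" "real k"] by (cases "inverse (real (Suc k)) \<le> real k") auto
    qed
  qed simp
  moreover have "0 \<le> integral {0<..} (qf H u)"
    using sq by (intro integral_nonneg) (auto simp: sq_int_def qf_nonneg)
  ultimately show ?thesis by simp
qed

text \<open>More than n kernel elements have limits at 0 whose images under \<open>bproj z\<close>
  are dependent. The corresponding combination has zero energy, hence is null, against
  independence.\<close>

lemma def_index_le_card:
  assumes z: "z = \<i> \<or> z = - \<i>"
    and lim: "\<And>f g f0. T_rep H f g f0 \<Longrightarrow> ((\<lambda>x. hip (f0 x) (Jmat *v f0 x)) \<longlongrightarrow> 0) at_top"
  shows "def_index H z \<le> enat CARD('n)"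
  unfolding def_index_def
proof (rule Sup_least, clarify)
  fix k :: nat and fs
  assume T: "\<forall>i<k. Tmax H (fs i) (\<lambda>x. z *s fs i x)"
    and indep: "\<forall>c. Hnull H (\<lambda>x. \<Sum>i<k. c i *s fs i x) \<longrightarrow> (\<forall>i<k. c i = 0)"
  show "enat k \<le> enat CARD('n)"
  proof (rule ccontr)
    assume "\<not> enat k \<le> enat CARD('n)"
    then have k: "CARD('n) < k" by simp
    obtain u where u: "\<And>i. i < k \<Longrightarrow> T_rep H (fs i) (\<lambda>x. z *s fs i x) (u i)"
      using T unfolding Tmax_def by metis
    obtain l where l: "\<And>i. i < k \<Longrightarrow> (u i \<longlongrightarrow> l i) (at_right 0)"
      using T_rep_limit_at_0[OF u] by metis
    obtain c where c: "\<exists>i<k. c i \<noteq> 0" "(\<Sum>i<k. c i *s bproj z (l i)) = 0"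
      using nontrivial_relation[OF k] by metis
    let ?f = "\<lambda>x. \<Sum>i<k. c i *s fs i x" and ?u = "\<lambda>x. \<Sum>i<k. c i *s u i x"
    have "T_rep H ?f (\<lambda>x. \<Sum>i<k. c i *s (z *s fs i x)) ?u"
      by (intro T_rep_sum T_rep_smult u) auto
    then have Tu: "T_rep H ?f (\<lambda>x. z *s ?f x) ?u"
      by (simp add: vec.scale_sum_right mult.commute)
    have "((\<lambda>x. - 2 * z * hip (?u x) (Jmat *v ?u x)) \<longlongrightarrow> - 2 * z * 0) at_top"
      by (intro tendsto_intros lim[OF Tu])
    then have "((\<lambda>x. complex_of_real (bform z (?u x))) \<longlongrightarrow> complex_of_real 0) at_top"
      by (simp add: bform_eq[OF z])
    then have inf: "((\<lambda>x. bform z (?u x)) \<longlongrightarrow> 0) at_top"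
      by (simp only: tendsto_of_real_iff)
    have lim0: "(?u \<longlongrightarrow> (\<Sum>i<k. c i *s l i)) (at_right 0)"
      using l by (intro tendsto_sum bounded_linear.tendsto[OF bounded_linear_smult]) auto
    have "bproj z (\<Sum>i<k. c i *s l i) = 0"
      using c(2) by (simp add: linear_sum[OF linear_bproj] bproj_smult)
    from eigen_energy_zero[OF z Tu inf lim0 this] have "Hnull H ?u"
      unfolding Hnull_def using Hform_eq[OF T_rep_sq_int[OF Tu]] by simp
    then have "AE x in lebesgue. 0 < x \<longrightarrow> H x *v ?u x = 0"
      using T_rep_sq_int[OF Tu] by (simp add: Hnull_iff sq_int_def)
    moreover have "AE x in lebesgue. 0 < x \<longrightarrow> H x *v ?f x = H x *v ?u x"
      using Tu unfolding T_rep_iff by blast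
    ultimately have "AE x in lebesgue. 0 < x \<longrightarrow> H x *v ?f x = 0"
      by eventually_elim auto
    moreover have "?f \<in> borel_measurable (lebesgue_on {0<..})"
      using Tu unfolding T_rep_iff sq_int_def by blast
    ultimately have "Hnull H ?f" by (simp add: Hnull_iff)
    then show False using indep c(1) by blast
  qed
qed

text \<open>If the form has norm at least \<open>e\<close> arbitrarily far out, then
  \<open>bform \<i>\<close> has absolute value at least \<open>2 * e\<close> there, so
  \<open>bform \<i>\<close> or its negative \<open>bform (- \<i>)\<close> falls below
  \<open>- e\<close> arbitrarily far out. The extra solution for that z exceeds the index
  bound.\<close>

lemma boundary_form_tendsto_0:
  assumes idx: "\<And>z. z = \<i> \<or> z = - \<i> \<Longrightarrow> def_index H z \<le> enat CARD('n)" and f: "T_rep H f g f0"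
  shows "((\<lambda>x. hip (f0 x) (Jmat *v f0 x)) \<longlongrightarrow> 0) at_top"
proof (rule ccontr)
  assume "\<not> ?thesis"
  then obtain e where "e > 0" and e: "\<not> (\<forall>\<^sub>F x in at_top. norm (hip (f0 x) (Jmat *v f0 x)) < e)"
    unfolding tendsto_iff dist_norm by auto
  have *: "\<exists>x\<ge>N. norm (hip (f0 x) (Jmat *v f0 x)) \<ge> e" for N
    using e unfolding eventually_at_top_linorder by (meson not_le)
  have "\<exists>z. (z = \<i> \<or> z = - \<i>) \<and> (\<forall>N. \<exists>x\<ge>N. bform z (f0 x) \<le> - e)"
  proof (rule ccontr)
    assume "\<not> ?thesis"
    then obtain N1 N2 where N: "\<And>x. x \<ge> N1 \<Longrightarrow> bform \<i> (f0 x) > - e" "\<And>x. x \<ge> N2 \<Longrightarrow> bform (- \<i>) (f0 x) > - e"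
      by (metis not_le)
    obtain x where x: "x \<ge> max N1 N2" "norm (hip (f0 x) (Jmat *v f0 x)) \<ge> e" using * by blast
    have "\<bar>bform \<i> (f0 x)\<bar> = 2 * norm (hip (f0 x) (Jmat *v f0 x))" by (rule norm_bform) simp
    moreover have "bform \<i> (f0 x) > - e" "bform \<i> (f0 x) < e"
      using N[of x] x(1) by (auto simp: bform_uminus)
    ultimately show False using x(2) \<open>e > 0\<close> by linarith
  qed
  then obtain z where z: "z = \<i> \<or> z = - \<i>" and zN: "\<And>N. \<exists>x\<ge>N. bform z (f0 x) \<le> - e" by blast
  \<comment> \<open>The added 1 keeps all points to the right of the base point 1.\<close>
  have "\<exists>x. x \<ge> real k + 1 \<and> bform z (f0 x) \<le> - e" for k :: nat using zN by blast
  then obtain L where L: "\<And>k::nat. L k \<ge> real k + 1" "\<And>k. bform z (f0 (L k)) \<le> - e" by metis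
  have "real k \<le> L k" for k using L(1)[of k] by linarith
  then have L_top: "filterlim L at_top sequentially"
    by (intro filterlim_at_top_mono[OF filterlim_real_sequentially] always_eventually) auto
  have L1: "1 \<le> L k" for k using L(1)[of k] by linarith
  have "sq_int g" using f unfolding T_rep_iff by blast
  then obtain q where "q \<noteq> 0" "sq_int (fsol z (bcomb z 0 q))"
    using sq_int_solution_from_boundary[OF z T_rep_sq_int[OF f] _ T_rep_solves_on[OF f zero_less_one]
        \<open>e > 0\<close> L_top L1 L(2)] by blast
  from Suc_card_le_def_index[OF z this] idx[OF z] have "enat (Suc CARD('n)) \<le> enat CARD('n)"
    by (rule order_trans)
  then show False by simp
qed

text \<open>With s the wanted pairing and t the pairing in exchanged order, \<open>f0 + h0\<close>
  gives s + t and \<open>f0 + \<i> h0\<close> gives \<i> (s - t); these two determine s.\<close>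

lemma boundary_pairing_tendsto_0:
  assumes lim: "\<And>f g f0. T_rep H f g f0 \<Longrightarrow> ((\<lambda>x. hip (f0 x) (Jmat *v f0 x)) \<longlongrightarrow> 0) at_top"
    and f: "T_rep H f g f0" and h: "T_rep H h k h0"
  shows "((\<lambda>x. hip (f0 x) (Jmat *v h0 x)) \<longlongrightarrow> 0) at_top"
proof -
  let ?b = "\<lambda>v w x. hip (v x) (Jmat *v w x)"
  have 1: "((\<lambda>x. ?b (\<lambda>x. f0 x + h0 x) (\<lambda>x. f0 x + h0 x) x - ?b f0 f0 x - ?b h0 h0 x) \<longlongrightarrow> 0 - 0 - 0) at_top"
    by (intro tendsto_diff lim[OF T_rep_add[OF f h]] lim[OF f] lim[OF h])
  have 2: "((\<lambda>x. ?b (\<lambda>x. f0 x + \<i> *s h0 x) (\<lambda>x. f0 x + \<i> *s h0 x) x - ?b f0 f0 x - ?b h0 h0 x) \<longlongrightarrow> 0 - 0 - 0) at_top"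
    by (intro tendsto_diff lim[OF T_rep_add[OF f T_rep_smult[OF h]]] lim[OF f] lim[OF h])
  have "((\<lambda>x. (?b (\<lambda>x. f0 x + h0 x) (\<lambda>x. f0 x + h0 x) x - ?b f0 f0 x - ?b h0 h0 x) / 2 -
      \<i> / 2 * (?b (\<lambda>x. f0 x + \<i> *s h0 x) (\<lambda>x. f0 x + \<i> *s h0 x) x - ?b f0 f0 x - ?b h0 h0 x))
      \<longlongrightarrow> 0 / 2 - \<i> / 2 * 0) at_top"
    using 1 2 by (intro tendsto_intros) auto
  moreover have "(?b (\<lambda>x. f0 x + h0 x) (\<lambda>x. f0 x + h0 x) x - ?b f0 f0 x - ?b h0 h0 x) / 2 -
      \<i> / 2 * (?b (\<lambda>x. f0 x + \<i> *s h0 x) (\<lambda>x. f0 x + \<i> *s h0 x) x - ?b f0 f0 x - ?b h0 h0 x) = ?b f0 h0 x" for x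
    by (simp add: mv_add mv_smult hip_add_left hip_add_right hip_smult_left hip_smult_right field_simps)
  ultimately show ?thesis by simp
qed

text \<open>\<open>card_le_def_index\<close> holds unconditionally, so both directions turn on the
  upper bounds for the indices.\<close>

theorem limit_point_iff:
  "(def_index H \<i> = enat CARD('n) \<and> def_index H (-\<i>) = enat CARD('n)) \<longleftrightarrow>
    (\<forall>f g h k f0 h0. T_rep H f g f0 \<and> T_rep H h k h0 \<longrightarrow>
        ((\<lambda>x. hip (f0 x) (Jmat *v h0 x)) \<longlongrightarrow> 0) at_top)" (is "?I \<longleftrightarrow> ?L")
proof
  assume ?I
  then have "def_index H z \<le> enat CARD('n)" if "z = \<i> \<or> z = - \<i>" for z using that by auto
  then have "((\<lambda>x. hip (f0 x) (Jmat *v f0 x)) \<longlongrightarrow> 0) at_top" if "T_rep H f g f0" for f g f0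
    using that by (rule boundary_form_tendsto_0)
  then show ?L using boundary_pairing_tendsto_0 by blast
next
  assume L: ?L
  have "((\<lambda>x. hip (f0 x) (Jmat *v f0 x)) \<longlongrightarrow> 0) at_top" if "T_rep H f g f0" for f g f0
    using L that by blast
  then have "def_index H z = enat CARD('n)" if "z = \<i> \<or> z = - \<i>" for z
    using that by (intro antisym card_le_def_index def_index_le_card)
  then show ?I by simp
qed

end

section \<open>From almost everywhere to pointwise positivity\<close>

lemma psd_zero: "psd (0 :: complex^'m::finite^'m)"
  unfolding psd_def by simp

lemma Hform_cong:
  assumes "AE x in lebesgue. 0 < x \<longrightarrow> G x = H x"
  shows "Hform G f = Hform H f"
  unfolding Hform_def
  by (rule nn_integral_cong_AE, use assms in eventually_elim) (auto simp: indicator_def)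

lemma T_rep_cong:
  assumes ae: "AE x in lebesgue. 0 < x \<longrightarrow> G x = H x"
  shows "T_rep G f g f0 \<longleftrightarrow> T_rep H f g f0"
proof -
  have "(AE x in lebesgue. 0 < x \<longrightarrow> (\<exists>d. (f0 has_vector_derivative d) (at x) \<and> Jmat *v d = - (G x *v g x))) \<longleftrightarrow>
      (AE x in lebesgue. 0 < x \<longrightarrow> (\<exists>d. (f0 has_vector_derivative d) (at x) \<and> Jmat *v d = - (H x *v g x)))"
    by (intro eventually_cong, use ae in eventually_elim) auto
  then show ?thesis
    unfolding T_rep_def L2H_def Hnull_def Hform_cong[OF ae] by simp
qed

lemma def_index_cong:
  assumes ae: "AE x in lebesgue. 0 < x \<longrightarrow> G x = H x"
  shows "def_index G \<mu> = def_index H \<mu>"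
  unfolding def_index_def Tmax_def Hnull_def Hform_cong[OF ae] T_rep_cong[OF ae] ..

theorem theorem4p1:
  fixes H :: "real \<Rightarrow> complex^('n::finite + 'n)^('n + 'n)"
  assumes meas: "H \<in> borel_measurable lebesgue"
    and int0: "\<exists>c>0. set_integrable lebesgue {0<..<c} H"
    and intloc: "\<forall>a b. 0 < a \<longrightarrow> a \<le> b \<longrightarrow> set_integrable lebesgue {a..b} H"
    and nonneg: "AE x in lebesgue. 0 < x \<longrightarrow> psd (H x)"
    and definite: "\<forall>v. (AE x in lebesgue. 0 < x \<longrightarrow> H x *v v = 0) \<longrightarrow> v = 0"
  shows "(def_index H \<i> = enat CARD('n) \<and> def_index H (-\<i>) = enat CARD('n)) \<longleftrightarrow>
    (\<forall>f g h k f0 h0. T_rep H f g f0 \<and> T_rep H h k h0 \<longrightarrow>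
        ((\<lambda>x. hip (f0 x) (Jmat *v h0 x)) \<longlongrightarrow> 0) at_top)"
proof -
  obtain N where N: "negligible N" "{x. \<not> (0 < x \<longrightarrow> psd (H x))} \<subseteq> N"
    using nonneg unfolding eventually_ae_filter_negligible by blast
  \<comment> \<open>\<open>G\<close> agrees with \<open>H\<close> almost everywhere on the half
    line, which is all that \<open>Hform\<close>, \<open>T_rep\<close> and \<open>def_index\<close>
    see.\<close>
  define G where "G x = (if 0 < x \<and> psd (H x) then H x else 0)" for x
  have ae: "AE x in lebesgue. 0 < x \<longrightarrow> G x = H x"
    using nonneg by eventually_elim (auto simp: G_def)
  have spike: "G x = indicator {0<..} x *\<^sub>R H x" if "x \<notin> N" for x
    using that N(2) by (auto simp: G_def indicator_def)
  interpret canonical_system G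
  proof
    have m: "(\<lambda>x. indicator {0<..} x *\<^sub>R H x) \<in> borel_measurable lebesgue"
      by (intro borel_measurable_scaleR borel_measurable_indicator meas) simp
    have "AE x in lebesgue. indicator {0<..} x *\<^sub>R H x = G x"
      using nonneg by eventually_elim (auto simp: G_def)
    with m show "G \<in> borel_measurable lebesgue"
      by (rule borel_measurable_AE)
    show "psd (G x)" for x
      by (simp add: G_def psd_zero)
    fix b :: real
    obtain c where "c > 0" and c: "H absolutely_integrable_on {0<..<c}" using int0 by blast
    \<comment> \<open>The two pieces overlap, and \<open>max\<close> keeps the second one a proper
      interval for every real \<open>b\<close>.\<close>
    have "H absolutely_integrable_on ({0<..<c} \<union> {c/2..max (c/2) b})"
      using c intloc \<open>c > 0\<close> by (intro absolutely_integrable_Un) auto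
    then have "H absolutely_integrable_on {0<..b}"
      by (rule set_integrable_subset) (use \<open>c > 0\<close> in auto)
    then have "H absolutely_integrable_on {0..b}"
      by (rule absolutely_integrable_spike_set) (auto intro: negligible_subset[of "{0}"])
    then show "G absolutely_integrable_on {0..b}"
      by (rule absolutely_integrable_spike[OF _ negligible_insert[THEN iffD2, OF N(1), of 0]]) (use spike in \<open>auto simp: indicator_def\<close>)
  next
    fix v :: "complex^('n + 'n)"
    assume "AE x in lebesgue. 0 < x \<longrightarrow> G x *v v = 0"
    with ae have "AE x in lebesgue. 0 < x \<longrightarrow> H x *v v = 0" by eventually_elim auto
    then show "v = 0" using definite by blast
  qed
  show ?thesis
    using limit_point_iff unfolding def_index_cong[OF ae] T_rep_cong[OF ae] .
qed

end
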